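(* Let $K$ be a commutative ring with unit that is both a $\mathbb{Q}$-ring (contains $\mathbb{Q}$ as a subring) and an integral domain, let $\chi=(\chi_d\colon W_d\to U(K))_{d\ge1}$ be an $\omega$-invariant sequence of characters, and let $E$ be a $K$-module with finite basis. Let $d$ and $q\ge0$ be integers with non-negative sum $n=d+q$. Then for any decomposable $q$-$\chi$-vector $a=a_1\chi\ldots\chi a_q\in[\chi]^q(E)$ and any decomposable $n$-$\chi$-form $a^*=a_1^*\chi\ldots\chi a_n^*\in[\chi]^n(E^* )$, the left inner product $a\rfloor a^*$ is the $d$-$\chi$-form $$\sum_{\rho\in M(\chi;n;d,q)}\chi(\rho)\,\langle a_1\chi\ldots\chi a_q,\ a_{\rho(d+1)}^*\chi\ldots\chi a_{\rho(n)}^*\rangle\ a_{\rho(1)}^*\chi\ldots\chi a_{\rho(d)}^*$$ in case $n\ge q$, and $0$ in case $n<q$.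
   Context: $S_\infty$ is the group of permutations of the positive integers fixing all but finitely many elements, $S_d\le S_\infty$ the subgroup fixing all $t>d$, and $\omega\colon S_\infty\to S_\infty$ the injective endomorphism $(\omega(\sigma))(1)=1$, $(\omega(\sigma))(t)=\sigma(t-1)+1$ for $t\ge2$. A sequence of group homomorphisms $\chi=(\chi_d\colon W_d\to U(K))_{d\ge1}$ ($U(K)$ the group of units of $K$) is $\omega$-invariant if $W_d\le S_d$, $W_d\le W_{d+1}$, $\omega(W_d)\le W_{d+1}$, and $\chi_{d+1}|_{W_d}=\chi_d=\chi_{d+1}\circ\omega|_{W_d}$ for all $d\ge1$. We write $\chi(\sigma)=\chi_d(\sigma)$ for $\sigma\in W_d$, and $W_0$ is trivial. It is known that then $\chi_d=\chi_d^{-1}$ for all $d$. $S_d$ acts on $T^d(E)$ by $\sigma(x_1\otimes\cdots\otimes x_d)=x_{\sigma^{-1}(1)}\otimes\cdots\otimes x_{\sigma^{-1}(d)}$. $[\chi]^d(E)$ is the quotient of $T^d(E)$ by the submodule generated by all $\chi_d(\sigma)^{-1}z-\sigma z$, $\sigma\in W_d$, $z\in T^d(E)$; $[\chi]^0(E)=K$, and $[\chi]^d(E)=0$ for $d<0$; the image of $x_1\otimes\cdots\otimes x_d$ is $x_1\chi\ldots\chi x_d$ (a decomposable $d$-$\chi$-vector; for $E^*$ in place of $E$, a decomposable $d$-$\chi$-form). $[\chi](E)=\coprod_{d}[\chi]^d(E)$ is an associative graded $K$-algebra with product (also denoted by $\chi$) $(x_1\chi\ldots\chi x_d)\chi(y_1\chi\ldots\chi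 y_e)=x_1\chi\ldots\chi x_d\chi y_1\chi\ldots\chi y_e$. $\langle\ ,\ \rangle\colon[\chi](E)\times[\chi](E^* )\to K$ is the bilinear form for which components of different degrees are orthogonal, $\langle x_1\chi\ldots\chi x_d,x_1^*\chi\ldots\chi x_d^*\rangle=\sum_{\sigma\in W_d}\chi(\sigma)\prod_{t=1}^d x_t^*(x_{\sigma^{-1}(t)})$ for $d\ge1$, and $\langle k,k^*\rangle=kk^*$ in degree $0$; it induces isomorphisms $[\chi]^d(E^* )\cong([\chi]^d(E))^*$, hence identifies $[\chi](E^* )$ with the graded dual of $[\chi](E)$. $M(\chi;n;d,q)$, for $d,q\ge 0$, $d+q=n$, is the set of lexicographically minimal representatives (comparing the words $(\rho(1),\ldots,\rho(n))$) of the left classes $\rho X$ of $W_n$ modulo its subgroup $X=W_d\times\omega^d(W_q)$. Left inner product: for $a\in[\chi](E)$ and $a^*\in[\chi](E^* )$, $a\rfloor a^*\in[\chi](E^* )$ is the image of $a^*$ under the transpose of the right multiplication $x\mapsto x\chi a$ of $[\chi](E)$; i.e. it is the unique element with $\langle x\chi a,a^*\rangle=\langle x,a\rfloor a^*\rangle$ for all $x\in[\chi](E)$. *)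

theory Defs
  imports Complex_Main "HOL-Algebra.Module" "HOL-Algebra.AbelCoset" "HOL-Algebra.Left_Coset"
    "HOL-Algebra.Sym_Groups"
begin

section \<open>Modules over a commutative ring\<close>

definition rat_ring :: "rat ring"
  where "rat_ring = \<lparr>carrier = UNIV, monoid.mult = (*), one = 1, zero = 0, add = (+)\<rparr>"

definition rational_ring :: "('k, 'r) ring_scheme \<Rightarrow> bool"
  where "rational_ring K \<longleftrightarrow> (\<exists>\<phi> \<in> ring_hom rat_ring K. inj \<phi>)"

definition finite_basis :: "('k, 'r) ring_scheme \<Rightarrow> ('k, 'e, 'm) module_scheme \<Rightarrow> 'e set \<Rightarrow> bool"
  where "finite_basis K E B \<longleftrightarrow> finite B \<and> B \<subseteq> carrier E \<and>
    (\<forall>x \<in> carrier E. \<exists>!c. c \<in> B \<rightarrow>\<^sub>E carrier K \<and> x = (\<Oplus>\<^bsub>E\<^esub>b\<in>B. c b \<odot>\<^bsub>E\<^esub> b))"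

text \<open>Maps are extensional (\<^const>\<open>undefined\<close> outside the carrier), so that they are determined by
  their values on the carrier, as \<open>=\<close> and \<open>THE\<close> below require.\<close>

definition linear_maps :: "('k, 'r) ring_scheme \<Rightarrow> ('k, 'a, 'm) module_scheme
    \<Rightarrow> ('k, 'b, 'n) module_scheme \<Rightarrow> ('a \<Rightarrow> 'b) set"
  where "linear_maps K M N = {f \<in> carrier M \<rightarrow>\<^sub>E carrier N.
    (\<forall>x \<in> carrier M. \<forall>y \<in> carrier M. f (x \<oplus>\<^bsub>M\<^esub> y) = f x \<oplus>\<^bsub>N\<^esub> f y) \<and>
    (\<forall>k \<in> carrier K. \<forall>x \<in> carrier M. f (k \<odot>\<^bsub>M\<^esub> x) = k \<odot>\<^bsub>N\<^esub> f x)}"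

definition bilinear_maps :: "('k, 'r) ring_scheme \<Rightarrow> ('k, 'a, 'l) module_scheme
    \<Rightarrow> ('k, 'b, 'm) module_scheme \<Rightarrow> ('k, 'c, 'n) module_scheme \<Rightarrow> ('a \<Rightarrow> 'b \<Rightarrow> 'c) set"
  where "bilinear_maps K L M N = {\<beta> \<in> carrier L \<rightarrow>\<^sub>E linear_maps K M N.
    \<forall>y \<in> carrier M. (\<lambda>x \<in> carrier L. \<beta> x y) \<in> linear_maps K L N}"

definition self_module :: "('k, 'r) ring_scheme \<Rightarrow> ('k, 'k) module"
  where "self_module K = \<lparr>carrier = carrier K, monoid.mult = monoid.mult K, one = \<one>\<^bsub>K\<^esub>,
    zero = \<zero>\<^bsub>K\<^esub>, add = add K, smult = monoid.mult K\<rparr>"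

text \<open>Modules are records extending rings; the components \<^const>\<open>monoid.mult\<close> and \<^const>\<open>one\<close> play no
  role for a module that is not an algebra and are left \<^const>\<open>undefined\<close>.\<close>

definition dual_module :: "('k, 'r) ring_scheme \<Rightarrow> ('k, 'e, 'm) module_scheme
    \<Rightarrow> ('k, 'e \<Rightarrow> 'k) module"
  where "dual_module K E = \<lparr>carrier = linear_maps K E (self_module K),
    monoid.mult = undefined, one = undefined,
    zero = (\<lambda>x \<in> carrier E. \<zero>\<^bsub>K\<^esub>),
    add = (\<lambda>f g. \<lambda>x \<in> carrier E. f x \<oplus>\<^bsub>K\<^esub> g x),
    smult = (\<lambda>k f. \<lambda>x \<in> carrier E. k \<otimes>\<^bsub>K\<^esub> f x)\<rparr>"

definition coprod_module :: "'i set \<Rightarrow> ('i \<Rightarrow> ('k, 'a, 'm) module_scheme) \<Rightarrow> ('k, 'i \<Rightarrow> 'a) module"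
  where "coprod_module I M =
    \<lparr>carrier = {f \<in> (\<Pi>\<^sub>E i\<in>I. carrier (M i)). finite {i \<in> I. f i \<noteq> \<zero>\<^bsub>M i\<^esub>}},
    monoid.mult = undefined, one = undefined,
    zero = (\<lambda>i\<in>I. \<zero>\<^bsub>M i\<^esub>),
    add = (\<lambda>f g. \<lambda>i\<in>I. f i \<oplus>\<^bsub>M i\<^esub> g i),
    smult = (\<lambda>k f. \<lambda>i\<in>I. k \<odot>\<^bsub>M i\<^esub> f i)\<rparr>"

definition free_module :: "('k, 'r) ring_scheme \<Rightarrow> 'i set \<Rightarrow> ('k, 'i \<Rightarrow> 'k) module"
  where "free_module K I = coprod_module I (\<lambda>_. self_module K)"

definition free_gen :: "('k, 'r) ring_scheme \<Rightarrow> 'i set \<Rightarrow> 'i \<Rightarrow> ('i \<Rightarrow> 'k)"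
  where "free_gen K I x = (\<lambda>i\<in>I. if i = x then \<one>\<^bsub>K\<^esub> else \<zero>\<^bsub>K\<^esub>)"

definition submodule_gen :: "('k, 'r) ring_scheme \<Rightarrow> ('k, 'a, 'm) module_scheme \<Rightarrow> 'a set \<Rightarrow> 'a set"
  where "submodule_gen K M S = \<Inter> {N. submodule N K M \<and> S \<subseteq> N}"

definition quot_module :: "('k, 'a, 'm) module_scheme \<Rightarrow> 'a set \<Rightarrow> ('k, 'a set) module"
  where "quot_module M N = \<lparr>carrier = a_rcosets\<^bsub>M\<^esub> N,
    monoid.mult = undefined, one = undefined,
    zero = N,
    add = set_add M,
    smult = (\<lambda>k C. \<Union>x\<in>C. N +>\<^bsub>M\<^esub> (k \<odot>\<^bsub>M\<^esub> x))\<rparr>"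


section \<open>Sequences of characters\<close>

text \<open>The group of permutations of the positive integers fixing all \<open>t > d\<close> is
  \<^term>\<open>sym_group d\<close>; its elements are functions on \<^typ>\<open>nat\<close> that also fix \<open>0\<close>.\<close>

definition \<omega> :: "(nat \<Rightarrow> nat) \<Rightarrow> nat \<Rightarrow> nat"
  where "\<omega> \<sigma> t = (if t \<le> 1 then t else \<sigma> (t - 1) + 1)"

text \<open>The index \<open>d = 0\<close> is included. As \<^term>\<open>sym_group 0\<close> is trivial, this amounts to the
  convention that \<open>W 0\<close> is the trivial group and \<open>\<chi> 0\<close> its trivial character, and every sequence
  indexed by \<open>d \<ge> 1\<close> extends in this way. Only the values of \<open>\<chi> d\<close> on \<open>W d\<close> are relevant.\<close>

definition omega_invariant ::
    "('k, 'r) ring_scheme \<Rightarrow> (nat \<Rightarrow> (nat \<Rightarrow> nat) set) \<Rightarrow> (nat \<Rightarrow> (nat \<Rightarrow> nat) \<Rightarrow> 'k) \<Rightarrow> bool"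
  where "omega_invariant K W \<chi> \<longleftrightarrow> (\<forall>d.
    subgroup (W d) (sym_group d) \<and>
    \<chi> d \<in> hom ((sym_group d)\<lparr>carrier := W d\<rparr>) (units_of K) \<and>
    W d \<subseteq> W (Suc d) \<and> \<omega> ` W d \<subseteq> W (Suc d) \<and>
    (\<forall>\<sigma> \<in> W d. \<chi> (Suc d) \<sigma> = \<chi> d \<sigma> \<and> \<chi> (Suc d) (\<omega> \<sigma>) = \<chi> d \<sigma>))"

definition word :: "nat \<Rightarrow> (nat \<Rightarrow> nat) \<Rightarrow> nat list"
  where "word n \<rho> = map \<rho> [1..<Suc n]"

definition min_reps :: "(nat \<Rightarrow> (nat \<Rightarrow> nat) set) \<Rightarrow> nat \<Rightarrow> nat \<Rightarrow> nat \<Rightarrow> (nat \<Rightarrow> nat) set"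
  where "min_reps W n d q =
    {\<rho>. \<exists>C \<in> lcosets\<^bsub>(sym_group n)\<lparr>carrier := W n\<rparr>\<^esub> (W d <#>\<^bsub>sym_group n\<^esub> (\<omega> ^^ d) ` W q).
      \<rho> \<in> C \<and> (\<forall>\<tau> \<in> C. \<tau> = \<rho> \<or> (word n \<rho>, word n \<tau>) \<in> lex less_than)}"


section \<open>Tensor powers and semi-symmetric powers\<close>

definition tuples :: "('k, 'e, 'm) module_scheme \<Rightarrow> nat \<Rightarrow> (nat \<Rightarrow> 'e) set"
  where "tuples E d = ({1..d} \<rightarrow>\<^sub>E carrier E)"

definition multilinear_relations ::
    "('k, 'r) ring_scheme \<Rightarrow> ('k, 'e, 'm) module_scheme \<Rightarrow> nat \<Rightarrow> ((nat \<Rightarrow> 'e) \<Rightarrow> 'k) set"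
  where "multilinear_relations K E d =
    (let F = free_module K (tuples E d); \<delta> = free_gen K (tuples E d) in
      {\<delta> (x(i := u \<oplus>\<^bsub>E\<^esub> v)) \<ominus>\<^bsub>F\<^esub> (\<delta> (x(i := u)) \<oplus>\<^bsub>F\<^esub> \<delta> (x(i := v))) | x i u v.
        x \<in> tuples E d \<and> i \<in> {1..d} \<and> u \<in> carrier E \<and> v \<in> carrier E} \<union>
      {\<delta> (x(i := k \<odot>\<^bsub>E\<^esub> u)) \<ominus>\<^bsub>F\<^esub> (k \<odot>\<^bsub>F\<^esub> \<delta> (x(i := u))) | x i k u.
        x \<in> tuples E d \<and> i \<in> {1..d} \<and> k \<in> carrier K \<and> u \<in> carrier E})"

text \<open>For \<open>d = 0\<close> there is exactly one tuple and no relation, so the tensor power is the free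
  module on the empty tensor, a copy of \<open>K\<close>.\<close>

definition tensor_submodule ::
    "('k, 'r) ring_scheme \<Rightarrow> ('k, 'e, 'm) module_scheme \<Rightarrow> nat \<Rightarrow> ((nat \<Rightarrow> 'e) \<Rightarrow> 'k) set"
  where "tensor_submodule K E d =
    submodule_gen K (free_module K (tuples E d)) (multilinear_relations K E d)"

definition tensor_power :: "('k, 'r) ring_scheme \<Rightarrow> ('k, 'e, 'm) module_scheme \<Rightarrow> nat
    \<Rightarrow> ('k, ((nat \<Rightarrow> 'e) \<Rightarrow> 'k) set) module"
  where "tensor_power K E d = quot_module (free_module K (tuples E d)) (tensor_submodule K E d)"

definition pure_tensor :: "('k, 'r) ring_scheme \<Rightarrow> ('k, 'e, 'm) module_scheme \<Rightarrow> nat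
    \<Rightarrow> (nat \<Rightarrow> 'e) \<Rightarrow> ((nat \<Rightarrow> 'e) \<Rightarrow> 'k) set"
  where "pure_tensor K E d x = tensor_submodule K E d +>\<^bsub>free_module K (tuples E d)\<^esub>
    free_gen K (tuples E d) (restrict x {1..d})"

text \<open>On the free module, \<open>z \<mapsto> (\<lambda>y. z (y \<circ> \<sigma>))\<close> is the linear map carrying the generator of a
  tuple \<open>x\<close> to that of \<open>x \<circ> inv \<sigma>\<close>. It preserves the multilinearity relations, hence maps cosets
  onto cosets and sends \<open>x\<^sub>1 \<otimes> \<dots> \<otimes> x\<^sub>d\<close> to the tensor whose \<open>t\<close>-th factor has index
  \<open>inv \<sigma> t\<close>.\<close>

definition tensor_act :: "(nat \<Rightarrow> nat) \<Rightarrow> ((nat \<Rightarrow> 'e) \<Rightarrow> 'k) set \<Rightarrow> ((nat \<Rightarrow> 'e) \<Rightarrow> 'k) set"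
  where "tensor_act \<sigma> C = (\<lambda>z y. z (y \<circ> \<sigma>)) ` C"

definition chi_submodule :: "('k, 'r) ring_scheme \<Rightarrow> (nat \<Rightarrow> (nat \<Rightarrow> nat) set)
    \<Rightarrow> (nat \<Rightarrow> (nat \<Rightarrow> nat) \<Rightarrow> 'k) \<Rightarrow> ('k, 'e, 'm) module_scheme \<Rightarrow> nat
    \<Rightarrow> ((nat \<Rightarrow> 'e) \<Rightarrow> 'k) set set"
  where "chi_submodule K W \<chi> E d = (let T = tensor_power K E d in
    submodule_gen K T
      {((inv\<^bsub>K\<^esub> (\<chi> d \<sigma>)) \<odot>\<^bsub>T\<^esub> z) \<ominus>\<^bsub>T\<^esub> tensor_act \<sigma> z | \<sigma> z. \<sigma> \<in> W d \<and> z \<in> carrier T})"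

definition chi_power :: "('k, 'r) ring_scheme \<Rightarrow> (nat \<Rightarrow> (nat \<Rightarrow> nat) set)
    \<Rightarrow> (nat \<Rightarrow> (nat \<Rightarrow> nat) \<Rightarrow> 'k) \<Rightarrow> ('k, 'e, 'm) module_scheme \<Rightarrow> nat
    \<Rightarrow> ('k, ((nat \<Rightarrow> 'e) \<Rightarrow> 'k) set set) module"
  where "chi_power K W \<chi> E d = quot_module (tensor_power K E d) (chi_submodule K W \<chi> E d)"


section \<open>The graded algebra\<close>

definition chi_sum :: "('k, 'r) ring_scheme \<Rightarrow> (nat \<Rightarrow> (nat \<Rightarrow> nat) set)
    \<Rightarrow> (nat \<Rightarrow> (nat \<Rightarrow> nat) \<Rightarrow> 'k) \<Rightarrow> ('k, 'e, 'm) module_scheme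
    \<Rightarrow> ('k, nat \<Rightarrow> ((nat \<Rightarrow> 'e) \<Rightarrow> 'k) set set) module"
  where "chi_sum K W \<chi> E = coprod_module UNIV (chi_power K W \<chi> E)"

definition chi_incl :: "('k, 'r) ring_scheme \<Rightarrow> (nat \<Rightarrow> (nat \<Rightarrow> nat) set)
    \<Rightarrow> (nat \<Rightarrow> (nat \<Rightarrow> nat) \<Rightarrow> 'k) \<Rightarrow> ('k, 'e, 'm) module_scheme \<Rightarrow> nat
    \<Rightarrow> ((nat \<Rightarrow> 'e) \<Rightarrow> 'k) set set \<Rightarrow> nat \<Rightarrow> ((nat \<Rightarrow> 'e) \<Rightarrow> 'k) set set"
  where "chi_incl K W \<chi> E d c = (\<lambda>e. if e = d then c else \<zero>\<^bsub>chi_power K W \<chi> E e\<^esub>)"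

text \<open>Only \<open>x 1, \<dots>, x d\<close> enter; \<^const>\<open>pure_tensor\<close> restricts \<open>x\<close>. The result
  \<open>x 1 \<chi> \<dots> \<chi> x d\<close> is taken in the direct sum, where products and the pairing live.\<close>

definition chi_dec :: "('k, 'r) ring_scheme \<Rightarrow> (nat \<Rightarrow> (nat \<Rightarrow> nat) set)
    \<Rightarrow> (nat \<Rightarrow> (nat \<Rightarrow> nat) \<Rightarrow> 'k) \<Rightarrow> ('k, 'e, 'm) module_scheme \<Rightarrow> nat
    \<Rightarrow> (nat \<Rightarrow> 'e) \<Rightarrow> nat \<Rightarrow> ((nat \<Rightarrow> 'e) \<Rightarrow> 'k) set set"
  where "chi_dec K W \<chi> E d x = chi_incl K W \<chi> E d
    (chi_submodule K W \<chi> E d +>\<^bsub>tensor_power K E d\<^esub> pure_tensor K E d x)"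

definition chi_mult :: "('k, 'r) ring_scheme \<Rightarrow> (nat \<Rightarrow> (nat \<Rightarrow> nat) set)
    \<Rightarrow> (nat \<Rightarrow> (nat \<Rightarrow> nat) \<Rightarrow> 'k) \<Rightarrow> ('k, 'e, 'm) module_scheme
    \<Rightarrow> (nat \<Rightarrow> ((nat \<Rightarrow> 'e) \<Rightarrow> 'k) set set) \<Rightarrow> (nat \<Rightarrow> ((nat \<Rightarrow> 'e) \<Rightarrow> 'k) set set)
    \<Rightarrow> (nat \<Rightarrow> ((nat \<Rightarrow> 'e) \<Rightarrow> 'k) set set)"
  where "chi_mult K W \<chi> E = (let A = chi_sum K W \<chi> E in
    THE \<mu>. \<mu> \<in> bilinear_maps K A A A \<and>
      (\<forall>d e. \<forall>x \<in> {1..d} \<rightarrow> carrier E. \<forall>y \<in> {1..e} \<rightarrow> carrier E.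
        \<mu> (chi_dec K W \<chi> E d x) (chi_dec K W \<chi> E e y) =
          chi_dec K W \<chi> E (d + e) (\<lambda>t. if t \<le> d then x t else y (t - d))))"

text \<open>The empty product \<^term>\<open>chi_dec K W \<chi> E 0 x\<close> does not depend on \<open>x\<close>; it corresponds to
  \<open>1 \<in> K\<close> in degree \<open>0\<close>.\<close>

definition chi_algebra :: "('k, 'r) ring_scheme \<Rightarrow> (nat \<Rightarrow> (nat \<Rightarrow> nat) set)
    \<Rightarrow> (nat \<Rightarrow> (nat \<Rightarrow> nat) \<Rightarrow> 'k) \<Rightarrow> ('k, 'e, 'm) module_scheme
    \<Rightarrow> ('k, nat \<Rightarrow> ((nat \<Rightarrow> 'e) \<Rightarrow> 'k) set set) module"
  where "chi_algebra K W \<chi> E = (chi_sum K W \<chi> E)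
    \<lparr>monoid.mult := chi_mult K W \<chi> E, one := chi_dec K W \<chi> E 0 undefined\<rparr>"


section \<open>The pairing and the left inner product\<close>

text \<open>In degree \<open>0\<close> the formula below reads \<open>\<langle>1, 1\<rangle> = 1\<close>, which by bilinearity is
  \<open>\<langle>k, k'\<rangle> = k k'\<close>.\<close>

definition chi_form :: "('k, 'r) ring_scheme \<Rightarrow> (nat \<Rightarrow> (nat \<Rightarrow> nat) set)
    \<Rightarrow> (nat \<Rightarrow> (nat \<Rightarrow> nat) \<Rightarrow> 'k) \<Rightarrow> ('k, 'e, 'm) module_scheme
    \<Rightarrow> (nat \<Rightarrow> ((nat \<Rightarrow> 'e) \<Rightarrow> 'k) set set)
    \<Rightarrow> (nat \<Rightarrow> ((nat \<Rightarrow> 'e \<Rightarrow> 'k) \<Rightarrow> 'k) set set) \<Rightarrow> 'k"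
  where "chi_form K W \<chi> E =
    (THE \<beta>. \<beta> \<in> bilinear_maps K (chi_algebra K W \<chi> E) (chi_algebra K W \<chi> (dual_module K E))
        (self_module K) \<and>
      (\<forall>d e. \<forall>c \<in> carrier (chi_power K W \<chi> E d). \<forall>c' \<in> carrier (chi_power K W \<chi> (dual_module K E) e).
        d \<noteq> e \<longrightarrow>
        \<beta> (chi_incl K W \<chi> E d c) (chi_incl K W \<chi> (dual_module K E) e c') = \<zero>\<^bsub>K\<^esub>) \<and>
      (\<forall>d. \<forall>x \<in> {1..d} \<rightarrow> carrier E. \<forall>f \<in> {1..d} \<rightarrow> carrier (dual_module K E).
        \<beta> (chi_dec K W \<chi> E d x) (chi_dec K W \<chi> (dual_module K E) d f) =
          (\<Oplus>\<^bsub>K\<^esub>\<sigma>\<in>W d. \<chi> d \<sigma> \<otimes>\<^bsub>K\<^esub> (\<Otimes>\<^bsub>K\<^esub>t\<in>{1..d}. f t (x (inv' \<sigma> t))))))"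

definition left_inner :: "('k, 'r) ring_scheme \<Rightarrow> (nat \<Rightarrow> (nat \<Rightarrow> nat) set)
    \<Rightarrow> (nat \<Rightarrow> (nat \<Rightarrow> nat) \<Rightarrow> 'k) \<Rightarrow> ('k, 'e, 'm) module_scheme
    \<Rightarrow> (nat \<Rightarrow> ((nat \<Rightarrow> 'e) \<Rightarrow> 'k) set set)
    \<Rightarrow> (nat \<Rightarrow> ((nat \<Rightarrow> 'e \<Rightarrow> 'k) \<Rightarrow> 'k) set set)
    \<Rightarrow> (nat \<Rightarrow> ((nat \<Rightarrow> 'e \<Rightarrow> 'k) \<Rightarrow> 'k) set set)"
  where "left_inner K W \<chi> E a f =
    (THE g. g \<in> carrier (chi_algebra K W \<chi> (dual_module K E)) \<and>
      (\<forall>x \<in> carrier (chi_algebra K W \<chi> E).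
        chi_form K W \<chi> E (x \<otimes>\<^bsub>chi_algebra K W \<chi> E\<^esub> a) f = chi_form K W \<chi> E x g))"

end

theory Submission
  imports Defs
begin

text \<open>The pairing \<open>\<langle>x, f\<rangle> = (\<Sum>\<sigma>\<in>W d. \<chi> \<sigma> * (\<Prod>s. f (\<sigma> s) (x s)))\<close> of decomposable vectors and forms
  satisfies a Laplace expansion: every \<open>\<sigma> \<in> W n\<close> is uniquely \<open>\<rho> \<alpha> \<omega>\<^sup>d(\<beta>)\<close> with \<open>\<rho>\<close> a minimal coset
  representative, \<open>\<alpha> \<in> W d\<close> and \<open>\<beta> \<in> W q\<close>, and \<open>\<chi>\<close> is multiplicative on this product, so
  \<open>\<langle>x \<chi> a, f\<rangle>\<close> is the sum over \<open>\<rho>\<close> of \<open>\<chi> \<rho> \<langle>a, f \<circ> \<rho> on {d+1..n}\<rangle> \<langle>x, f \<circ> \<rho> on {1..d}\<rangle>\<close>.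
  The formula follows since the pairing is nondegenerate on the side of the forms: for a basis \<open>B\<close>
  of \<open>E\<close>, the sum of \<open>\<langle>b\<^sub>1 \<chi> \<dots> \<chi> b\<^sub>d, g\<rangle> b\<^sub>1\<^sup>* \<chi> \<dots> \<chi> b\<^sub>d\<^sup>*\<close> over all \<open>d\<close>-tuples in \<open>B\<close> is \<open>|W d|\<close> times \<open>g\<close>,
  and \<open>|W d|\<close> is invertible in \<open>K\<close>.

  Both the compatibility of the pairing with the relations and this identity need \<open>\<chi>\<^sup>2 = 1\<close>. If
  \<open>\<sigma>\<close> moves at least one point, a commutator of \<open>\<sigma>\<close> with one of its shifts is a 3-cycle, so the
  kernel of \<open>\<chi>\<close> contains many 3-cycles; they generate a group containing \<open>\<tau> \<omega>\<^sup>k(\<tau>)\<close> for a suitable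
  shift \<open>\<tau>\<close> of \<open>\<sigma>\<close>, and the value of \<open>\<chi>\<close> there is \<open>\<chi> \<sigma> * \<chi> \<sigma>\<close>.\<close>

section \<open>Permutation groups closed under the shift\<close>

text \<open>The relations let \<sigma> act as the inverse of \<chi> \<sigma> on vectors and forms
  alike, whereas re-indexing the pairing yields the inverse of \<chi> \<sigma> when the vectors are
  permuted and \<chi> \<sigma> itself when the forms are. The two agree only if \<chi> \<sigma> is
  its own inverse. 3-cycles generate even permutations only, so transpositions are obtained in
  pairs: with auxiliary points u, v beyond everything else, the kernel contains (x y)(u v) and (x+D
  y+D)(u v), and in their product (u v) cancels. Both must use the same u and v, which dictates the
  distance D. Room to the right must be unlimited, hence the passage to the union of all W d.
  Product, pairing and left inner product are definite descriptions, so each requires existence and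
  uniqueness before anything can be computed. For product and pairing both come from the universal
  property of the direct sum of the \<chi>-powers, used in one variable at a time. For the left
  inner product, uniqueness is nondegeneracy and existence is the formula itself.\<close>

lemma omega_funpow: "\<sigma> 0 = 0 \<Longrightarrow> (\<omega> ^^ k) \<sigma> t = (if t \<le> k then t else \<sigma> (t - k) + k)"
proof (induction k arbitrary: t)
  case 0
  then show ?case by simp
next
  case (Suc k)
  then show ?case by (auto simp: \<omega>_def)
qed

lemma permutes_interval_0: "\<sigma> permutes {1..d::nat} \<Longrightarrow> \<sigma> 0 = 0"
  by (simp add: permutes_not_in)

lemma permutes_interval_pos: "\<sigma> permutes {1..d::nat} \<Longrightarrow> 0 < t \<Longrightarrow> 0 < \<sigma> t"
  using permutes_interval_0[of \<sigma> d] permutes_inj[of \<sigma> "{1..d}"]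
  by (metis injD neq0_conv)

text \<open>\<tau> maps positive points to positive points, so a point beyond k stays beyond k and
  the second branch of the formula survives composition.\<close>

lemma omega_funpow_comp:
  assumes "\<sigma> permutes {1..d}" "\<tau> permutes {1..e}"
  shows "(\<omega> ^^ k) (\<sigma> \<circ> \<tau>) = (\<omega> ^^ k) \<sigma> \<circ> (\<omega> ^^ k) \<tau>"
proof
  fix t
  show "(\<omega> ^^ k) (\<sigma> \<circ> \<tau>) t = ((\<omega> ^^ k) \<sigma> \<circ> (\<omega> ^^ k) \<tau>) t"
    using permutes_interval_0[OF assms(1)] permutes_interval_0[OF assms(2)]
      permutes_interval_pos[OF assms(2), of "t - k"]
    by (auto simp: omega_funpow)
qed

lemma omega_funpow_permutes:
  assumes "\<sigma> permutes {1..d}"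
  shows "(\<omega> ^^ k) \<sigma> permutes {1 + k..d + k}"
proof (rule bij_imp_permutes)
  have z: "\<sigma> 0 = 0" using assms by (rule permutes_interval_0)
  have "bij_betw (\<lambda>t. \<sigma> (t - k) + k) {1 + k..d + k} {1 + k..d + k}"
  proof (rule bij_betw_byWitness[where f' = "\<lambda>t. inv' \<sigma> (t - k) + k"])
    have *: "t - k \<in> {1..d}" if "t \<in> {1 + k..d + k}" for t using that by auto
    have i: "inv' \<sigma> permutes {1..d}" using assms by (rule permutes_inv)
    show "\<forall>t\<in>{1 + k..d + k}. inv' \<sigma> (\<sigma> (t - k) + k - k) + k = t"
      using assms by (auto simp: permutes_inverses)
    show "\<forall>t\<in>{1 + k..d + k}. \<sigma> (inv' \<sigma> (t - k) + k - k) + k = t"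
      using assms by (auto simp: permutes_inverses)
    show "(\<lambda>t. \<sigma> (t - k) + k) ` {1 + k..d + k} \<subseteq> {1 + k..d + k}"
      using permutes_in_image[OF assms] * by fastforce
    show "(\<lambda>t. inv' \<sigma> (t - k) + k) ` {1 + k..d + k} \<subseteq> {1 + k..d + k}"
      using permutes_in_image[OF i] * by fastforce
  qed
  then show "bij_betw ((\<omega> ^^ k) \<sigma>) {1 + k..d + k} {1 + k..d + k}"
    by (rule bij_betw_cong[THEN iffD1, rotated]) (auto simp: omega_funpow z)
  show "(\<omega> ^^ k) \<sigma> t = t" if "t \<notin> {1 + k..d + k}" for t
  proof (cases "t \<le> k")
    case True
    then show ?thesis by (simp add: omega_funpow z)
  next
    case False
    with that have "t - k \<notin> {1..d}" by auto
    then show ?thesis using False permutes_not_in[OF assms] by (simp add: omega_funpow z)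
  qed
qed

section \<open>Three-cycles and commutators\<close>

definition cyc3 :: "nat \<Rightarrow> nat \<Rightarrow> nat \<Rightarrow> nat \<Rightarrow> nat"
  where "cyc3 p u v = transpose p u \<circ> transpose u v"

lemma conj_transpose:
  assumes "bij g"
  shows "g \<circ> transpose a b \<circ> inv' g = transpose (g a) (g b)"
proof
  fix x
  obtain y where "x = g y" using assms by (metis bij_pointE)
  then show "(g \<circ> transpose a b \<circ> inv' g) x = transpose (g a) (g b) x"
    using assms by (auto simp: transpose_def bij_is_inj inj_eq)
qed

lemma conj_comp:
  assumes "bij g"
  shows "g \<circ> (a \<circ> b) \<circ> inv' g = (g \<circ> a \<circ> inv' g) \<circ> (g \<circ> b \<circ> inv' g)"
  using assms by (auto simp: fun_eq_iff bij_is_inj)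

text \<open>Conjugation acts on each of the two transpositions that make up \<open>cyc3\<close>, so
  the identity holds for arbitrary points. For distinct ones \<open>cyc3 p u v\<close> is the cycle
  sending p to u, u to v and v to p.\<close>

lemma conj_cyc3: "bij g \<Longrightarrow> g \<circ> cyc3 p u v \<circ> inv' g = cyc3 (g p) (g u) (g v)"
  by (simp only: cyc3_def conj_comp conj_transpose)

lemma cyc3_apply:
  "p \<noteq> u \<Longrightarrow> u \<noteq> v \<Longrightarrow> v \<noteq> p \<Longrightarrow>
    cyc3 p u v x = (if x = p then u else if x = u then v else if x = v then p else x)"
  by (auto simp: cyc3_def transpose_def)

lemma transpose_disjoint_comm:
  "distinct [x, y, u, v] \<Longrightarrow> transpose u v \<circ> transpose x y = transpose x y \<circ> transpose u v"
  by (rule ext) (auto simp: transpose_def)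

lemma cyc3_rotate: "p \<noteq> u \<Longrightarrow> u \<noteq> v \<Longrightarrow> v \<noteq> p \<Longrightarrow> cyc3 p u v = cyc3 u v p"
  by (auto simp: cyc3_def fun_eq_iff transpose_def)

lemma omega_funpow_cyc3:
  "0 < p \<Longrightarrow> 0 < u \<Longrightarrow> 0 < v \<Longrightarrow> (\<omega> ^^ i) (cyc3 p u v) = cyc3 (p + i) (u + i) (v + i)"
  by (rule ext, subst omega_funpow) (auto simp: cyc3_def transpose_def)

text \<open>By injectivity \<rho> moves \<open>\<rho> p\<close> and \<sigma> moves
  \<open>\<sigma> p\<close>, so \<sigma> fixes \<open>\<rho> p\<close> and \<rho> fixes
  \<open>\<sigma> p\<close>. Hence \<open>\<sigma> \<circ> \<rho>\<close> and
  \<open>\<rho> \<circ> \<sigma>\<close> differ only at p and at the preimages of p under \<sigma>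
  and under \<rho>, and the 3-cycle makes up for the difference at these three points.\<close>

lemma commutator_cyc3:
  assumes "bij \<sigma>" "bij \<rho>" and p: "\<sigma> p \<noteq> p" "\<rho> p \<noteq> p" and fx: "\<And>x. x \<noteq> p \<Longrightarrow> \<sigma> x = x \<or> \<rho> x = x"
  shows "\<sigma> \<circ> \<rho> \<circ> inv' \<sigma> \<circ> inv' \<rho> = cyc3 p (\<sigma> p) (\<rho> p)"
proof -
  have i: "\<sigma> x = \<sigma> y \<longleftrightarrow> x = y" "\<rho> x = \<rho> y \<longleftrightarrow> x = y" for x y
    using assms by (simp_all add: bij_is_inj inj_eq)
  \<comment> \<open>Written without inverses; the commutator is recovered by representing an
    arbitrary point as \<open>\<rho> (\<sigma> x)\<close>.\<close>
  have *: "\<sigma> (\<rho> x) = cyc3 p (\<sigma> p) (\<rho> p) (\<rho> (\<sigma> x))" for x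
  proof (cases "x = p")
    case True
    have "\<rho> (\<sigma> p) = \<sigma> p" "\<sigma> (\<rho> p) = \<rho> p" using fx p i by metis+
    with p True show ?thesis by (auto simp: cyc3_def transpose_def i)
  next
    case False
    have sp: "\<rho> (\<sigma> p) = \<sigma> p" and rp: "\<sigma> (\<rho> p) = \<rho> p" using fx p i by metis+
    show ?thesis
    proof (cases "\<sigma> x = x")
      case sx: True
      show ?thesis
      proof (cases "\<rho> x = x")
        case True
        then show ?thesis using sx False p sp rp by (auto simp: cyc3_def transpose_def i)
      next
        case rx: False
        show ?thesis
        proof (cases "\<rho> x = p")
          case True
          then show ?thesis using sx p by (auto simp: cyc3_def transpose_def i)
        next
          case r: False
          then have "\<sigma> (\<rho> x) = \<rho> x" using fx rx i by metis
          moreover have "\<rho> x \<noteq> \<sigma> p" "\<rho> x \<noteq> \<rho> p" using sp rx False i by metis+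
          ultimately show ?thesis using sx r by (auto simp: cyc3_def transpose_def)
        qed
      qed
    next
      case sx: False
      then have rx: "\<rho> x = x" using fx False by metis
      show ?thesis
      proof (cases "\<sigma> x = p")
        case True
        then show ?thesis using rx p by (auto simp: cyc3_def transpose_def i)
      next
        case r: False
        then have "\<rho> (\<sigma> x) = \<sigma> x" using fx sx i by metis
        moreover have "\<sigma> x \<noteq> \<rho> p" "\<sigma> x \<noteq> \<sigma> p" using rp sx False i by metis+
        ultimately show ?thesis using rx r by (auto simp: cyc3_def transpose_def)
      qed
    qed
  qed
  show ?thesis
  proof
    fix y
    obtain x where "y = \<rho> (\<sigma> x)" using assms(1,2) by (metis bij_pointE)
    with * assms(1,2) show "(\<sigma> \<circ> \<rho> \<circ> inv' \<sigma> \<circ> inv' \<rho>) y = cyc3 p (\<sigma> p) (\<rho> p) y"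
      by (simp add: bij_is_inj)
  qed
qed

text \<open>For \<pi> supported in {1..D} these are two copies of \<pi> side by side, with disjoint
  supports. A shift-invariant character takes the same value on either copy, hence a square on the
  whole.\<close>

definition doubled :: "nat \<Rightarrow> (nat \<Rightarrow> nat) \<Rightarrow> nat \<Rightarrow> nat"
  where "doubled D \<pi> = \<pi> \<circ> (\<omega> ^^ D) \<pi>"

lemma doubled_apply:
  assumes "\<pi> permutes {1..D}"
  shows "doubled D \<pi> t = (if t \<le> D then \<pi> t else \<pi> (t - D) + D)"
  using permutes_interval_0[OF assms] permutes_interval_pos[OF assms, of "t - D"]
  by (auto simp: doubled_def omega_funpow intro!: permutes_not_in[OF assms])

text \<open>Disjoint supports let the shifted copy of \<pi> pass the unshifted copy of \<rho>. Both
  permutations preserve {1..D}, which is why the case distinction at D survives composition.\<close>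

lemma doubled_comp:
  assumes "\<pi> permutes {1..D}" "\<rho> permutes {1..D}"
  shows "doubled D (\<pi> \<circ> \<rho>) = doubled D \<pi> \<circ> doubled D \<rho>"
proof
  fix t
  have "\<rho> t \<le> D" if "t \<le> D"
  proof (cases "t = 0")
    case True
    then show ?thesis using permutes_interval_0[OF assms(2)] by simp
  next
    case False
    then show ?thesis using permutes_in_image[OF assms(2), of t] that by auto
  qed
  then show "doubled D (\<pi> \<circ> \<rho>) t = (doubled D \<pi> \<circ> doubled D \<rho>) t"
    using permutes_interval_pos[OF assms(2), of "t - D"]
    unfolding doubled_apply[OF permutes_compose[OF assms(2,1)]] comp_apply
      doubled_apply[OF assms(1)] doubled_apply[OF assms(2)]
    by auto
qed

lemma doubled_id: "doubled D id = id"
  by (auto simp: doubled_def omega_funpow)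

lemma doubled_transpose:
  assumes "x \<in> {1..D}" "y \<in> {1..D}"
  shows "doubled D (transpose x y) = transpose x y \<circ> transpose (x + D) (y + D)"
  using assms by (auto simp: fun_eq_iff doubled_apply permutes_swap_id transpose_def)

text \<open>V stands for the union of all W d and N for the kernel of the common character on it:
  commutators lie in N since the values commute, and N is stable under the shift by invariance.
  Working in the union removes every bound on the degree, so points may be moved as far to the right
  as desired.\<close>

locale shift_group =
  fixes V N :: "(nat \<Rightarrow> nat) set"
  assumes permutes: "\<sigma> \<in> V \<Longrightarrow> \<exists>d. \<sigma> permutes {1..d}"
    and shift: "\<sigma> \<in> V \<Longrightarrow> \<omega> \<sigma> \<in> V"
    and sub: "N \<subseteq> V"
    and N_id: "id \<in> N"
    and N_comp: "\<sigma> \<in> N \<Longrightarrow> \<tau> \<in> N \<Longrightarrow> \<sigma> \<circ> \<tau> \<in> N"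
    and N_shift: "\<sigma> \<in> N \<Longrightarrow> \<omega> \<sigma> \<in> N"
    and conj: "g \<in> V \<Longrightarrow> \<sigma> \<in> N \<Longrightarrow> g \<circ> \<sigma> \<circ> inv' g \<in> N"
    and commutator: "g \<in> V \<Longrightarrow> h \<in> V \<Longrightarrow> g \<circ> h \<circ> inv' g \<circ> inv' h \<in> N"
begin

lemma bij: "\<sigma> \<in> V \<Longrightarrow> bij \<sigma>"
  using permutes permutes_bij by blast

lemma fixes_0: "\<sigma> \<in> V \<Longrightarrow> \<sigma> 0 = 0"
  using permutes permutes_interval_0 by blast

lemma shift_funpow: "\<sigma> \<in> V \<Longrightarrow> (\<omega> ^^ k) \<sigma> \<in> V"
  by (induction k) (auto intro: shift)

lemma N_shift_funpow: "\<sigma> \<in> N \<Longrightarrow> (\<omega> ^^ k) \<sigma> \<in> N"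
  by (induction k) (auto intro: N_shift)

lemma conj_cyc3_N: "g \<in> V \<Longrightarrow> cyc3 p u v \<in> N \<Longrightarrow> cyc3 (g p) (g u) (g v) \<in> N"
  using conj conj_cyc3 bij by metis

text \<open>If \<open>M\<close> and \<open>m\<close> are the largest and the smallest point moved by \<open>\<sigma>\<close>, then \<open>\<sigma>\<close> and its shift
  by \<open>M - m\<close> have only \<open>M\<close> as a common moved point, so their commutator is a 3-cycle.\<close>

lemma shifted_cyc3s:
  assumes "\<sigma> \<in> V" "\<sigma> \<noteq> id"
  obtains M a b where "0 < a" "0 < b" "a < M" "\<And>j. M \<le> j \<Longrightarrow> cyc3 j (j - a) (j + b) \<in> N"
    "\<And>t. M < t \<Longrightarrow> \<sigma> t = t"
proof -
  obtain d where d: "\<sigma> permutes {1..d}" using permutes assms by blast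
  let ?S = "{t. \<sigma> t \<noteq> t}"
  have sub: "?S \<subseteq> {1..d}" using d permutes_not_in by fastforce
  have fin: "finite ?S" using sub finite_subset by blast
  have ne: "?S \<noteq> {}" using assms(2) by auto
  define M where "M = Max ?S"
  define m where "m = Min ?S"
  have M: "\<sigma> M \<noteq> M" and m: "\<sigma> m \<noteq> m" using Max_in[OF fin ne] Min_in[OF fin ne]
    by (auto simp: M_def m_def)
  have geM: "t \<le> M" and gem: "m \<le> t" if "\<sigma> t \<noteq> t" for t
    using that fin by (auto simp: M_def m_def)
  have inj: "\<sigma> x = \<sigma> y \<longleftrightarrow> x = y" for x y using bij[OF assms(1)] by (simp add: bij_is_inj inj_eq)
  have lt: "\<sigma> M < M" using geM[of "\<sigma> M"] M inj by fastforce
  have gt: "m < \<sigma> m" using gem[of "\<sigma> m"] m inj by fastforce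
  have m0: "0 < m" using m fixes_0[OF assms(1)] by (cases m) auto
  have mM: "m \<le> M" using geM m by blast
  have sM: "0 < \<sigma> M" using permutes_interval_pos[OF d, of M] m0 mM by simp
  let ?\<rho> = "(\<omega> ^^ (M - m)) \<sigma>"
  have rho: "?\<rho> t = (if t \<le> M - m then t else \<sigma> (t - (M - m)) + (M - m))" for t
    using fixes_0[OF assms(1)] by (rule omega_funpow)
  have rM: "?\<rho> M = M + (\<sigma> m - m)" using rho[of M] m0 mM gt by auto
  have "\<sigma> \<circ> ?\<rho> \<circ> inv' \<sigma> \<circ> inv' ?\<rho> = cyc3 M (\<sigma> M) (?\<rho> M)"
  proof (rule commutator_cyc3)
    show "bij \<sigma>" "bij ?\<rho>" using assms(1) shift_funpow bij by blast+
    show "\<sigma> M \<noteq> M" "?\<rho> M \<noteq> M" using M rM gt by auto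
    fix x assume "x \<noteq> M"
    show "\<sigma> x = x \<or> ?\<rho> x = x"
    proof (cases "x < M")
      case True
      then have "\<sigma> (x - (M - m)) = x - (M - m)" using gem[of "x - (M - m)"] mM m0 by linarith
      then show ?thesis by (simp add: rho)
    next
      case False
      then show ?thesis using geM[of x] \<open>x \<noteq> M\<close> by force
    qed
  qed
  then have N: "cyc3 M (\<sigma> M) (?\<rho> M) \<in> N" using commutator[OF assms(1) shift_funpow[OF assms(1)]] by metis
  show ?thesis
  \<comment> \<open>The cycle just found runs through M, M - a and M + b for these two differences.
    Recording offsets instead of points lets one statement cover all its shifts, j being the image
    of M.\<close>
  proof (rule that[of "M - \<sigma> M" "\<sigma> m - m" M])
    show "0 < M - \<sigma> M" "0 < \<sigma> m - m" "M - \<sigma> M < M" using lt gt sM by auto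
    show "cyc3 j (j - (M - \<sigma> M)) (j + (\<sigma> m - m)) \<in> N" if "M \<le> j" for j
    proof -
      have "(\<omega> ^^ (j - M)) (cyc3 M (\<sigma> M) (?\<rho> M)) \<in> N" using N by (rule N_shift_funpow)
      moreover have "(\<omega> ^^ (j - M)) (cyc3 M (\<sigma> M) (?\<rho> M)) = cyc3 (M + (j - M)) (\<sigma> M + (j - M)) (?\<rho> M + (j - M))"
        using m0 mM sM rM by (intro omega_funpow_cyc3) auto
      moreover have "\<sigma> M + (j - M) = j - (M - \<sigma> M)" "?\<rho> M + (j - M) = j + (\<sigma> m - m)"
        using that lt rM by auto
      ultimately show ?thesis using that by simp
    qed
    show "\<sigma> t = t" if "M < t" for t using geM[of t] that by force
  qed
qed

text \<open>Conjugation with the 3-cycle on \<open>x\<close>, \<open>x + a\<close>, \<open>x + a + b\<close> pushes \<open>x\<close> to \<open>x + a + b\<close> and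
  fixes all smaller points, so the two points besides \<open>p\<close> can be moved far away.\<close>

lemma far_cyc3:
  assumes "0 < a" "0 < b" and cyc: "\<And>j. M \<le> j \<Longrightarrow> cyc3 j (j - a) (j + b) \<in> N"
    and p: "M \<le> p" and "l \<le> k"
  shows "cyc3 p (p + a + b + k * (a + b)) (p + a + l * (a + b)) \<in> N"
proof -
  \<comment> \<open>The cycle attached to j = x + a, whose other two points are x and x + a +
    b.\<close>
  have push: "cyc3 (x + a) x (x + a + b) \<in> N" if "M \<le> x" for x
    using cyc[of "x + a"] that by simp
  have "cyc3 p (p + a + b + k * (a + b)) (p + a) \<in> N" for k
  proof (induction k)
    case 0
    show ?case using push[OF p] assms(1,2) cyc3_rotate[of "p + a" p "p + a + b"] by simp
  next
    case (Suc k)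
    let ?x = "p + a + b + k * (a + b)"
    have "cyc3 (?x + a) ?x (?x + a + b) \<in> V" using push[of ?x] p sub by auto
    moreover have "cyc3 (?x + a) ?x (?x + a + b) p = p"
      "cyc3 (?x + a) ?x (?x + a + b) ?x = ?x + a + b"
      "cyc3 (?x + a) ?x (?x + a + b) (p + a) = p + a"
      using assms(1,2) by (subst cyc3_apply; simp)+
    moreover have "?x + a + b = p + a + b + Suc k * (a + b)" by simp
    ultimately show ?case using conj_cyc3_N[OF _ Suc] by metis
  qed
  then show ?thesis using \<open>l \<le> k\<close>
  proof (induction l)
    case 0
    then show ?case by simp
  next
    case (Suc l)
    let ?x = "p + a + l * (a + b)" and ?y = "p + a + b + k * (a + b)"
    have "Suc l * (a + b) \<le> k * (a + b)" using Suc.prems(2) by (rule mult_le_mono1)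
    \<comment> \<open>The second point is parked beyond all three points of the conjugating cycle
      and so stays put; this is where l \<le> k enters.\<close>
    then have y: "?x + a + b < ?y" using assms(1,2) by simp
    have "cyc3 (?x + a) ?x (?x + a + b) \<in> V" using push[of ?x] p sub by auto
    moreover have "cyc3 (?x + a) ?x (?x + a + b) p = p"
      "cyc3 (?x + a) ?x (?x + a + b) ?y = ?y"
      "cyc3 (?x + a) ?x (?x + a + b) ?x = ?x + a + b"
      using assms(1,2) y by (subst cyc3_apply; simp)+
    moreover have "?x + a + b = p + a + Suc l * (a + b)" by simp
    moreover have "cyc3 p ?y ?x \<in> N" using Suc by simp
    ultimately show ?case using conj_cyc3_N by metis
  qed
qed

text \<open>The product of the two 3-cycles is (x u)(y v). Conjugation by \<open>cyc3 x u v\<close>,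
  which sends x, u, y, v to u, v, y, x, turns it into (u v)(y x).\<close>

lemma cyc3_pair:
  assumes "distinct [x, y, u, v]" and x: "cyc3 x u v \<in> N" and y: "cyc3 y u v \<in> N"
  shows "transpose x y \<circ> transpose u v \<in> N"
proof -
  have "cyc3 x u v \<circ> cyc3 y u v = transpose x u \<circ> transpose y v"
    by (rule ext) (use assms(1) in \<open>auto simp: cyc3_apply transpose_def\<close>)
  then have "transpose x u \<circ> transpose y v \<in> N" using N_comp[OF x y] by simp
  then have "cyc3 x u v \<circ> (transpose x u \<circ> transpose y v) \<circ> inv' (cyc3 x u v) \<in> N"
    using x sub conj by blast
  moreover have "bij (cyc3 x u v)" using x sub bij by blast
  ultimately have "transpose (cyc3 x u v x) (cyc3 x u v u) \<circ> transpose (cyc3 x u v y) (cyc3 x u v v) \<in> N"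
    by (simp only: conj_comp conj_transpose)
  note * = this
  have "cyc3 x u v x = u" "cyc3 x u v u = v" "cyc3 x u v y = y" "cyc3 x u v v = x"
    using assms(1) by (simp_all add: cyc3_def transpose_def)
  from *[unfolded this] show ?thesis by (metis transpose_disjoint_comm[OF assms(1)] transpose_commute)
qed

text \<open>Induction on the support: splitting off the transposition of a and
  \<open>\<pi> a\<close> leaves a permutation fixing a. The hypothesis speaks of the transpositions
  along \<pi>, so it has to be re-established for the remaining permutation, which can differ from
  \<pi> only at a and at the preimage of a.\<close>

lemma doubled_in_N:
  assumes "finite S" "S \<subseteq> {1..D}" "\<pi> permutes S"
    and "\<And>x. x \<in> S \<Longrightarrow> doubled D (transpose x (\<pi> x)) \<in> N"
  shows "doubled D \<pi> \<in> N"
  using assms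
proof (induction S arbitrary: \<pi> rule: finite_induct)
  case empty
  then have "\<pi> = id" by simp
  then show ?case using doubled_id N_id by metis
next
  case (insert a S)
  let ?\<rho> = "transpose a (\<pi> a) \<circ> \<pi>"
  have perm: "\<rho> permutes {1..D}" if "\<rho> permutes S" for \<rho>
    using permutes_subset[OF that] insert.prems(1) by blast
  have \<rho>: "?\<rho> permutes S" using insert.prems(2) by (rule permutes_insert_lemma)
  have a: "a \<in> {1..D}" "\<pi> a \<in> {1..D}"
    using insert.prems(1) permutes_in_image[OF insert.prems(2), of a] by auto
  have inj: "\<pi> x = \<pi> y \<longleftrightarrow> x = y" for x y
    using insert.prems(2) by (metis permutes_def)
  have "doubled D (transpose x (?\<rho> x)) \<in> N" if x: "x \<in> S" for x
  proof (cases "\<pi> x = a")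
    case False
    moreover have "\<pi> x \<noteq> \<pi> a" using inj x insert.hyps by auto
    ultimately show ?thesis using insert.prems(3)[of x] x by (simp add: transpose_apply_other)
  next
    case True
    have xD: "x \<in> {1..D}" "x \<noteq> a" using x insert.prems(1) insert.hyps by auto
    have 1: "doubled D (transpose x a) \<in> N" "doubled D (transpose a (\<pi> a)) \<in> N"
      using insert.prems(3)[of x] insert.prems(3)[of a] x True by auto
    show ?thesis
    proof (cases "x = \<pi> a")
      case True
      then show ?thesis using \<open>\<pi> x = a\<close> using doubled_id[of D] N_id by (simp add: id_def)
    next
      case False
      have ne: "\<pi> a \<noteq> a" using True inj xD by metis
      \<comment> \<open>Bypassing a: the transposition of x and \<open>\<pi> a\<close> is the
        conjugate of that of a and \<open>\<pi> a\<close> by that of x and a, and the doubled forms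
        of both are known to lie in N.\<close>
      have eq: "transpose x (\<pi> a) = transpose x a \<circ> transpose a (\<pi> a) \<circ> transpose x a"
        using False ne xD by (auto simp: fun_eq_iff transpose_def)
      have "doubled D (transpose x (\<pi> a)) = doubled D (transpose x a) \<circ> doubled D (transpose a (\<pi> a)) \<circ> doubled D (transpose x a)"
        unfolding eq using a xD by (simp add: doubled_comp permutes_swap_id permutes_compose)
      then show ?thesis using 1 True by (simp add: N_comp)
    qed
  qed
  then have "doubled D ?\<rho> \<in> N" using insert.IH insert.prems(1) \<rho> by blast
  moreover have "doubled D (transpose a (\<pi> a)) \<in> N" using insert.prems(3) by simp
  moreover have "\<pi> = transpose a (\<pi> a) \<circ> ?\<rho>" by (simp add: fun_eq_iff)
  ultimately show ?case
    using doubled_comp[OF permutes_swap_id[OF a] perm[OF \<rho>]] N_comp by metis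
qed

text \<open>Shifting \<sigma> by M pushes its support beyond M, into the range where
  \<open>far_cyc3\<close> supplies a 3-cycle at every point. It then suffices to treat the doubled
  transpositions of a point and its image.\<close>

lemma ex_doubled_in_N:
  assumes "\<sigma> \<in> V"
  shows "\<exists>j k. doubled k ((\<omega> ^^ j) \<sigma>) \<in> N"
proof (cases "\<sigma> = id")
  case True
  then show ?thesis using doubled_id N_id by (metis funpow_0)
next
  case False
  obtain M a b where ab: "0 < a" "0 < b" "a < M"
    and cyc: "\<And>j. M \<le> j \<Longrightarrow> cyc3 j (j - a) (j + b) \<in> N"
    and supp: "\<And>t. M < t \<Longrightarrow> \<sigma> t = t"
    using shifted_cyc3s[OF assms False] by metis
  note far = far_cyc3[OF ab(1,2) cyc]
  let ?\<tau> = "(\<omega> ^^ M) \<sigma>"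
  \<comment> \<open>D is at least 2 * M, so {1..D} contains the support of the shifted permutation.
    It is also 2 * M copies of a + b, so that moving a starting point by D amounts to 2 * M pushes
    by a + b.\<close>
  define D where "D = 2 * M * (a + b)"
  have D: "2 * M \<le> D" using ab by (simp add: D_def)
  have z: "\<sigma> 0 = 0" using assms by (rule fixes_0)
  have V: "?\<tau> \<in> V" using assms by (rule shift_funpow)
  have "\<sigma> permutes {1..M}"
    unfolding permutes_def
    using bij[OF assms] supp z by (metis atLeastAtMost_iff bij_pointE less_one not_le)
  then have "?\<tau> permutes {1 + M..M + M}" by (rule omega_funpow_permutes)
  then have perm: "?\<tau> permutes {1 + M..D}" by (rule permutes_subset) (use D in auto)
  have "doubled D ?\<tau> \<in> N"
  proof (rule doubled_in_N[OF _ _ perm])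
    fix x assume x: "x \<in> {1 + M..D}"
    let ?y = "?\<tau> x"
    have y: "?y \<in> {1 + M..D}" using permutes_in_image[OF perm] x by blast
    show "doubled D (transpose x ?y) \<in> N"
    proof (cases "?y = x")
      case True
      then show ?thesis by (simp add: transpose_same doubled_id N_id)
    next
      case False
      \<comment> \<open>Pushing both outer points 2 * D times takes them beyond 2 * D, where neither
        the shifted permutation nor its copy moves anything. Conjugation therefore moves x while
        keeping u and v.\<close>
      define u v where "u = x + a + b + (2 * D) * (a + b)" and "v = x + a + (2 * D) * (a + b)"
      have "2 * D \<le> (2 * D) * (a + b)" using ab by simp
      then have u: "2 * D < u" "2 * D < v" "u \<noteq> v" unfolding u_def v_def using ab by linarith+
      have uv_fixed: "?\<tau> t = t" if "D < t" for t using that by (simp add: permutes_not_in[OF perm])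
      have 1: "cyc3 x u v \<in> N" unfolding u_def v_def using x by (intro far) auto
      then have 2: "cyc3 ?y u v \<in> N" using conj_cyc3_N[OF V 1] uv_fixed[of u] uv_fixed[of v] u by simp
      have "2 * M \<le> 2 * D" using D by simp
      \<comment> \<open>Starting from x + D and pushing 2 * M times less often leads to the very
        same u and v.\<close>
      then have "(2 * D - 2 * M) * (a + b) + D = (2 * D) * (a + b)"
        by (simp add: D_def diff_mult_distrib)
      then have "(x + D) + a + b + (2 * D - 2 * M) * (a + b) = u"
        "(x + D) + a + (2 * D - 2 * M) * (a + b) = v" unfolding u_def v_def by linarith+
      moreover have "cyc3 (x + D) ((x + D) + a + b + (2 * D - 2 * M) * (a + b))
          ((x + D) + a + (2 * D - 2 * M) * (a + b)) \<in> N"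
        using x by (intro far) auto
      ultimately have 3: "cyc3 (x + D) u v \<in> N" by metis
      have sh: "(\<omega> ^^ D) ?\<tau> t = (if t \<le> D then t else ?\<tau> (t - D) + D)" for t
        using fixes_0[OF V] by (rule omega_funpow)
      have "(\<omega> ^^ D) ?\<tau> t = t" if "2 * D < t" for t
        using that uv_fixed[of "t - D"] by (simp add: sh)
      moreover have "(\<omega> ^^ D) ?\<tau> (x + D) = ?y + D" using x by (simp add: sh)
      ultimately have 4: "cyc3 (?y + D) u v \<in> N"
        using conj_cyc3_N[OF shift_funpow[OF V] 3, of D] u by simp
      have "transpose x ?y \<circ> transpose u v \<in> N"
        by (rule cyc3_pair[OF _ 1 2]) (use x y u False in auto)
      moreover have "transpose (x + D) (?y + D) \<circ> transpose u v \<in> N"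
        by (rule cyc3_pair[OF _ 3 4]) (use x y u False in auto)
      moreover have "transpose u v \<circ> transpose (x + D) (?y + D) = transpose (x + D) (?y + D) \<circ> transpose u v"
        by (rule transpose_disjoint_comm) (use x y u False in auto)
      \<comment> \<open>In the second factor the commuting transpositions stand in the other order,
        so that the two copies of (u v) meet and cancel.\<close>
      ultimately have "(transpose x ?y \<circ> transpose u v) \<circ> (transpose u v \<circ> transpose (x + D) (?y + D)) \<in> N"
        by (simp only: N_comp)
      moreover have "(A \<circ> transpose u v) \<circ> (transpose u v \<circ> B) = A \<circ> B" for A B :: "nat \<Rightarrow> nat"
        by (simp add: fun_eq_iff)
      ultimately have "transpose x ?y \<circ> transpose (x + D) (?y + D) \<in> N" by (simp only:)
      then show ?thesis using x y doubled_transpose[of x D ?y] by simp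
    qed
  qed auto
  then show ?thesis by blast
qed

end

section \<open>Linear maps\<close>

text \<open>Negatives are supplied by the scalar -1, so a construction has to provide only zero, sum
  and scalar multiplication, which is what the module records specify.\<close>

lemma module_of_axioms:
  fixes R (structure) and M (structure)
  assumes "cring R"
    and "\<And>x y. x \<in> carrier M \<Longrightarrow> y \<in> carrier M \<Longrightarrow> x \<oplus>\<^bsub>M\<^esub> y \<in> carrier M"
    and "\<zero>\<^bsub>M\<^esub> \<in> carrier M"
    and "\<And>x y z. x \<in> carrier M \<Longrightarrow> y \<in> carrier M \<Longrightarrow> z \<in> carrier M \<Longrightarrow> (x \<oplus>\<^bsub>M\<^esub> y) \<oplus>\<^bsub>M\<^esub> z = x \<oplus>\<^bsub>M\<^esub> (y \<oplus>\<^bsub>M\<^esub> z)"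
    and "\<And>x y. x \<in> carrier M \<Longrightarrow> y \<in> carrier M \<Longrightarrow> x \<oplus>\<^bsub>M\<^esub> y = y \<oplus>\<^bsub>M\<^esub> x"
    and "\<And>x. x \<in> carrier M \<Longrightarrow> \<zero>\<^bsub>M\<^esub> \<oplus>\<^bsub>M\<^esub> x = x"
    and neg: "\<And>x. x \<in> carrier M \<Longrightarrow> (\<ominus>\<^bsub>R\<^esub> \<one>\<^bsub>R\<^esub>) \<odot>\<^bsub>M\<^esub> x \<oplus>\<^bsub>M\<^esub> x = \<zero>\<^bsub>M\<^esub>"
    and closed: "\<And>a x. a \<in> carrier R \<Longrightarrow> x \<in> carrier M \<Longrightarrow> a \<odot>\<^bsub>M\<^esub> x \<in> carrier M"
    and "\<And>a b x. a \<in> carrier R \<Longrightarrow> b \<in> carrier R \<Longrightarrow> x \<in> carrier M \<Longrightarrow> (a \<oplus> b) \<odot>\<^bsub>M\<^esub> x = (a \<odot>\<^bsub>M\<^esub> x) \<oplus>\<^bsub>M\<^esub> (b \<odot>\<^bsub>M\<^esub> x)"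
    and "\<And>a x y. a \<in> carrier R \<Longrightarrow> x \<in> carrier M \<Longrightarrow> y \<in> carrier M \<Longrightarrow> a \<odot>\<^bsub>M\<^esub> (x \<oplus>\<^bsub>M\<^esub> y) = (a \<odot>\<^bsub>M\<^esub> x) \<oplus>\<^bsub>M\<^esub> (a \<odot>\<^bsub>M\<^esub> y)"
    and "\<And>a b x. a \<in> carrier R \<Longrightarrow> b \<in> carrier R \<Longrightarrow> x \<in> carrier M \<Longrightarrow> (a \<otimes> b) \<odot>\<^bsub>M\<^esub> x = a \<odot>\<^bsub>M\<^esub> (b \<odot>\<^bsub>M\<^esub> x)"
    and "\<And>x. x \<in> carrier M \<Longrightarrow> \<one> \<odot>\<^bsub>M\<^esub> x = x"
  shows "module R M"
proof (rule moduleI)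
  interpret R: cring R by fact
  show "abelian_group M"
  proof (rule abelian_groupI)
    show "\<exists>y\<in>carrier M. y \<oplus>\<^bsub>M\<^esub> x = \<zero>\<^bsub>M\<^esub>" if "x \<in> carrier M" for x
      using neg[OF that] closed[OF _ that] R.one_closed R.a_inv_closed by blast
  qed (use assms in auto)
qed (use assms in auto)

lemma minus_eq_zero_iff:
  assumes "abelian_group M" "x \<in> carrier M" "y \<in> carrier M"
  shows "x \<ominus>\<^bsub>M\<^esub> y = \<zero>\<^bsub>M\<^esub> \<longleftrightarrow> x = y"
proof -
  interpret abelian_group M by fact
  show ?thesis using minus_equality[of x "\<ominus>\<^bsub>M\<^esub> y"] assms(2,3) by (auto simp: a_minus_def r_neg)
qed

lemma self_module_simps [simp]:
  "carrier (self_module K) = carrier K" "add (self_module K) = add K" "zero (self_module K) = zero K"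
  "smult (self_module K) = monoid.mult K"
  by (simp_all add: self_module_def)

lemma finsum_self_module [simp]: "finsum (self_module K) = finsum K"
  by (simp add: fun_eq_iff finsum_def finprod_def self_module_def)

lemma module_self_module:
  assumes "cring K"
  shows "module K (self_module K)"
proof -
  interpret cring K by fact
  show ?thesis
    by (rule module_of_axioms)
      (use assms in \<open>auto simp: a_assoc m_assoc l_distr r_distr l_minus l_neg intro: a_comm\<close>)
qed

lemma linear_mapsI:
  assumes "\<And>x. x \<in> carrier M \<Longrightarrow> f x \<in> carrier N"
    and "\<And>x y. x \<in> carrier M \<Longrightarrow> y \<in> carrier M \<Longrightarrow> f (x \<oplus>\<^bsub>M\<^esub> y) = f x \<oplus>\<^bsub>N\<^esub> f y"
    and "\<And>k x. k \<in> carrier K \<Longrightarrow> x \<in> carrier M \<Longrightarrow> f (k \<odot>\<^bsub>M\<^esub> x) = k \<odot>\<^bsub>N\<^esub> f x"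
    and "f \<in> extensional (carrier M)"
  shows "f \<in> linear_maps K M N"
  using assms by (auto simp: linear_maps_def PiE_def)

lemma linear_maps_restrictI:
  assumes "module K M"
    and "\<And>x. x \<in> carrier M \<Longrightarrow> f x \<in> carrier N"
    and "\<And>x y. x \<in> carrier M \<Longrightarrow> y \<in> carrier M \<Longrightarrow> f (x \<oplus>\<^bsub>M\<^esub> y) = f x \<oplus>\<^bsub>N\<^esub> f y"
    and "\<And>k x. k \<in> carrier K \<Longrightarrow> x \<in> carrier M \<Longrightarrow> f (k \<odot>\<^bsub>M\<^esub> x) = k \<odot>\<^bsub>N\<^esub> f x"
  shows "restrict f (carrier M) \<in> linear_maps K M N"
proof -
  interpret module K M by fact
  show ?thesis by (rule linear_mapsI) (use assms in auto)
qed

lemma linear_closed: "f \<in> linear_maps K M N \<Longrightarrow> x \<in> carrier M \<Longrightarrow> f x \<in> carrier N"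
  by (auto simp: linear_maps_def)

lemma linear_add: "f \<in> linear_maps K M N \<Longrightarrow> x \<in> carrier M \<Longrightarrow> y \<in> carrier M \<Longrightarrow>
    f (x \<oplus>\<^bsub>M\<^esub> y) = f x \<oplus>\<^bsub>N\<^esub> f y"
  by (auto simp: linear_maps_def)

lemma linear_smult: "f \<in> linear_maps K M N \<Longrightarrow> k \<in> carrier K \<Longrightarrow> x \<in> carrier M \<Longrightarrow>
    f (k \<odot>\<^bsub>M\<^esub> x) = k \<odot>\<^bsub>N\<^esub> f x"
  by (auto simp: linear_maps_def)

lemma linear_eqI:
  assumes "f \<in> linear_maps K M N" "g \<in> linear_maps K M N" "\<And>x. x \<in> carrier M \<Longrightarrow> f x = g x"
  shows "f = g"
proof
  fix x show "f x = g x"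
    using assms by (cases "x \<in> carrier M") (auto simp: linear_maps_def PiE_def extensional_def)
qed

text \<open>Linearity looks at carrier, sum and scalar multiplication alone. This identifies the
  linear maps on the algebra with those on the underlying direct sum.\<close>

lemma linear_maps_cong:
  assumes "carrier M = carrier M'" "add M = add M'" "smult M = smult M'"
    "carrier N = carrier N'" "add N = add N'" "smult N = smult N'"
  shows "linear_maps K M N = linear_maps K M' N'"
  by (simp add: linear_maps_def assms)

context
  fixes K (structure) and M N
  assumes M: "module K M" and N: "module K N"
begin

interpretation M: module K M by (rule M)
interpretation N: module K N by (rule N)

lemma linear_zero: "f \<in> linear_maps K M N \<Longrightarrow> f \<zero>\<^bsub>M\<^esub> = \<zero>\<^bsub>N\<^esub>"
  using linear_smult[of f K M N \<zero> "\<zero>\<^bsub>M\<^esub>"] linear_closed[of f K M N "\<zero>\<^bsub>M\<^esub>"] by simp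

lemma linear_a_inv:
  assumes f: "f \<in> linear_maps K M N" and x: "x \<in> carrier M"
  shows "f (\<ominus>\<^bsub>M\<^esub> x) = \<ominus>\<^bsub>N\<^esub> f x"
proof (rule N.M.minus_equality[symmetric])
  show "f (\<ominus>\<^bsub>M\<^esub> x) \<oplus>\<^bsub>N\<^esub> f x = \<zero>\<^bsub>N\<^esub>"
    using x linear_add[OF f, of "\<ominus>\<^bsub>M\<^esub> x" x] by (simp add: M.M.l_neg linear_zero[OF f])
qed (use x in \<open>auto intro: linear_closed[OF f]\<close>)

lemma linear_minus:
  assumes f: "f \<in> linear_maps K M N" and "x \<in> carrier M" "y \<in> carrier M"
  shows "f (x \<ominus>\<^bsub>M\<^esub> y) = f x \<ominus>\<^bsub>N\<^esub> f y"
  using assms(2,3) by (simp add: a_minus_def linear_add[OF f] linear_a_inv[OF f])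

lemma linear_finsum:
  assumes "f \<in> linear_maps K M N" "g \<in> A \<rightarrow> carrier M"
  shows "f (\<Oplus>\<^bsub>M\<^esub>i\<in>A. g i) = (\<Oplus>\<^bsub>N\<^esub>i\<in>A. f (g i))"
proof (cases "finite A")
  case True
  then show ?thesis using assms(2)
  proof (induction A)
    case empty
    then show ?case by (simp add: linear_zero[OF assms(1)])
  next
    case (insert a A)
    then have g: "g a \<in> carrier M" "g \<in> A \<rightarrow> carrier M" by auto
    then have "f (g a) \<in> carrier N" "(\<lambda>i. f (g i)) \<in> A \<rightarrow> carrier N"
      using linear_closed[OF assms(1)] by (auto simp: Pi_iff)
    with insert.hyps g show ?case
      by (simp add: insert.IH linear_add[OF assms(1)])
  qed
next
  case False
  then show ?thesis by (simp add: linear_zero[OF assms(1)])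
qed

lemma submodule_vimage:
  assumes "f \<in> linear_maps K M N" "submodule P K N"
  shows "submodule {x \<in> carrier M. f x \<in> P} K M"
proof (rule M.submoduleI)
  note P = N.submoduleE[OF assms(2)]
  have "\<zero>\<^bsub>N\<^esub> \<in> P" using subgroup.one_closed[OF submodule.axioms(1)[OF assms(2)]] by simp
  then show "\<zero>\<^bsub>M\<^esub> \<in> {x \<in> carrier M. f x \<in> P}" by (simp add: linear_zero[OF assms(1)])
qed (use N.submoduleE[OF assms(2)] in \<open>auto simp: linear_add[OF assms(1)] linear_smult[OF assms(1)] linear_a_inv[OF assms(1)]\<close>)

lemma zero_submodule: "submodule {\<zero>\<^bsub>M\<^esub>} K M"
  by (rule M.submoduleI) auto

end

lemma linear_comp:
  assumes "module K L" "f \<in> linear_maps K L M" "g \<in> linear_maps K M N"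
  shows "(\<lambda>x\<in>carrier L. g (f x)) \<in> linear_maps K L N"
  by (rule linear_maps_restrictI[OF assms(1)])
    (simp_all add: linear_closed[OF assms(2)] linear_closed[OF assms(3)] linear_add[OF assms(2)]
      linear_add[OF assms(3)] linear_smult[OF assms(2)] linear_smult[OF assms(3)])

text \<open>The dual is the case of scalar values. General values are required for currying: a
  bilinear map becomes a linear map into this module, and the universal property of the first
  argument applies to it.\<close>

definition hom_module :: "('k, 'r) ring_scheme \<Rightarrow> ('k, 'a, 'm) module_scheme
    \<Rightarrow> ('k, 'b, 'n) module_scheme \<Rightarrow> ('k, 'a \<Rightarrow> 'b) module"
  where "hom_module K M N = \<lparr>carrier = linear_maps K M N,
    monoid.mult = undefined, one = undefined,
    zero = (\<lambda>x \<in> carrier M. \<zero>\<^bsub>N\<^esub>),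
    add = (\<lambda>f g. \<lambda>x \<in> carrier M. f x \<oplus>\<^bsub>N\<^esub> g x),
    smult = (\<lambda>k f. \<lambda>x \<in> carrier M. k \<odot>\<^bsub>N\<^esub> f x)\<rparr>"

lemma dual_module_eq_hom_module: "dual_module K E = hom_module K E (self_module K)"
  by (simp add: dual_module_def hom_module_def)

lemma carrier_hom_module [simp]: "carrier (hom_module K M N) = linear_maps K M N"
  by (simp add: hom_module_def)

lemma hom_module_apply:
  "x \<in> carrier M \<Longrightarrow> (f \<oplus>\<^bsub>hom_module K M N\<^esub> g) x = f x \<oplus>\<^bsub>N\<^esub> g x"
  "x \<in> carrier M \<Longrightarrow> (k \<odot>\<^bsub>hom_module K M N\<^esub> f) x = k \<odot>\<^bsub>N\<^esub> f x"
  "x \<in> carrier M \<Longrightarrow> \<zero>\<^bsub>hom_module K M N\<^esub> x = \<zero>\<^bsub>N\<^esub>"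
  by (simp_all add: hom_module_def)

lemma module_hom_module:
  assumes "module K M" "module K N"
  shows "module K (hom_module K M N)"
proof -
  interpret M: module K M by fact
  interpret N: module K N by fact
  have closed: "f \<oplus>\<^bsub>hom_module K M N\<^esub> g \<in> linear_maps K M N"
    if f: "f \<in> linear_maps K M N" and g: "g \<in> linear_maps K M N" for f g
    unfolding hom_module_def ring.simps
    by (rule linear_maps_restrictI[OF assms(1)])
      (simp_all add: linear_closed[OF f] linear_closed[OF g] linear_add[OF f] linear_add[OF g]
        linear_smult[OF f] linear_smult[OF g] N.M.a_ac N.smult_r_distr)
  have zero: "\<zero>\<^bsub>hom_module K M N\<^esub> \<in> linear_maps K M N"
    unfolding hom_module_def ring.simps
    by (rule linear_maps_restrictI[OF assms(1)]) simp_all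
  have sm: "k \<odot>\<^bsub>hom_module K M N\<^esub> f \<in> linear_maps K M N"
    if k: "k \<in> carrier K" and f: "f \<in> linear_maps K M N" for k f
    unfolding hom_module_def module.simps
    by (rule linear_maps_restrictI[OF assms(1)])
      (simp_all add: k linear_closed[OF f] linear_add[OF f] linear_smult[OF f] N.smult_r_distr
        N.smult_assoc1[symmetric] M.R.m_comm)
  note cl = closed zero sm
  have eq: "f = g" if "f \<in> linear_maps K M N" "g \<in> linear_maps K M N"
    "\<And>x. x \<in> carrier M \<Longrightarrow> f x = g x" for f g
    using that by (rule linear_eqI)
  show ?thesis
    apply (rule module_of_axioms)
    subgoal by (rule M.R.is_cring)
    subgoal by (simp add: cl)
    subgoal by (simp add: cl)
    subgoal by (rule eq) (auto simp: cl hom_module_apply N.M.a_assoc linear_closed)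
    subgoal by (rule eq) (auto simp: cl hom_module_apply N.M.a_comm linear_closed)
    subgoal by (rule eq) (auto simp: cl hom_module_apply linear_closed)
    subgoal by (rule eq) (auto simp: cl hom_module_apply linear_closed N.smult_l_minus N.M.l_neg)
    subgoal by (simp add: cl)
    subgoal by (rule eq) (auto simp: cl hom_module_apply linear_closed N.smult_l_distr)
    subgoal by (rule eq) (auto simp: cl hom_module_apply linear_closed N.smult_r_distr)
    subgoal by (rule eq) (auto simp: cl hom_module_apply linear_closed N.smult_assoc1)
    subgoal by (rule eq) (auto simp: cl hom_module_apply linear_closed)
    done
qed

lemma evaluation_linear:
  assumes "module K M" "module K N" "x \<in> carrier M"
  shows "(\<lambda>f\<in>linear_maps K M N. f x) \<in> linear_maps K (hom_module K M N) N"
  using linear_maps_restrictI[OF module_hom_module[OF assms(1,2)], of "\<lambda>f. f x" N] assms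
  by (simp add: linear_closed hom_module_apply)

text \<open>Sums and scalar multiples of homomorphisms are pointwise, so linearity in the first
  argument may be tested at each second argument. The two sets coincide literally because on both
  sides the maps are extensional in each argument.\<close>

lemma bilinear_maps_eq:
  assumes "module K M" "module K N" "module K L"
  shows "bilinear_maps K L M N = linear_maps K L (hom_module K M N)"
proof (intro equalityI subsetI)
  interpret H: module K "hom_module K M N" using assms module_hom_module by blast
  interpret L: module K L by fact
  fix \<beta>
  {
    assume b: "\<beta> \<in> bilinear_maps K L M N"
    then have \<beta>: "\<beta> \<in> carrier L \<rightarrow>\<^sub>E linear_maps K M N"
      and lin: "\<And>y. y \<in> carrier M \<Longrightarrow> (\<lambda>x\<in>carrier L. \<beta> x y) \<in> linear_maps K L N"
      by (auto simp: bilinear_maps_def)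
    have cl: "\<beta> x \<in> linear_maps K M N" if "x \<in> carrier L" for x using \<beta> that by auto
    show "\<beta> \<in> linear_maps K L (hom_module K M N)"
    proof (rule linear_mapsI)
      show "\<beta> x \<in> carrier (hom_module K M N)" if "x \<in> carrier L" for x using cl that by simp
      show "\<beta> (x \<oplus>\<^bsub>L\<^esub> y) = \<beta> x \<oplus>\<^bsub>hom_module K M N\<^esub> \<beta> y" if "x \<in> carrier L" "y \<in> carrier L" for x y
        by (rule linear_eqI[of _ K M N])
          (use that cl H.M.a_closed linear_add[OF lin] in \<open>auto simp: hom_module_apply\<close>)
      show "\<beta> (k \<odot>\<^bsub>L\<^esub> x) = k \<odot>\<^bsub>hom_module K M N\<^esub> \<beta> x" if "k \<in> carrier K" "x \<in> carrier L" for k x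
        by (rule linear_eqI[of _ K M N])
          (use that cl H.smult_closed linear_smult[OF lin] in \<open>auto simp: hom_module_apply\<close>)
      show "\<beta> \<in> extensional (carrier L)" using \<beta> by (auto simp: PiE_def)
    qed
  }
  {
    assume b: "\<beta> \<in> linear_maps K L (hom_module K M N)"
    have "(\<lambda>x\<in>carrier L. \<beta> x y) \<in> linear_maps K L N" if "y \<in> carrier M" for y
      using linear_comp[OF assms(3) b evaluation_linear[OF assms(1,2) that]] linear_closed[OF b]
      by (simp cong: restrict_cong)
    then show "\<beta> \<in> bilinear_maps K L M N"
      using b by (auto simp: bilinear_maps_def linear_maps_def[of K L])
  }
qed

section \<open>Quotient modules\<close>

context
  fixes K :: "('k, 'r) ring_scheme" and M :: "('k, 'a, 'm) module_scheme" and N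
  assumes M: "module K M" and N: "submodule N K M"
begin

interpretation M: module K M by (rule M)

interpretation N: abelian_subgroup N M
  using submodule.axioms(1)[OF N] M.M.abelian_group_axioms
  by (intro abelian_subgroupI3 additive_subgroup.intro)

lemma carrier_quot_module: "carrier (quot_module M N) = (\<lambda>x. N +>\<^bsub>M\<^esub> x) ` carrier M"
  by (auto simp: quot_module_def A_RCOSETS_def')

lemma zero_quot_module: "\<zero>\<^bsub>quot_module M N\<^esub> = N +>\<^bsub>M\<^esub> \<zero>\<^bsub>M\<^esub>"
  by (simp add: quot_module_def N.a_subset)

lemma coset_eq_iff:
  assumes "x \<in> carrier M" "y \<in> carrier M"
  shows "N +>\<^bsub>M\<^esub> x = N +>\<^bsub>M\<^esub> y \<longleftrightarrow> x \<ominus>\<^bsub>M\<^esub> y \<in> N"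
  using assms N.a_rcos_module[of y x] N.a_repr_independence'[of x y] N.a_rcos_self[of x]
  by (auto simp: a_minus_def)

lemma coset_add:
  "x \<in> carrier M \<Longrightarrow> y \<in> carrier M \<Longrightarrow>
    (N +>\<^bsub>M\<^esub> x) \<oplus>\<^bsub>quot_module M N\<^esub> (N +>\<^bsub>M\<^esub> y) = N +>\<^bsub>M\<^esub> (x \<oplus>\<^bsub>M\<^esub> y)"
  by (simp add: quot_module_def N.a_rcos_sum)

text \<open>Scalar multiplication on the quotient is a union over all elements z of the coset. All
  the cosets united are equal, since k maps the difference of two representatives into N, and the
  family is nonempty.\<close>

lemma coset_smult:
  assumes k: "k \<in> carrier K" and x: "x \<in> carrier M"
  shows "k \<odot>\<^bsub>quot_module M N\<^esub> (N +>\<^bsub>M\<^esub> x) = N +>\<^bsub>M\<^esub> (k \<odot>\<^bsub>M\<^esub> x)"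
proof -
  have "N +>\<^bsub>M\<^esub> (k \<odot>\<^bsub>M\<^esub> z) = N +>\<^bsub>M\<^esub> (k \<odot>\<^bsub>M\<^esub> x)" if z: "z \<in> N +>\<^bsub>M\<^esub> x" for z
  proof -
    have zc: "z \<in> carrier M" using z x N.a_elemrcos_carrier by blast
    have "z \<ominus>\<^bsub>M\<^esub> x \<in> N" using N.a_rcos_module[OF x zc] z by (simp add: a_minus_def)
    then have "k \<odot>\<^bsub>M\<^esub> (z \<ominus>\<^bsub>M\<^esub> x) \<in> N" using k submodule.smult_closed[OF N] by blast
    moreover have "k \<odot>\<^bsub>M\<^esub> (z \<ominus>\<^bsub>M\<^esub> x) = k \<odot>\<^bsub>M\<^esub> z \<ominus>\<^bsub>M\<^esub> k \<odot>\<^bsub>M\<^esub> x"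
      using k zc x by (simp add: a_minus_def M.smult_r_distr M.smult_r_minus)
    ultimately show ?thesis using k x zc by (simp add: coset_eq_iff)
  qed
  then have "(\<Union>z\<in>N +>\<^bsub>M\<^esub> x. N +>\<^bsub>M\<^esub> (k \<odot>\<^bsub>M\<^esub> z)) = (\<Union>z\<in>N +>\<^bsub>M\<^esub> x. N +>\<^bsub>M\<^esub> (k \<odot>\<^bsub>M\<^esub> x))"
    by (rule SUP_cong[OF refl])
  also have "\<dots> = N +>\<^bsub>M\<^esub> (k \<odot>\<^bsub>M\<^esub> x)" using N.a_rcos_self[OF x] by blast
  finally show ?thesis unfolding quot_module_def module.simps .
qed

lemma module_quot_module: "module K (quot_module M N)"
proof -
  have coset: "\<exists>x\<in>carrier M. c = N +>\<^bsub>M\<^esub> x" if "c \<in> carrier (quot_module M N)" for c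
    using that by (auto simp: carrier_quot_module)
  have closed: "N +>\<^bsub>M\<^esub> x \<in> carrier (quot_module M N)" if "x \<in> carrier M" for x
    using that by (simp add: carrier_quot_module)
  show ?thesis
    apply (rule module_of_axioms, rule M.R.is_cring)
              apply ((drule coset)+, clarify, simp add: coset_add closed)
             apply (simp add: zero_quot_module closed)
            apply ((drule coset)+, clarify, simp add: coset_add M.M.a_assoc)
           apply ((drule coset)+, clarify, simp add: coset_add M.M.a_comm)
          apply ((drule coset)+, clarify, simp add: coset_add zero_quot_module)
         apply ((drule coset)+, clarify, simp add: coset_add coset_smult zero_quot_module M.smult_l_minus M.M.l_neg)
        apply (drule coset, clarify, simp add: coset_smult closed)
       apply (drule coset, clarify, simp add: coset_add coset_smult M.smult_l_distr)
      apply ((drule coset)+, clarify, simp add: coset_add coset_smult M.smult_r_distr)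
     apply (drule coset, clarify, simp add: coset_smult M.smult_assoc1)
    apply (drule coset, clarify, simp add: coset_smult)
    done
qed

lemma quot_proj_linear: "(\<lambda>x\<in>carrier M. N +>\<^bsub>M\<^esub> x) \<in> linear_maps K M (quot_module M N)"
  by (rule linear_maps_restrictI[OF M]) (auto simp: carrier_quot_module coset_add coset_smult)

text \<open>Universal property of the quotient. Values are taken at a chosen representative; another
  one differs by an element of N, where h vanishes.\<close>

lemma quot_lift:
  assumes L: "module K L" and h: "h \<in> linear_maps K M L" and ker: "\<And>x. x \<in> N \<Longrightarrow> h x = \<zero>\<^bsub>L\<^esub>"
  shows "\<exists>H\<in>linear_maps K (quot_module M N) L. \<forall>x\<in>carrier M. H (N +>\<^bsub>M\<^esub> x) = h x"
proof -
  interpret L: module K L by (rule L)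
  define H where "H = (\<lambda>c. h (SOME x. x \<in> carrier M \<and> c = N +>\<^bsub>M\<^esub> x))"
  have H: "H (N +>\<^bsub>M\<^esub> x) = h x" if x: "x \<in> carrier M" for x
  proof -
    let ?y = "SOME y. y \<in> carrier M \<and> N +>\<^bsub>M\<^esub> x = N +>\<^bsub>M\<^esub> y"
    have y: "?y \<in> carrier M \<and> N +>\<^bsub>M\<^esub> x = N +>\<^bsub>M\<^esub> ?y" by (rule someI[of _ x]) (use x in auto)
    then have "x \<ominus>\<^bsub>M\<^esub> ?y \<in> N" using x coset_eq_iff by blast
    then have "h x \<ominus>\<^bsub>L\<^esub> h ?y = \<zero>\<^bsub>L\<^esub>" using ker linear_minus[OF M L h x] y by metis
    then have "h x = h ?y" using x y linear_closed[OF h] by (simp add: minus_eq_zero_iff[OF L.M.abelian_group_axioms])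
    then show ?thesis by (simp add: H_def)
  qed
  have "restrict H (carrier (quot_module M N)) \<in> linear_maps K (quot_module M N) L"
    by (rule linear_maps_restrictI[OF module_quot_module])
      (auto simp: carrier_quot_module coset_add coset_smult H linear_closed[OF h] linear_add[OF h] linear_smult[OF h])
  moreover have "restrict H (carrier (quot_module M N)) (N +>\<^bsub>M\<^esub> x) = h x" if "x \<in> carrier M" for x
    using that H by (auto simp: carrier_quot_module)
  ultimately show ?thesis by blast
qed

end

lemma submodule_gen_submodule:
  assumes "module K M" "S \<subseteq> carrier M"
  shows "submodule (submodule_gen K M S) K M"
proof -
  interpret M: module K M by fact
  \<comment> \<open>The whole module belongs to the family, which keeps the intersection inside the
    carrier.\<close>
  have c: "carrier M \<in> {N. submodule N K M \<and> S \<subseteq> N}" using assms M.carrier_is_submodule by simp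
  show ?thesis unfolding submodule_gen_def
  proof (rule M.submoduleI)
    show "\<Inter> {N. submodule N K M \<and> S \<subseteq> N} \<subseteq> carrier M" using c by (rule Inter_lower)
    show "\<zero>\<^bsub>M\<^esub> \<in> \<Inter> {N. submodule N K M \<and> S \<subseteq> N}"
      using subgroup.one_closed[OF submodule.axioms(1)] by fastforce
  qed (auto dest: M.submoduleE)
qed

lemma submodule_gen_incl: "S \<subseteq> submodule_gen K M S"
  by (auto simp: submodule_gen_def)

lemma submodule_gen_least: "submodule N K M \<Longrightarrow> S \<subseteq> N \<Longrightarrow> submodule_gen K M S \<subseteq> N"
  by (auto simp: submodule_gen_def)

text \<open>The kernel of h, as the preimage of the zero submodule, is a submodule containing
  S.\<close>

lemma linear_vanishes_on_submodule_gen: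
  assumes "module K M" "module K L" "h \<in> linear_maps K M L" "S \<subseteq> carrier M"
    and "\<And>s. s \<in> S \<Longrightarrow> h s = \<zero>\<^bsub>L\<^esub>" and "x \<in> submodule_gen K M S"
  shows "h x = \<zero>\<^bsub>L\<^esub>"
proof -
  have "submodule_gen K M S \<subseteq> {x \<in> carrier M. h x \<in> {\<zero>\<^bsub>L\<^esub>}}"
    using assms(4,5)
    by (intro submodule_gen_least submodule_vimage[OF assms(1,2,3)] zero_submodule[OF assms(2,2)]) auto
  with assms(6) show ?thesis by auto
qed

section \<open>Direct sums\<close>

lemma carrier_coprod_module:
  "f \<in> carrier (coprod_module I M) \<longleftrightarrow> f \<in> (\<Pi>\<^sub>E i\<in>I. carrier (M i)) \<and> finite {i \<in> I. f i \<noteq> \<zero>\<^bsub>M i\<^esub>}"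
  by (simp add: coprod_module_def)

lemma coprod_module_apply:
  "i \<in> I \<Longrightarrow> (f \<oplus>\<^bsub>coprod_module I M\<^esub> g) i = f i \<oplus>\<^bsub>M i\<^esub> g i"
  "i \<in> I \<Longrightarrow> (k \<odot>\<^bsub>coprod_module I M\<^esub> f) i = k \<odot>\<^bsub>M i\<^esub> f i"
  "i \<in> I \<Longrightarrow> \<zero>\<^bsub>coprod_module I M\<^esub> i = \<zero>\<^bsub>M i\<^esub>"
  by (simp_all add: coprod_module_def)

definition coprod_incl :: "'i set \<Rightarrow> ('i \<Rightarrow> ('k, 'a, 'm) module_scheme) \<Rightarrow> 'i \<Rightarrow> 'a \<Rightarrow> 'i \<Rightarrow> 'a"
  where "coprod_incl I M i c = (\<lambda>j\<in>I. if j = i then c else \<zero>\<^bsub>M j\<^esub>)"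

context
  fixes K :: "('k, 'r) ring_scheme" and I :: "'i set" and M :: "'i \<Rightarrow> ('k, 'a, 'm) module_scheme"
  assumes K: "cring K" and mods: "\<And>i. i \<in> I \<Longrightarrow> module K (M i)"
begin

lemma coprod_closed:
  assumes "i \<in> I"
  shows "f \<in> carrier (coprod_module I M) \<Longrightarrow> f i \<in> carrier (M i)"
  using assms by (auto simp: carrier_coprod_module)

lemma coprod_add_closed:
  assumes "f \<in> carrier (coprod_module I M)" "g \<in> carrier (coprod_module I M)"
  shows "f \<oplus>\<^bsub>coprod_module I M\<^esub> g \<in> carrier (coprod_module I M)"
proof -
  have ab: "abelian_group (M i)" if "i \<in> I" for i using mods[OF that] by (simp add: module_def)
  have "{i \<in> I. f i \<oplus>\<^bsub>M i\<^esub> g i \<noteq> \<zero>\<^bsub>M i\<^esub>} \<subseteq> {i \<in> I. f i \<noteq> \<zero>\<^bsub>M i\<^esub>} \<union> {i \<in> I. g i \<noteq> \<zero>\<^bsub>M i\<^esub>}"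
    using ab by (auto simp: abelian_group_def abelian_monoid.l_zero abelian_monoid.zero_closed)
  moreover have "finite \<dots>" using assms by (simp add: carrier_coprod_module)
  ultimately have "finite {i \<in> I. f i \<oplus>\<^bsub>M i\<^esub> g i \<noteq> \<zero>\<^bsub>M i\<^esub>}" by (rule finite_subset)
  then show ?thesis
    using assms ab
    by (auto simp: coprod_module_def abelian_group_def intro!: abelian_monoid.a_closed elim!: rev_finite_subset)
qed

lemma coprod_smult_closed:
  assumes "k \<in> carrier K" "f \<in> carrier (coprod_module I M)"
  shows "k \<odot>\<^bsub>coprod_module I M\<^esub> f \<in> carrier (coprod_module I M)"
proof -
  have "{i \<in> I. k \<odot>\<^bsub>M i\<^esub> f i \<noteq> \<zero>\<^bsub>M i\<^esub>} \<subseteq> {i \<in> I. f i \<noteq> \<zero>\<^bsub>M i\<^esub>}"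
    using module.smult_r_null[OF mods] assms(1) by auto
  then have "finite {i \<in> I. k \<odot>\<^bsub>M i\<^esub> f i \<noteq> \<zero>\<^bsub>M i\<^esub>}"
    using assms(2) by (auto simp: carrier_coprod_module elim: finite_subset)
  then show ?thesis
    using assms module.smult_closed[OF mods]
    by (auto simp: coprod_module_def elim!: rev_finite_subset)
qed

lemma coprod_zero_closed: "\<zero>\<^bsub>coprod_module I M\<^esub> \<in> carrier (coprod_module I M)"
  using mods by (auto simp: coprod_module_def module_def abelian_group_def abelian_monoid.zero_closed)

lemma coprod_eqI:
  assumes "f \<in> carrier (coprod_module I M)" "g \<in> carrier (coprod_module I M)" "\<And>i. i \<in> I \<Longrightarrow> f i = g i"
  shows "f = g"
  using assms by (auto simp: carrier_coprod_module intro: PiE_ext)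

lemma module_coprod_module: "module K (coprod_module I M)"
proof -
  note cl = coprod_add_closed coprod_smult_closed coprod_zero_closed coprod_closed
  have ab: "abelian_group (M i)" if "i \<in> I" for i using mods[OF that] by (simp add: module_def)
  have am: "abelian_monoid (M i)" if "i \<in> I" for i using ab[OF that] by (simp add: abelian_group_def)
  interpret K: cring K by (rule K)
  show ?thesis
    apply (rule module_of_axioms)
    subgoal by (rule K)
    subgoal by (simp add: cl)
    subgoal by (simp add: cl)
    subgoal by (rule coprod_eqI) (auto simp: cl coprod_module_apply abelian_monoid.a_assoc[OF am])
    subgoal by (rule coprod_eqI) (auto simp: cl coprod_module_apply abelian_monoid.a_comm[OF am])
    subgoal by (rule coprod_eqI) (auto simp: cl coprod_module_apply abelian_monoid.l_zero[OF am])
    subgoal by (rule coprod_eqI) (auto simp: cl coprod_module_apply module.smult_l_minus[OF mods]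
          module.smult_one[OF mods] abelian_group.l_neg[OF ab])
    subgoal by (simp add: cl)
    subgoal by (rule coprod_eqI) (auto simp: cl coprod_module_apply module.smult_l_distr[OF mods])
    subgoal by (rule coprod_eqI) (auto simp: cl coprod_module_apply module.smult_r_distr[OF mods])
    subgoal by (rule coprod_eqI) (auto simp: cl coprod_module_apply module.smult_assoc1[OF mods])
    subgoal by (rule coprod_eqI) (auto simp: cl coprod_module_apply module.smult_one[OF mods])
    done
qed

lemma coprod_incl_closed:
  assumes "i \<in> I" "c \<in> carrier (M i)"
  shows "coprod_incl I M i c \<in> carrier (coprod_module I M)"
proof -
  have "{j \<in> I. coprod_incl I M i c j \<noteq> \<zero>\<^bsub>M j\<^esub>} \<subseteq> {i}" by (auto simp: coprod_incl_def)
  then have "finite {j \<in> I. coprod_incl I M i c j \<noteq> \<zero>\<^bsub>M j\<^esub>}" by (rule finite_subset) simp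
  then show ?thesis
    using assms mods
    by (auto simp: carrier_coprod_module coprod_incl_def module_def abelian_group_def abelian_monoid.zero_closed)
qed

lemma coprod_incl_linear:
  assumes "i \<in> I"
  shows "restrict (coprod_incl I M i) (carrier (M i)) \<in> linear_maps K (M i) (coprod_module I M)"
proof (rule linear_maps_restrictI[OF mods[OF assms]])
  note cl = coprod_add_closed coprod_smult_closed coprod_incl_closed
  have m: "module K (M j)" "abelian_monoid (M j)" if "j \<in> I" for j using mods[OF that]
    by (simp_all add: module_def abelian_group_def)
  interpret Mi: module K "M i" using assms by (rule mods)
  show "coprod_incl I M i x \<in> carrier (coprod_module I M)" if "x \<in> carrier (M i)" for x
    using assms that by (rule coprod_incl_closed)
  show "coprod_incl I M i (x \<oplus>\<^bsub>M i\<^esub> y) = coprod_incl I M i x \<oplus>\<^bsub>coprod_module I M\<^esub> coprod_incl I M i y"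
    if "x \<in> carrier (M i)" "y \<in> carrier (M i)" for x y
    using that assms by (intro coprod_eqI cl)
      (auto simp: coprod_module_apply coprod_incl_def abelian_monoid.l_zero[OF m(2)] abelian_monoid.zero_closed[OF m(2)])
  show "coprod_incl I M i (k \<odot>\<^bsub>M i\<^esub> x) = k \<odot>\<^bsub>coprod_module I M\<^esub> coprod_incl I M i x"
    if "k \<in> carrier K" "x \<in> carrier (M i)" for k x
    using that assms by (intro coprod_eqI cl)
      (auto simp: coprod_module_apply coprod_incl_def module.smult_r_null[OF m(1)])
qed

lemma coprod_induct:
  assumes f: "f \<in> carrier (coprod_module I M)"
    and incl: "\<And>i c. i \<in> I \<Longrightarrow> c \<in> carrier (M i) \<Longrightarrow> P (coprod_incl I M i c)"
    and zero: "P \<zero>\<^bsub>coprod_module I M\<^esub>"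
    and add: "\<And>f g. f \<in> carrier (coprod_module I M) \<Longrightarrow> g \<in> carrier (coprod_module I M) \<Longrightarrow>
      P f \<Longrightarrow> P g \<Longrightarrow> P (f \<oplus>\<^bsub>coprod_module I M\<^esub> g)"
  shows "P f"
proof -
  \<comment> \<open>The induction runs over a finite set containing the support rather than the
    support itself, so that clearing one coordinate is enough for the induction step.\<close>
  have "P f" if "finite S" "f \<in> carrier (coprod_module I M)" "{i \<in> I. f i \<noteq> \<zero>\<^bsub>M i\<^esub>} \<subseteq> S" for S f
    using that
  proof (induction S arbitrary: f)
    case empty
    then have "f = \<zero>\<^bsub>coprod_module I M\<^esub>"
      by (intro coprod_eqI coprod_zero_closed) (auto simp: coprod_module_apply)
    then show ?case using zero by simp
  next
    case (insert a S)
    show ?case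
    proof (cases "a \<in> I")
      case False
      then show ?thesis using insert by blast
    next
      case True
      interpret Ma: module K "M a" using True by (rule mods)
      let ?g = "f(a := \<zero>\<^bsub>M a\<^esub>)"
      have fin: "finite {i \<in> I. ?g i \<noteq> \<zero>\<^bsub>M i\<^esub>}"
        using insert.prems(1) by (auto simp: carrier_coprod_module elim!: rev_finite_subset)
      then have g: "?g \<in> carrier (coprod_module I M)"
        using insert.prems(1) True by (auto simp: carrier_coprod_module PiE_def extensional_def)
      have fa: "f a \<in> carrier (M a)" using True insert.prems(1) by (rule coprod_closed)
      have "P ?g" using insert.prems by (intro insert.IH g) auto
      moreover have "f = coprod_incl I M a (f a) \<oplus>\<^bsub>coprod_module I M\<^esub> ?g"
      proof (rule coprod_eqI)
        fix i assume "i \<in> I"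
        interpret Mi: module K "M i" using \<open>i \<in> I\<close> by (rule mods)
        show "f i = (coprod_incl I M a (f a) \<oplus>\<^bsub>coprod_module I M\<^esub> ?g) i"
          using \<open>i \<in> I\<close> coprod_closed[OF \<open>i \<in> I\<close> insert.prems(1)]
          by (auto simp: coprod_module_apply coprod_incl_def)
      qed (use insert.prems(1) True fa g in \<open>auto intro: coprod_add_closed coprod_incl_closed\<close>)
      ultimately show ?thesis using add[OF coprod_incl_closed[OF True fa] g] incl[OF True fa] by metis
    qed
  qed
  then show ?thesis using f by (auto simp: carrier_coprod_module)
qed

lemma coprod_lift:
  assumes L: "module K L" and h: "\<And>i. i \<in> I \<Longrightarrow> h i \<in> linear_maps K (M i) L"
  shows "\<exists>H\<in>linear_maps K (coprod_module I M) L. \<forall>i\<in>I. \<forall>c\<in>carrier (M i). H (coprod_incl I M i c) = h i c"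
proof -
  interpret L: module K L by (rule L)
  define H where "H = (\<lambda>f. \<Oplus>\<^bsub>L\<^esub>i\<in>{i \<in> I. f i \<noteq> \<zero>\<^bsub>M i\<^esub>}. h i (f i))"
  \<comment> \<open>The support varies with f, so additivity cannot be read off the definition. Over
    a common finite superset the extra terms vanish and sums can be compared term by term.\<close>
  have H: "H f = (\<Oplus>\<^bsub>L\<^esub>i\<in>S. h i (f i))"
    if "f \<in> carrier (coprod_module I M)" "finite S" "S \<subseteq> I" "{i \<in> I. f i \<noteq> \<zero>\<^bsub>M i\<^esub>} \<subseteq> S" for f S
    unfolding H_def
  proof (rule L.M.add.finprod_mono_neutral_cong_left)
    show "\<And>i. i \<in> S - {i \<in> I. f i \<noteq> \<zero>\<^bsub>M i\<^esub>} \<Longrightarrow> h i (f i) = \<zero>\<^bsub>L\<^esub>"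
      using linear_zero[OF mods L h] that by auto
  qed (use that h in \<open>auto intro!: linear_closed[OF h] coprod_closed\<close>)
  have lin: "restrict H (carrier (coprod_module I M)) \<in> linear_maps K (coprod_module I M) L"
  proof (rule linear_maps_restrictI[OF module_coprod_module])
    show "H f \<in> carrier L" if "f \<in> carrier (coprod_module I M)" for f
      using that by (auto simp: H_def intro!: L.M.finsum_closed linear_closed[OF h] coprod_closed)
    show "H (f \<oplus>\<^bsub>coprod_module I M\<^esub> g) = H f \<oplus>\<^bsub>L\<^esub> H g"
      if f: "f \<in> carrier (coprod_module I M)" and g: "g \<in> carrier (coprod_module I M)" for f g
    proof -
      define S where "S = {i \<in> I. f i \<noteq> \<zero>\<^bsub>M i\<^esub>} \<union> {i \<in> I. g i \<noteq> \<zero>\<^bsub>M i\<^esub>}"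
      have S: "finite S" "S \<subseteq> I" using f g by (auto simp: S_def carrier_coprod_module)
      have "{i \<in> I. (f \<oplus>\<^bsub>coprod_module I M\<^esub> g) i \<noteq> \<zero>\<^bsub>M i\<^esub>} \<subseteq> S"
        using mods by (auto simp: S_def coprod_module_apply module_def abelian_group_def
            abelian_monoid.l_zero abelian_monoid.zero_closed)
      then have "H (f \<oplus>\<^bsub>coprod_module I M\<^esub> g) = (\<Oplus>\<^bsub>L\<^esub>i\<in>S. h i ((f \<oplus>\<^bsub>coprod_module I M\<^esub> g) i))"
        using S by (intro H coprod_add_closed f g)
      also have "\<dots> = (\<Oplus>\<^bsub>L\<^esub>i\<in>S. h i (f i) \<oplus>\<^bsub>L\<^esub> h i (g i))"
        using S f g by (intro L.M.finsum_cong')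
          (auto simp: coprod_module_apply coprod_closed linear_add[OF h] linear_closed[OF h] subset_eq)
      also have "\<dots> = (\<Oplus>\<^bsub>L\<^esub>i\<in>S. h i (f i)) \<oplus>\<^bsub>L\<^esub> (\<Oplus>\<^bsub>L\<^esub>i\<in>S. h i (g i))"
        using S f g by (intro L.M.finsum_addf) (auto intro!: linear_closed[OF h] coprod_closed)
      also have "(\<Oplus>\<^bsub>L\<^esub>i\<in>S. h i (f i)) = H f" using S by (intro H[symmetric] f) (auto simp: S_def)
      also have "(\<Oplus>\<^bsub>L\<^esub>i\<in>S. h i (g i)) = H g" using S by (intro H[symmetric] g) (auto simp: S_def)
      finally show ?thesis .
    qed
    show "H (k \<odot>\<^bsub>coprod_module I M\<^esub> f) = k \<odot>\<^bsub>L\<^esub> H f"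
      if k: "k \<in> carrier K" and f: "f \<in> carrier (coprod_module I M)" for k f
    proof -
      define S where "S = {i \<in> I. f i \<noteq> \<zero>\<^bsub>M i\<^esub>}"
      have S: "finite S" "S \<subseteq> I" using f by (auto simp: S_def carrier_coprod_module)
      have "{i \<in> I. (k \<odot>\<^bsub>coprod_module I M\<^esub> f) i \<noteq> \<zero>\<^bsub>M i\<^esub>} \<subseteq> S"
        using module.smult_r_null[OF mods k] by (auto simp: S_def coprod_module_apply)
      then have "H (k \<odot>\<^bsub>coprod_module I M\<^esub> f) = (\<Oplus>\<^bsub>L\<^esub>i\<in>S. h i ((k \<odot>\<^bsub>coprod_module I M\<^esub> f) i))"
        using S by (intro H coprod_smult_closed k f)
      also have "\<dots> = (\<Oplus>\<^bsub>L\<^esub>i\<in>S. k \<odot>\<^bsub>L\<^esub> h i (f i))"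
        using S f k by (intro L.M.finsum_cong')
          (auto simp: coprod_module_apply coprod_closed linear_smult[OF h] linear_closed[OF h] subset_eq)
      also have "\<dots> = k \<odot>\<^bsub>L\<^esub> (\<Oplus>\<^bsub>L\<^esub>i\<in>S. h i (f i))"
        using S f k by (intro L.finsum_smult_ldistr[symmetric]) (auto intro!: linear_closed[OF h] coprod_closed)
      also have "(\<Oplus>\<^bsub>L\<^esub>i\<in>S. h i (f i)) = H f" using S by (intro H[symmetric] f) (auto simp: S_def)
      finally show ?thesis .
    qed
  qed
  have "H (coprod_incl I M i c) = h i c" if i: "i \<in> I" and c: "c \<in> carrier (M i)" for i c
  proof -
    have "H (coprod_incl I M i c) = (\<Oplus>\<^bsub>L\<^esub>j\<in>{i}. h j (coprod_incl I M i c j))"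
      using i c by (intro H coprod_incl_closed) (auto simp: coprod_incl_def)
    also have "\<dots> = h i c" using linear_closed[OF h[OF i] c] i
      by (simp add: coprod_incl_def)
    finally show ?thesis .
  qed
  then show ?thesis using lin coprod_incl_closed by (intro bexI[of _ "restrict H (carrier (coprod_module I M))"]) auto
qed

end

section \<open>Tensor powers\<close>

lemma free_gen_eq_coprod_incl: "free_gen K I x = coprod_incl I (\<lambda>_. self_module K) x \<one>\<^bsub>K\<^esub>"
  by (auto simp: free_gen_def coprod_incl_def restrict_def)

context
  fixes K :: "('k, 'r) ring_scheme"
  assumes K: "cring K"
begin

interpretation K: cring K by (rule K)

lemma module_free_module: "module K (free_module K I)"
  unfolding free_module_def by (intro module_coprod_module K module_self_module)

lemma free_gen_closed: "x \<in> I \<Longrightarrow> free_gen K I x \<in> carrier (free_module K I)"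
  unfolding free_module_def free_gen_eq_coprod_incl
  by (intro coprod_incl_closed[OF K module_self_module[OF K]]) auto

lemma coprod_incl_eq_smult_free_gen:
  assumes "x \<in> I" "k \<in> carrier K"
  shows "coprod_incl I (\<lambda>_. self_module K) x k = k \<odot>\<^bsub>free_module K I\<^esub> free_gen K I x"
  using linear_smult[OF coprod_incl_linear[OF K module_self_module[OF K] assms(1)] assms(2), of "\<one>\<^bsub>K\<^esub>"] assms
  by (simp add: free_module_def free_gen_eq_coprod_incl)

lemma free_induct:
  assumes f: "f \<in> carrier (free_module K I)"
    and gen: "\<And>x. x \<in> I \<Longrightarrow> P (free_gen K I x)"
    and zero: "P \<zero>\<^bsub>free_module K I\<^esub>"
    and add: "\<And>f g. f \<in> carrier (free_module K I) \<Longrightarrow> g \<in> carrier (free_module K I) \<Longrightarrow>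
      P f \<Longrightarrow> P g \<Longrightarrow> P (f \<oplus>\<^bsub>free_module K I\<^esub> g)"
    and smult: "\<And>k f. k \<in> carrier K \<Longrightarrow> f \<in> carrier (free_module K I) \<Longrightarrow>
      P f \<Longrightarrow> P (k \<odot>\<^bsub>free_module K I\<^esub> f)"
  shows "P f"
proof (rule coprod_induct[where I = I and M = "\<lambda>_. self_module K" and P = P, OF K module_self_module[OF K]])
  show "f \<in> carrier (coprod_module I (\<lambda>_. self_module K))" using f by (simp add: free_module_def)
  show "P (coprod_incl I (\<lambda>_. self_module K) i c)" if "i \<in> I" "c \<in> carrier (self_module K)" for i c
    using that coprod_incl_eq_smult_free_gen[of i I c] smult[OF _ free_gen_closed gen, of c i] by simp
qed (use zero add in \<open>simp_all add: free_module_def\<close>)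

text \<open>The free module is a direct sum of copies of K; on the copy of index i the map sends k
  to the k-fold multiple of \<open>g i\<close>.\<close>

lemma free_lift:
  assumes L: "module K L" and g: "\<And>x. x \<in> I \<Longrightarrow> g x \<in> carrier L"
  shows "\<exists>H\<in>linear_maps K (free_module K I) L. \<forall>x\<in>I. H (free_gen K I x) = g x"
proof -
  interpret L: module K L by (rule L)
  have "\<exists>H\<in>linear_maps K (coprod_module I (\<lambda>_. self_module K)) L.
    \<forall>i\<in>I. \<forall>c\<in>carrier (self_module K). H (coprod_incl I (\<lambda>_. self_module K) i c) =
      (\<lambda>k\<in>carrier (self_module K). k \<odot>\<^bsub>L\<^esub> g i) c"
    by (intro coprod_lift[OF K module_self_module[OF K] L] linear_maps_restrictI[OF module_self_module[OF K]])
      (auto simp: g L.smult_l_distr L.smult_assoc1)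
  then obtain H where H: "H \<in> linear_maps K (free_module K I) L"
    and Hi: "\<And>i. i \<in> I \<Longrightarrow> H (free_gen K I i) = (\<lambda>k\<in>carrier K. k \<odot>\<^bsub>L\<^esub> g i) \<one>\<^bsub>K\<^esub>"
    unfolding free_module_def free_gen_eq_coprod_incl by (metis K.one_closed self_module_simps(1))
  have "H (free_gen K I i) = g i" if "i \<in> I" for i using Hi[OF that] g[OF that] by simp
  with H show ?thesis by blast
qed

end

text \<open>Both conditions change one slot of a full tuple by function update, in the same shape as
  the generators of \<open>multilinear_relations\<close>, so that the linear extension of such a map
  visibly kills each generator.\<close>

definition multilinear_map :: "('k, 'r) ring_scheme \<Rightarrow> ('k, 'e, 'm) module_scheme \<Rightarrow> nat
    \<Rightarrow> ('k, 'a, 'n) module_scheme \<Rightarrow> ((nat \<Rightarrow> 'e) \<Rightarrow> 'a) \<Rightarrow> bool"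
  where "multilinear_map K E d N h \<longleftrightarrow>
    (\<forall>x\<in>tuples E d. h x \<in> carrier N) \<and>
    (\<forall>x\<in>tuples E d. \<forall>i\<in>{1..d}. \<forall>u\<in>carrier E. \<forall>v\<in>carrier E.
      h (x(i := u \<oplus>\<^bsub>E\<^esub> v)) = h (x(i := u)) \<oplus>\<^bsub>N\<^esub> h (x(i := v))) \<and>
    (\<forall>x\<in>tuples E d. \<forall>i\<in>{1..d}. \<forall>k\<in>carrier K. \<forall>u\<in>carrier E.
      h (x(i := k \<odot>\<^bsub>E\<^esub> u)) = k \<odot>\<^bsub>N\<^esub> h (x(i := u)))"

lemma multilinear_mapI:
  assumes "\<And>x. x \<in> tuples E d \<Longrightarrow> h x \<in> carrier N"
    and "\<And>x i u v. x \<in> tuples E d \<Longrightarrow> i \<in> {1..d} \<Longrightarrow> u \<in> carrier E \<Longrightarrow> v \<in> carrier E \<Longrightarrow>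
      h (x(i := u \<oplus>\<^bsub>E\<^esub> v)) = h (x(i := u)) \<oplus>\<^bsub>N\<^esub> h (x(i := v))"
    and "\<And>x i k u. x \<in> tuples E d \<Longrightarrow> i \<in> {1..d} \<Longrightarrow> k \<in> carrier K \<Longrightarrow> u \<in> carrier E \<Longrightarrow>
      h (x(i := k \<odot>\<^bsub>E\<^esub> u)) = k \<odot>\<^bsub>N\<^esub> h (x(i := u))"
  shows "multilinear_map K E d N h"
  using assms by (simp add: multilinear_map_def)

lemma multilinear_map_closed: "multilinear_map K E d N h \<Longrightarrow> x \<in> tuples E d \<Longrightarrow> h x \<in> carrier N"
  by (simp add: multilinear_map_def)

lemma multilinear_map_add: "multilinear_map K E d N h \<Longrightarrow> x \<in> tuples E d \<Longrightarrow> i \<in> {1..d} \<Longrightarrow>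
    u \<in> carrier E \<Longrightarrow> v \<in> carrier E \<Longrightarrow> h (x(i := u \<oplus>\<^bsub>E\<^esub> v)) = h (x(i := u)) \<oplus>\<^bsub>N\<^esub> h (x(i := v))"
  by (simp add: multilinear_map_def)

lemma multilinear_map_smult: "multilinear_map K E d N h \<Longrightarrow> x \<in> tuples E d \<Longrightarrow> i \<in> {1..d} \<Longrightarrow>
    k \<in> carrier K \<Longrightarrow> u \<in> carrier E \<Longrightarrow> h (x(i := k \<odot>\<^bsub>E\<^esub> u)) = k \<odot>\<^bsub>N\<^esub> h (x(i := u))"
  by (simp add: multilinear_map_def)

lemma tuples_upd: "x \<in> tuples E d \<Longrightarrow> i \<in> {1..d} \<Longrightarrow> u \<in> carrier E \<Longrightarrow> x(i := u) \<in> tuples E d"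
  by (auto simp: tuples_def PiE_def extensional_def)

lemma tuples_restrict [simp]: "x \<in> tuples E d \<Longrightarrow> restrict x {1..d} = x"
  by (simp add: tuples_def PiE_restrict)

lemma tuples_restrict_Suc [simp]: "x \<in> tuples E d \<Longrightarrow> restrict x {Suc 0..d} = x"
  using tuples_restrict[of x E d] by simp

lemma tuples_comp_iff:
  assumes "\<sigma> permutes {1..d}"
  shows "x \<circ> \<sigma> \<in> tuples E d \<longleftrightarrow> x \<in> tuples E d"
proof -
  have "y \<circ> \<tau> \<in> tuples E d" if "y \<in> tuples E d" "\<tau> permutes {1..d}" for y \<tau>
    using that permutes_in_image[OF that(2)] permutes_not_in[OF that(2)]
    by (auto simp: tuples_def PiE_def extensional_def Pi_iff)
  from this[of x \<sigma>] this[of "x \<circ> \<sigma>" "inv' \<sigma>"] show ?thesis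
    using assms permutes_inv[OF assms] by (auto simp: comp_assoc permutes_inv_o)
qed

lemma upd_comp_inv:
  assumes "\<sigma> permutes S"
  shows "x(i := u) \<circ> inv' \<sigma> = (x \<circ> inv' \<sigma>)(\<sigma> i := u)"
  using permutes_inverses[OF assms] by (auto simp: fun_eq_iff)

lemma multilinear_map_comp:
  assumes E: "module K E" and h: "multilinear_map K E d M h" and p: "p \<in> linear_maps K M N"
    and g: "\<And>x. x \<in> tuples E d \<Longrightarrow> g x = p (h x)"
  shows "multilinear_map K E d N g"
proof -
  interpret E: module K E by (rule E)
  note hc = multilinear_map_closed[OF h]
  show ?thesis
  proof (rule multilinear_mapI)
    show "g x \<in> carrier N" if "x \<in> tuples E d" for x
      using linear_closed[OF p hc[OF that]] g[OF that] by simp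
    show "g (x(i := u \<oplus>\<^bsub>E\<^esub> v)) = g (x(i := u)) \<oplus>\<^bsub>N\<^esub> g (x(i := v))"
      if "x \<in> tuples E d" "i \<in> {1..d}" "u \<in> carrier E" "v \<in> carrier E" for x i u v
      using tuples_upd[OF that(1,2)] that(3,4) multilinear_map_add[OF h that] by (simp add: g linear_add[OF p] hc)
    show "g (x(i := k \<odot>\<^bsub>E\<^esub> u)) = k \<odot>\<^bsub>N\<^esub> g (x(i := u))"
      if "x \<in> tuples E d" "i \<in> {1..d}" "k \<in> carrier K" "u \<in> carrier E" for x i k u
      using tuples_upd[OF that(1,2)] that(3,4) multilinear_map_smult[OF h that] by (simp add: g linear_smult[OF p] hc)
  qed
qed

context
  fixes K :: "('k, 'r) ring_scheme" and E :: "('k, 'e, 'm) module_scheme" and d :: nat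
  assumes E: "module K E"
begin

interpretation E: module K E by (rule E)

interpretation F: module K "free_module K (tuples E d)"
  by (rule module_free_module[OF E.R.is_cring])

lemmas FM = module_free_module[OF E.R.is_cring]

lemma multilinear_relations_closed:
  "multilinear_relations K E d \<subseteq> carrier (free_module K (tuples E d))"
  by (auto simp: multilinear_relations_def Let_def
      intro!: F.M.minus_closed F.smult_closed F.M.add.m_closed free_gen_closed[OF E.R.is_cring] tuples_upd)

lemma tensor_submodule_submodule:
  "submodule (tensor_submodule K E d) K (free_module K (tuples E d))"
  unfolding tensor_submodule_def by (rule submodule_gen_submodule[OF FM multilinear_relations_closed])

lemma module_tensor_power: "module K (tensor_power K E d)"
  unfolding tensor_power_def by (rule module_quot_module[OF FM tensor_submodule_submodule])

lemma pure_tensor_closed: "x \<in> tuples E d \<Longrightarrow> pure_tensor K E d x \<in> carrier (tensor_power K E d)"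
  by (simp add: pure_tensor_def tensor_power_def carrier_quot_module[OF FM tensor_submodule_submodule]
      free_gen_closed[OF E.R.is_cring])

text \<open>Universal property of the tensor power: the map on tuples extends linearly to the free
  module, and multilinearity says exactly that the extension kills the relations.\<close>

lemma tensor_lift:
  assumes L: "module K L" and h: "multilinear_map K E d L h"
  shows "\<exists>H\<in>linear_maps K (tensor_power K E d) L. \<forall>x\<in>tuples E d. H (pure_tensor K E d x) = h x"
proof -
  interpret L: module K L by (rule L)
  obtain H0 where H0: "H0 \<in> linear_maps K (free_module K (tuples E d)) L"
    and H0g: "\<And>x. x \<in> tuples E d \<Longrightarrow> H0 (free_gen K (tuples E d) x) = h x"
    using free_lift[OF E.R.is_cring L, of "tuples E d" h] multilinear_map_closed[OF h] by blast
  note gc = free_gen_closed[OF E.R.is_cring]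
  have rel: "H0 s = \<zero>\<^bsub>L\<^esub>" if "s \<in> multilinear_relations K E d" for s
    using that
    by (auto simp: multilinear_relations_def Let_def linear_minus[OF FM L H0] linear_add[OF H0]
        linear_smult[OF H0] gc tuples_upd H0g multilinear_map_add[OF h] multilinear_map_smult[OF h]
        minus_eq_zero_iff[OF L.M.abelian_group_axioms] multilinear_map_closed[OF h])
  have "\<exists>H\<in>linear_maps K (tensor_power K E d) L.
      \<forall>x\<in>carrier (free_module K (tuples E d)). H (tensor_submodule K E d +>\<^bsub>free_module K (tuples E d)\<^esub> x) = H0 x"
    unfolding tensor_power_def
  proof (rule quot_lift[OF FM tensor_submodule_submodule L H0])
    show "H0 x = \<zero>\<^bsub>L\<^esub>" if "x \<in> tensor_submodule K E d" for x
      using linear_vanishes_on_submodule_gen[OF FM L H0 multilinear_relations_closed rel] that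
      by (simp add: tensor_submodule_def)
  qed
  then obtain H where H: "H \<in> linear_maps K (tensor_power K E d) L"
    "\<And>x. x \<in> carrier (free_module K (tuples E d)) \<Longrightarrow>
      H (tensor_submodule K E d +>\<^bsub>free_module K (tuples E d)\<^esub> x) = H0 x"
    by blast
  then have "H (pure_tensor K E d x) = h x" if "x \<in> tuples E d" for x
    using that gc[OF that] by (simp add: pure_tensor_def H0g)
  with H(1) show ?thesis by blast
qed

lemma tensor_induct:
  assumes z: "z \<in> carrier (tensor_power K E d)"
    and gen: "\<And>x. x \<in> tuples E d \<Longrightarrow> P (pure_tensor K E d x)"
    and zero: "P \<zero>\<^bsub>tensor_power K E d\<^esub>"
    and add: "\<And>f g. f \<in> carrier (tensor_power K E d) \<Longrightarrow> g \<in> carrier (tensor_power K E d) \<Longrightarrow>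
      P f \<Longrightarrow> P g \<Longrightarrow> P (f \<oplus>\<^bsub>tensor_power K E d\<^esub> g)"
    and smult: "\<And>k f. k \<in> carrier K \<Longrightarrow> f \<in> carrier (tensor_power K E d) \<Longrightarrow>
      P f \<Longrightarrow> P (k \<odot>\<^bsub>tensor_power K E d\<^esub> f)"
  shows "P z"
proof -
  let ?F = "free_module K (tuples E d)" and ?N = "tensor_submodule K E d"
  note N = FM tensor_submodule_submodule
  have cl: "?N +>\<^bsub>?F\<^esub> f \<in> carrier (tensor_power K E d)" if "f \<in> carrier ?F" for f
    using that by (simp add: tensor_power_def carrier_quot_module[OF N])
  obtain f where f: "f \<in> carrier ?F" "z = ?N +>\<^bsub>?F\<^esub> f"
    using z by (auto simp: tensor_power_def carrier_quot_module[OF N])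
  have "P (?N +>\<^bsub>?F\<^esub> f)" using f(1)
  proof (rule free_induct[OF E.R.is_cring])
    show "P (?N +>\<^bsub>?F\<^esub> free_gen K (tuples E d) x)" if "x \<in> tuples E d" for x
      using gen[OF that] that by (simp add: pure_tensor_def)
    show "P (?N +>\<^bsub>?F\<^esub> \<zero>\<^bsub>?F\<^esub>)" using zero by (simp add: tensor_power_def zero_quot_module[OF N])
    show "P (?N +>\<^bsub>?F\<^esub> (f \<oplus>\<^bsub>?F\<^esub> g))"
      if "f \<in> carrier ?F" "g \<in> carrier ?F" "P (?N +>\<^bsub>?F\<^esub> f)" "P (?N +>\<^bsub>?F\<^esub> g)" for f g
      using add[OF cl cl that(3,4)] that by (simp add: tensor_power_def coset_add[OF N])
    show "P (?N +>\<^bsub>?F\<^esub> (k \<odot>\<^bsub>?F\<^esub> f))"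
      if "k \<in> carrier K" "f \<in> carrier ?F" "P (?N +>\<^bsub>?F\<^esub> f)" for k f
      using smult[OF that(1) cl that(3)] that by (simp add: tensor_power_def coset_smult[OF N])
  qed
  then show ?thesis using f by simp
qed

lemma pure_tensor_multilinear: "multilinear_map K E d (tensor_power K E d) (pure_tensor K E d)"
proof (rule multilinear_mapI)
  let ?F = "free_module K (tuples E d)" and ?N = "tensor_submodule K E d" and ?g = "free_gen K (tuples E d)"
  note N = FM tensor_submodule_submodule
  note gc = free_gen_closed[OF E.R.is_cring]
  note rel = submodule_gen_incl[of "multilinear_relations K E d" K ?F, folded tensor_submodule_def, THEN subsetD]
  show "pure_tensor K E d x \<in> carrier (tensor_power K E d)" if "x \<in> tuples E d" for x
    using that by (rule pure_tensor_closed)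
  show "pure_tensor K E d (x(i := u \<oplus>\<^bsub>E\<^esub> v)) =
      pure_tensor K E d (x(i := u)) \<oplus>\<^bsub>tensor_power K E d\<^esub> pure_tensor K E d (x(i := v))"
    if "x \<in> tuples E d" "i \<in> {1..d}" "u \<in> carrier E" "v \<in> carrier E" for x i u v
  proof -
    have "?g (x(i := u \<oplus>\<^bsub>E\<^esub> v)) \<ominus>\<^bsub>?F\<^esub> (?g (x(i := u)) \<oplus>\<^bsub>?F\<^esub> ?g (x(i := v))) \<in> ?N"
      using that by (intro rel) (auto simp: multilinear_relations_def Let_def)
    moreover have "x(i := u) \<in> tuples E d" "x(i := v) \<in> tuples E d" "x(i := u \<oplus>\<^bsub>E\<^esub> v) \<in> tuples E d"
      using that by (auto intro: tuples_upd)
    ultimately show ?thesis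
      by (simp add: pure_tensor_def tensor_power_def coset_add[OF N] coset_eq_iff[OF N] gc)
  qed
  show "pure_tensor K E d (x(i := k \<odot>\<^bsub>E\<^esub> u)) = k \<odot>\<^bsub>tensor_power K E d\<^esub> pure_tensor K E d (x(i := u))"
    if "x \<in> tuples E d" "i \<in> {1..d}" "k \<in> carrier K" "u \<in> carrier E" for x i k u
  proof -
    have "?g (x(i := k \<odot>\<^bsub>E\<^esub> u)) \<ominus>\<^bsub>?F\<^esub> (k \<odot>\<^bsub>?F\<^esub> ?g (x(i := u))) \<in> ?N"
      using that by (intro rel) (auto simp: multilinear_relations_def Let_def)
    moreover have "x(i := u) \<in> tuples E d" "x(i := k \<odot>\<^bsub>E\<^esub> u) \<in> tuples E d"
      using that by (auto intro: tuples_upd)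
    ultimately show ?thesis
      using that(3) by (simp add: pure_tensor_def tensor_power_def coset_smult[OF N] coset_eq_iff[OF N] gc)
  qed
qed

section \<open>Permutations acting on the tensor power\<close>

context
  fixes \<sigma> assumes \<sigma>: "\<sigma> permutes {1..d}"
begin

lemma free_act_closed:
  assumes "z \<in> carrier (free_module K (tuples E d))"
  shows "(\<lambda>y. z (y \<circ> \<sigma>)) \<in> carrier (free_module K (tuples E d))"
proof -
  \<comment> \<open>The support of the permuted function lies in the preimage of the support of z
    under composition with \<sigma>. Surjectivity of \<sigma> makes that composition injective,
    hence the preimage finite.\<close>
  have "inj (\<lambda>y. y \<circ> \<sigma>)" using permutes_surj[OF \<sigma>] by (simp add: inj_on_def fun.inj_map_strong surj_def comp_def fun_eq_iff) metis
  then have "finite ((\<lambda>y. y \<circ> \<sigma>) -` {i \<in> tuples E d. z i \<noteq> \<zero>\<^bsub>K\<^esub>})"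
    using assms by (intro finite_vimageI) (simp_all add: free_module_def carrier_coprod_module)
  moreover have "{y \<in> tuples E d. z (y \<circ> \<sigma>) \<noteq> \<zero>\<^bsub>K\<^esub>} \<subseteq> (\<lambda>y. y \<circ> \<sigma>) -` {i \<in> tuples E d. z i \<noteq> \<zero>\<^bsub>K\<^esub>}"
    using tuples_comp_iff[OF \<sigma>] by auto
  ultimately have "finite {y \<in> tuples E d. z (y \<circ> \<sigma>) \<noteq> \<zero>\<^bsub>K\<^esub>}" using finite_subset by blast
  then show ?thesis
    using assms tuples_comp_iff[OF \<sigma>]
    by (auto simp: free_module_def carrier_coprod_module PiE_def extensional_def Pi_iff)
qed

lemma free_act_linear:
  "(\<lambda>z\<in>carrier (free_module K (tuples E d)). \<lambda>y. z (y \<circ> \<sigma>))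
    \<in> linear_maps K (free_module K (tuples E d)) (free_module K (tuples E d))"
  by (rule linear_maps_restrictI[OF FM free_act_closed])
    (auto simp: free_module_def coprod_module_def fun_eq_iff restrict_def tuples_comp_iff[OF \<sigma>, unfolded comp_def])

lemma free_act_gen:
  assumes "x \<in> tuples E d"
  shows "(\<lambda>y. free_gen K (tuples E d) x (y \<circ> \<sigma>)) = free_gen K (tuples E d) (x \<circ> inv' \<sigma>)"
proof
  fix y
  have "y \<circ> \<sigma> = x \<longleftrightarrow> y = x \<circ> inv' \<sigma>" using permutes_inv_o[OF \<sigma>] by (metis comp_assoc comp_id)
  then show "free_gen K (tuples E d) x (y \<circ> \<sigma>) = free_gen K (tuples E d) (x \<circ> inv' \<sigma>) y"
    by (simp add: free_gen_def restrict_def tuples_comp_iff[OF \<sigma>])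
qed

text \<open>The generators are permuted among themselves: the relation for the tuple x at slot i
  goes to the one for \<open>x \<circ> inv' \<sigma>\<close> at slot
  \<open>\<sigma> i\<close>.\<close>

lemma free_act_relations:
  assumes "z \<in> multilinear_relations K E d"
  shows "(\<lambda>y. z (y \<circ> \<sigma>)) \<in> multilinear_relations K E d"
proof -
  let ?F = "free_module K (tuples E d)" and ?g = "free_gen K (tuples E d)"
  define A where "A = (\<lambda>z\<in>carrier ?F. \<lambda>y. z (y \<circ> \<sigma>))"
  have A: "A \<in> linear_maps K ?F ?F" unfolding A_def by (rule free_act_linear)
  note gc = free_gen_closed[OF E.R.is_cring]
  have Ag: "A (?g (x(i := u))) = ?g ((x \<circ> inv' \<sigma>)(\<sigma> i := u))"
    if "x \<in> tuples E d" "i \<in> {1..d}" "u \<in> carrier E" for x i u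
    using gc[OF tuples_upd[OF that]] free_act_gen[OF tuples_upd[OF that]] upd_comp_inv[OF \<sigma>, of x i u]
    by (simp add: A_def)
  have x': "x \<circ> inv' \<sigma> \<in> tuples E d" if "x \<in> tuples E d" for x
    using that tuples_comp_iff[OF permutes_inv[OF \<sigma>]] by blast
  have i': "\<sigma> i \<in> {1..d}" if "i \<in> {1..d}" for i using that permutes_in_image[OF \<sigma>] by blast
  have Az: "A z = (\<lambda>y. z (y \<circ> \<sigma>))" using assms multilinear_relations_closed by (auto simp: A_def)
  have "A z \<in> multilinear_relations K E d"
    using assms unfolding multilinear_relations_def Let_def
  proof (elim UnE CollectE exE conjE)
    fix x i u v
    assume z: "z = ?g (x(i := u \<oplus>\<^bsub>E\<^esub> v)) \<ominus>\<^bsub>?F\<^esub> (?g (x(i := u)) \<oplus>\<^bsub>?F\<^esub> ?g (x(i := v)))"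
      and *: "x \<in> tuples E d" "i \<in> {1..d}" "u \<in> carrier E" "v \<in> carrier E"
    have "A z = ?g ((x \<circ> inv' \<sigma>)(\<sigma> i := u \<oplus>\<^bsub>E\<^esub> v)) \<ominus>\<^bsub>?F\<^esub> (?g ((x \<circ> inv' \<sigma>)(\<sigma> i := u)) \<oplus>\<^bsub>?F\<^esub> ?g ((x \<circ> inv' \<sigma>)(\<sigma> i := v)))"
      unfolding z using * by (simp add: linear_minus[OF FM FM A] linear_add[OF A] gc tuples_upd Ag)
    then show "A z \<in> {?g (x(i := u \<oplus>\<^bsub>E\<^esub> v)) \<ominus>\<^bsub>?F\<^esub> (?g (x(i := u)) \<oplus>\<^bsub>?F\<^esub> ?g (x(i := v))) | x i u v.
        x \<in> tuples E d \<and> i \<in> {1..d} \<and> u \<in> carrier E \<and> v \<in> carrier E} \<union>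
      {?g (x(i := k \<odot>\<^bsub>E\<^esub> u)) \<ominus>\<^bsub>?F\<^esub> (k \<odot>\<^bsub>?F\<^esub> ?g (x(i := u))) | x i k u.
        x \<in> tuples E d \<and> i \<in> {1..d} \<and> k \<in> carrier K \<and> u \<in> carrier E}"
      using x'[OF *(1)] i'[OF *(2)] *(3,4) by blast
  next
    fix x i k u
    assume z: "z = ?g (x(i := k \<odot>\<^bsub>E\<^esub> u)) \<ominus>\<^bsub>?F\<^esub> (k \<odot>\<^bsub>?F\<^esub> ?g (x(i := u)))"
      and *: "x \<in> tuples E d" "i \<in> {1..d}" "k \<in> carrier K" "u \<in> carrier E"
    have "A z = ?g ((x \<circ> inv' \<sigma>)(\<sigma> i := k \<odot>\<^bsub>E\<^esub> u)) \<ominus>\<^bsub>?F\<^esub> (k \<odot>\<^bsub>?F\<^esub> ?g ((x \<circ> inv' \<sigma>)(\<sigma> i := u)))"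
      unfolding z using * by (simp add: linear_minus[OF FM FM A] linear_smult[OF A] gc tuples_upd Ag)
    then show "A z \<in> {?g (x(i := u \<oplus>\<^bsub>E\<^esub> v)) \<ominus>\<^bsub>?F\<^esub> (?g (x(i := u)) \<oplus>\<^bsub>?F\<^esub> ?g (x(i := v))) | x i u v.
        x \<in> tuples E d \<and> i \<in> {1..d} \<and> u \<in> carrier E \<and> v \<in> carrier E} \<union>
      {?g (x(i := k \<odot>\<^bsub>E\<^esub> u)) \<ominus>\<^bsub>?F\<^esub> (k \<odot>\<^bsub>?F\<^esub> ?g (x(i := u))) | x i k u.
        x \<in> tuples E d \<and> i \<in> {1..d} \<and> k \<in> carrier K \<and> u \<in> carrier E}"
      using x'[OF *(1)] i'[OF *(2)] *(3,4) by blast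
  qed
  then show ?thesis by (simp add: Az)
qed

lemma free_act_submodule:
  assumes "z \<in> tensor_submodule K E d"
  shows "(\<lambda>y. z (y \<circ> \<sigma>)) \<in> tensor_submodule K E d"
proof -
  let ?F = "free_module K (tuples E d)"
  have "tensor_submodule K E d \<subseteq>
      {z \<in> carrier ?F. (\<lambda>z\<in>carrier ?F. \<lambda>y. z (y \<circ> \<sigma>)) z \<in> tensor_submodule K E d}"
    unfolding tensor_submodule_def
  proof (rule submodule_gen_least)
    show "submodule {z \<in> carrier ?F. (\<lambda>z\<in>carrier ?F. \<lambda>y. z (y \<circ> \<sigma>)) z \<in> submodule_gen K ?F (multilinear_relations K E d)} K ?F"
      by (rule submodule_vimage[OF FM FM free_act_linear tensor_submodule_submodule[unfolded tensor_submodule_def]])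
    show "multilinear_relations K E d \<subseteq> {z \<in> carrier ?F. (\<lambda>z\<in>carrier ?F. \<lambda>y. z (y \<circ> \<sigma>)) z \<in> submodule_gen K ?F (multilinear_relations K E d)}"
      using free_act_relations multilinear_relations_closed
        submodule_gen_incl[of "multilinear_relations K E d" K ?F] by auto
  qed
  with assms show ?thesis by auto
qed

end

text \<open>\<open>tensor_act\<close> takes the image of a set, so its value on a coset is a full
  coset only if the submodule of relations is mapped onto itself. Its stability under the inverse
  permutation provides the preimages.\<close>

lemma tensor_act_coset:
  assumes \<sigma>: "\<sigma> permutes {1..d}" and z: "z \<in> carrier (free_module K (tuples E d))"
  shows "tensor_act \<sigma> (tensor_submodule K E d +>\<^bsub>free_module K (tuples E d)\<^esub> z) =
    tensor_submodule K E d +>\<^bsub>free_module K (tuples E d)\<^esub> (\<lambda>y. z (y \<circ> \<sigma>))"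
proof -
  let ?F = "free_module K (tuples E d)" and ?N = "tensor_submodule K E d"
  let ?A = "\<lambda>z y. z (y \<circ> \<sigma>)"
  have Nc: "?N \<subseteq> carrier ?F" using F.submoduleE(1)[OF tensor_submodule_submodule] .
  have add: "?A (n \<oplus>\<^bsub>?F\<^esub> z) = ?A n \<oplus>\<^bsub>?F\<^esub> ?A z" if "n \<in> ?N" for n
    using linear_add[OF free_act_linear[OF \<sigma>], of n z] that Nc z F.M.a_closed by auto
  have surj: "\<exists>m\<in>?N. n = ?A m" if "n \<in> ?N" for n
    using free_act_submodule[OF permutes_inv[OF \<sigma>] that] by (force simp: comp_assoc permutes_inv_o[OF \<sigma>])
  have "tensor_act \<sigma> (?N +>\<^bsub>?F\<^esub> z) = (\<lambda>n. ?A (n \<oplus>\<^bsub>?F\<^esub> z)) ` ?N"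
    by (auto simp: tensor_act_def a_r_coset_def')
  also have "\<dots> = (\<lambda>n. ?A n \<oplus>\<^bsub>?F\<^esub> ?A z) ` ?N" by (rule image_cong[OF refl add])
  also have "\<dots> = (\<lambda>n. n \<oplus>\<^bsub>?F\<^esub> ?A z) ` ?A ` ?N" by (simp add: image_image)
  also have "?A ` ?N = ?N"
  proof (intro equalityI subsetI)
    show "n \<in> ?N" if "n \<in> ?A ` ?N" for n using that free_act_submodule[OF \<sigma>] by blast
    show "n \<in> ?A ` ?N" if "n \<in> ?N" for n using surj[OF that] by blast
  qed
  also have "(\<lambda>n. n \<oplus>\<^bsub>?F\<^esub> ?A z) ` ?N = ?N +>\<^bsub>?F\<^esub> ?A z" by (auto simp: a_r_coset_def')
  finally show ?thesis .
qed

lemma tensor_act_linear: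
  assumes \<sigma>: "\<sigma> permutes {1..d}"
  shows "(\<lambda>z\<in>carrier (tensor_power K E d). tensor_act \<sigma> z) \<in> linear_maps K (tensor_power K E d) (tensor_power K E d)"
proof -
  let ?F = "free_module K (tuples E d)" and ?N = "tensor_submodule K E d"
  let ?A = "\<lambda>z\<in>carrier ?F. \<lambda>y. z (y \<circ> \<sigma>)"
  note N = FM tensor_submodule_submodule
  note A = free_act_linear[OF \<sigma>]
  have act: "tensor_act \<sigma> (?N +>\<^bsub>?F\<^esub> z) = ?N +>\<^bsub>?F\<^esub> ?A z" if "z \<in> carrier ?F" for z
    using that tensor_act_coset[OF \<sigma> that] by simp
  have Ac: "?A z \<in> carrier ?F" if "z \<in> carrier ?F" for z using linear_closed[OF A that] .
  show ?thesis
  proof (rule linear_maps_restrictI[OF module_tensor_power])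
    show "tensor_act \<sigma> z \<in> carrier (tensor_power K E d)" if "z \<in> carrier (tensor_power K E d)" for z
      using that act Ac by (auto simp: tensor_power_def carrier_quot_module[OF N] simp del: restrict_apply)
    show "tensor_act \<sigma> (z \<oplus>\<^bsub>tensor_power K E d\<^esub> w) = tensor_act \<sigma> z \<oplus>\<^bsub>tensor_power K E d\<^esub> tensor_act \<sigma> w"
      if zw: "z \<in> carrier (tensor_power K E d)" "w \<in> carrier (tensor_power K E d)" for z w
    proof -
      obtain x y where x: "x \<in> carrier ?F" "z = ?N +>\<^bsub>?F\<^esub> x" and y: "y \<in> carrier ?F" "w = ?N +>\<^bsub>?F\<^esub> y"
        using zw by (auto simp: tensor_power_def carrier_quot_module[OF N])
      have "tensor_act \<sigma> (z \<oplus>\<^bsub>tensor_power K E d\<^esub> w) = ?N +>\<^bsub>?F\<^esub> ?A (x \<oplus>\<^bsub>?F\<^esub> y)"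
        using x y by (simp only: tensor_power_def coset_add[OF N] act F.M.a_closed)
      also have "\<dots> = tensor_act \<sigma> z \<oplus>\<^bsub>tensor_power K E d\<^esub> tensor_act \<sigma> w"
        using x y by (simp only: tensor_power_def linear_add[OF A] coset_add[OF N] act Ac)
      finally show ?thesis .
    qed
    show "tensor_act \<sigma> (k \<odot>\<^bsub>tensor_power K E d\<^esub> z) = k \<odot>\<^bsub>tensor_power K E d\<^esub> tensor_act \<sigma> z"
      if k: "k \<in> carrier K" and z: "z \<in> carrier (tensor_power K E d)" for k z
    proof -
      obtain x where x: "x \<in> carrier ?F" "z = ?N +>\<^bsub>?F\<^esub> x"
        using z by (auto simp: tensor_power_def carrier_quot_module[OF N])
      have "tensor_act \<sigma> (k \<odot>\<^bsub>tensor_power K E d\<^esub> z) = ?N +>\<^bsub>?F\<^esub> ?A (k \<odot>\<^bsub>?F\<^esub> x)"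
        using x k by (simp only: tensor_power_def coset_smult[OF N] act F.smult_closed)
      also have "\<dots> = k \<odot>\<^bsub>tensor_power K E d\<^esub> tensor_act \<sigma> z"
        using x k by (simp only: tensor_power_def linear_smult[OF A] coset_smult[OF N] act Ac)
      finally show ?thesis .
    qed
  qed
qed

lemma tensor_act_pure:
  assumes \<sigma>: "\<sigma> permutes {1..d}" and x: "x \<in> tuples E d"
  shows "tensor_act \<sigma> (pure_tensor K E d x) = pure_tensor K E d (x \<circ> inv' \<sigma>)"
proof -
  have "x \<circ> inv' \<sigma> \<in> tuples E d" using x tuples_comp_iff[OF permutes_inv[OF \<sigma>]] by blast
  then show ?thesis
    using x tensor_act_coset[OF \<sigma> free_gen_closed[OF E.R.is_cring x]] free_act_gen[OF \<sigma> x]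
    by (simp add: pure_tensor_def)
qed

end

section \<open>Character sequences\<close>

lemma inv_sym_group:
  assumes "\<sigma> permutes {1..n}"
  shows "inv\<^bsub>sym_group n\<^esub> \<sigma> = inv' \<sigma>"
  by (rule group.inv_equality[OF sym_group_is_group])
    (use assms permutes_inv[OF assms] in \<open>auto simp: sym_group_def permutes_inv_o\<close>)

locale character_sequence =
  fixes K :: "('k, 'r) ring_scheme" (structure) and W :: "nat \<Rightarrow> (nat \<Rightarrow> nat) set"
    and \<chi> :: "nat \<Rightarrow> (nat \<Rightarrow> nat) \<Rightarrow> 'k"
  assumes cring_K: "cring K" and omega_inv: "omega_invariant K W \<chi>"
begin

sublocale K: cring K by (rule cring_K)

lemma W_subgroup: "subgroup (W d) (sym_group d)"
  and chi_hom: "\<chi> d \<in> hom ((sym_group d)\<lparr>carrier := W d\<rparr>) (units_of K)"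
  and W_Suc: "\<sigma> \<in> W d \<Longrightarrow> \<sigma> \<in> W (Suc d)"
  and W_shift_Suc: "\<sigma> \<in> W d \<Longrightarrow> \<omega> \<sigma> \<in> W (Suc d)"
  and chi_Suc: "\<sigma> \<in> W d \<Longrightarrow> \<chi> (Suc d) \<sigma> = \<chi> d \<sigma>"
  and chi_shift_Suc: "\<sigma> \<in> W d \<Longrightarrow> \<chi> (Suc d) (\<omega> \<sigma>) = \<chi> d \<sigma>"
  using omega_inv unfolding omega_invariant_def by blast+

lemma W_permutes: "\<sigma> \<in> W d \<Longrightarrow> \<sigma> permutes {1..d}"
  using subgroup.subset[OF W_subgroup] by (auto simp: sym_group_def)

lemma W_id: "id \<in> W d"
  using subgroup.one_closed[OF W_subgroup, of d] by (simp add: sym_group_def)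

lemma W_comp: "\<sigma> \<in> W d \<Longrightarrow> \<tau> \<in> W d \<Longrightarrow> \<sigma> \<circ> \<tau> \<in> W d"
  using subgroup.m_closed[OF W_subgroup, of \<sigma> d \<tau>] by (simp add: sym_group_def)

lemma W_inv: "\<sigma> \<in> W d \<Longrightarrow> inv' \<sigma> \<in> W d"
  using subgroup.m_inv_closed[OF W_subgroup, of \<sigma> d] inv_sym_group[OF W_permutes] by simp

lemma finite_W: "finite (W d)"
  using finite_permutations[of "{1..d}"] W_permutes by (auto elim!: finite_subset[rotated])

lemma chi_Units: "\<sigma> \<in> W d \<Longrightarrow> \<chi> d \<sigma> \<in> Units K"
  using chi_hom[of d] by (auto simp: hom_def units_of_def)

lemma chi_closed: "\<sigma> \<in> W d \<Longrightarrow> \<chi> d \<sigma> \<in> carrier K"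
  using chi_Units K.Units_closed by blast

lemma chi_comp: "\<sigma> \<in> W d \<Longrightarrow> \<tau> \<in> W d \<Longrightarrow> \<chi> d (\<sigma> \<circ> \<tau>) = \<chi> d \<sigma> \<otimes> \<chi> d \<tau>"
  using chi_hom[of d] by (simp add: hom_def units_of_def sym_group_def)

lemma chi_id: "\<chi> d id = \<one>"
proof -
  have "\<chi> d id \<otimes> \<chi> d id = \<chi> d id \<otimes> \<one>"
    using chi_comp[OF W_id W_id, of d] chi_closed[OF W_id, of d] by simp
  then show ?thesis using K.Units_l_cancel[OF chi_Units[OF W_id]] chi_closed[OF W_id] K.one_closed by blast
qed

lemma W_le: "d \<le> e \<Longrightarrow> \<sigma> \<in> W d \<Longrightarrow> \<sigma> \<in> W e"
  by (induction e rule: dec_induct) (auto intro: W_Suc)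

lemma chi_le: "d \<le> e \<Longrightarrow> \<sigma> \<in> W d \<Longrightarrow> \<chi> e \<sigma> = \<chi> d \<sigma>"
  by (induction e rule: dec_induct) (auto simp: chi_Suc W_le)

lemma W_shift: "\<sigma> \<in> W d \<Longrightarrow> (\<omega> ^^ k) \<sigma> \<in> W (k + d)"
  by (induction k) (auto intro: W_shift_Suc)

lemma chi_shift: "\<sigma> \<in> W d \<Longrightarrow> \<chi> (k + d) ((\<omega> ^^ k) \<sigma>) = \<chi> d \<sigma>"
  by (induction k) (auto simp: chi_shift_Suc W_shift)

lemma chi_inv: "\<sigma> \<in> W d \<Longrightarrow> \<chi> d (inv' \<sigma>) = inv \<chi> d \<sigma>"
proof -
  assume s: "\<sigma> \<in> W d"
  have "\<chi> d (inv' \<sigma>) \<otimes> \<chi> d \<sigma> = \<one>"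
    using chi_comp[OF W_inv[OF s] s] chi_id permutes_inv_o[OF W_permutes[OF s]] by simp
  then show ?thesis using K.comm_inv_char[of "\<chi> d \<sigma>" "\<chi> d (inv' \<sigma>)"] chi_closed[OF s] chi_closed[OF W_inv[OF s]]
    by (simp add: K.m_comm)
qed

lemma shift_group_kernel: "shift_group (\<Union>d. W d) {\<sigma>. \<exists>d. \<sigma> \<in> W d \<and> \<chi> d \<sigma> = \<one>}"
proof
  \<comment> \<open>Any two elements lie in the group of the larger degree, with unchanged values;
    there the laws of a single homomorphism \<open>\<chi> e\<close> apply.\<close>
  have common: "\<exists>e. \<sigma> \<in> W e \<and> \<tau> \<in> W e \<and> \<chi> e \<sigma> = \<chi> c \<sigma> \<and> \<chi> e \<tau> = \<chi> d \<tau>"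
    if "\<sigma> \<in> W c" "\<tau> \<in> W d" for \<sigma> \<tau> c d
    using that W_le[of c "max c d"] W_le[of d "max c d"] chi_le[of c "max c d"] chi_le[of d "max c d"]
    by (intro exI[of _ "max c d"]) auto
  show "\<exists>d. \<sigma> permutes {1..d}" if "\<sigma> \<in> (\<Union>d. W d)" for \<sigma> using that W_permutes by blast
  show "\<omega> \<sigma> \<in> (\<Union>d. W d)" if "\<sigma> \<in> (\<Union>d. W d)" for \<sigma> using that W_shift_Suc by blast
  show "{\<sigma>. \<exists>d. \<sigma> \<in> W d \<and> \<chi> d \<sigma> = \<one>} \<subseteq> (\<Union>d. W d)" by blast
  show "id \<in> {\<sigma>. \<exists>d. \<sigma> \<in> W d \<and> \<chi> d \<sigma> = \<one>}" using W_id chi_id by blast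
  show "\<omega> \<sigma> \<in> {\<sigma>. \<exists>d. \<sigma> \<in> W d \<and> \<chi> d \<sigma> = \<one>}" if "\<sigma> \<in> {\<sigma>. \<exists>d. \<sigma> \<in> W d \<and> \<chi> d \<sigma> = \<one>}" for \<sigma>
    using that W_shift_Suc chi_shift_Suc by fastforce
  show "\<sigma> \<circ> \<tau> \<in> {\<sigma>. \<exists>d. \<sigma> \<in> W d \<and> \<chi> d \<sigma> = \<one>}"
    if \<sigma>: "\<sigma> \<in> {\<sigma>. \<exists>d. \<sigma> \<in> W d \<and> \<chi> d \<sigma> = \<one>}" and \<tau>: "\<tau> \<in> {\<sigma>. \<exists>d. \<sigma> \<in> W d \<and> \<chi> d \<sigma> = \<one>}" for \<sigma> \<tau>
  proof -
    obtain e where "\<sigma> \<in> W e" "\<tau> \<in> W e" "\<chi> e \<sigma> = \<one>" "\<chi> e \<tau> = \<one>" using \<sigma> \<tau> common by fastforce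
    then show ?thesis using W_comp[of \<sigma> e \<tau>] chi_comp[of \<sigma> e \<tau>] by auto
  qed
  show "g \<circ> \<sigma> \<circ> inv' g \<in> {\<sigma>. \<exists>d. \<sigma> \<in> W d \<and> \<chi> d \<sigma> = \<one>}"
    if g: "g \<in> (\<Union>d. W d)" and \<sigma>: "\<sigma> \<in> {\<sigma>. \<exists>d. \<sigma> \<in> W d \<and> \<chi> d \<sigma> = \<one>}" for g \<sigma>
  proof -
    obtain e where e: "\<sigma> \<in> W e" "g \<in> W e" "\<chi> e \<sigma> = \<one>" using \<sigma> g common by fastforce
    then have "\<chi> e (g \<circ> \<sigma> \<circ> inv' g) = \<one>"
      using chi_Units by (simp add: chi_comp W_comp W_inv chi_inv chi_closed)
    then show ?thesis using W_comp W_inv e by blast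
  qed
  show "g \<circ> h \<circ> inv' g \<circ> inv' h \<in> {\<sigma>. \<exists>d. \<sigma> \<in> W d \<and> \<chi> d \<sigma> = \<one>}"
    if g: "g \<in> (\<Union>d. W d)" and h: "h \<in> (\<Union>d. W d)" for g h
  proof -
    obtain e where e: "g \<in> W e" "h \<in> W e" using g h common by fastforce
    then have u: "\<chi> e g \<in> Units K" "\<chi> e h \<in> Units K" using chi_Units by auto
    have "\<chi> e (g \<circ> h \<circ> inv' g \<circ> inv' h) = (\<chi> e g \<otimes> \<chi> e h) \<otimes> inv (\<chi> e g) \<otimes> inv (\<chi> e h)"
      using e by (simp add: chi_comp W_comp W_inv chi_inv)
    also have "\<dots> = (\<chi> e g \<otimes> inv (\<chi> e g)) \<otimes> (\<chi> e h \<otimes> inv (\<chi> e h))"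
      using u by (simp add: K.m_ac K.Units_closed del: K.Units_r_inv K.Units_l_inv)
    also have "\<dots> = \<one>" using u by simp
    finally show ?thesis using W_comp W_inv e by blast
  qed
qed

lemma chi_square: 
  assumes "\<sigma> \<in> W d"
  shows "\<chi> d \<sigma> \<otimes> \<chi> d \<sigma> = \<one>"
proof -
  obtain j k e where e: "doubled k ((\<omega> ^^ j) \<sigma>) \<in> W e" "\<chi> e (doubled k ((\<omega> ^^ j) \<sigma>)) = \<one>"
    using shift_group.ex_doubled_in_N[OF shift_group_kernel, of \<sigma>] assms by blast
  \<comment> \<open>The degree \<open>?m\<close> is at least e, j + d and k + j + d, so the doubled
    element and its two factors can be evaluated by one homomorphism.\<close>
  let ?\<tau> = "(\<omega> ^^ j) \<sigma>" and ?m = "e + k + j + d"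
  have \<tau>: "?\<tau> \<in> W (j + d)" "\<chi> (j + d) ?\<tau> = \<chi> d \<sigma>" using assms by (rule W_shift, rule chi_shift)
  have \<tau>': "(\<omega> ^^ k) ?\<tau> \<in> W (k + (j + d))" "\<chi> (k + (j + d)) ((\<omega> ^^ k) ?\<tau>) = \<chi> d \<sigma>"
    using W_shift[OF \<tau>(1)] chi_shift[OF \<tau>(1)] \<tau>(2) by auto
  have "\<one> = \<chi> ?m (doubled k ?\<tau>)" using chi_le[OF _ e(1), of ?m] e(2) by simp
  also have "\<dots> = \<chi> ?m ?\<tau> \<otimes> \<chi> ?m ((\<omega> ^^ k) ?\<tau>)"
    unfolding doubled_def by (intro chi_comp W_le[OF _ \<tau>(1)] W_le[OF _ \<tau>'(1)]) auto
  also have "\<dots> = \<chi> d \<sigma> \<otimes> \<chi> d \<sigma>"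
    using chi_le[OF _ \<tau>(1), of ?m] chi_le[OF _ \<tau>'(1), of ?m] \<tau>(2) \<tau>'(2) by simp
  finally show ?thesis by simp
qed

lemma chi_inv_eq: "\<sigma> \<in> W d \<Longrightarrow> inv \<chi> d \<sigma> = \<chi> d \<sigma>"
  using chi_square K.comm_inv_char[of "\<chi> d \<sigma>" "\<chi> d \<sigma>"] chi_closed[of \<sigma> d] by simp

section \<open>Semi-symmetric powers\<close>

text \<open>These are the maps on tuples that factor through the \<chi>-power. The relations
  identify \<sigma> z with the inverse of \<chi> \<sigma> times z; as the values are self-inverse,
  \<chi> \<sigma> itself is used.\<close>

definition chi_multilinear :: "('k, 'e, 'm) module_scheme \<Rightarrow> nat \<Rightarrow> ('k, 'a, 'n) module_scheme
    \<Rightarrow> ((nat \<Rightarrow> 'e) \<Rightarrow> 'a) \<Rightarrow> bool"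
  where "chi_multilinear E d N h \<longleftrightarrow> multilinear_map K E d N h \<and>
    (\<forall>\<sigma>\<in>W d. \<forall>x\<in>tuples E d. h (x \<circ> inv' \<sigma>) = \<chi> d \<sigma> \<odot>\<^bsub>N\<^esub> h x)"

lemma chi_multilinearD:
  "chi_multilinear E d N h \<Longrightarrow> multilinear_map K E d N h"
  "chi_multilinear E d N h \<Longrightarrow> \<sigma> \<in> W d \<Longrightarrow> x \<in> tuples E d \<Longrightarrow> h (x \<circ> inv' \<sigma>) = \<chi> d \<sigma> \<odot>\<^bsub>N\<^esub> h x"
  by (simp_all add: chi_multilinear_def)

text \<open>The decomposable vector inside its homogeneous power, before inclusion into the direct
  sum; universal properties are proved degree by degree with this version.\<close>

definition chi_vec :: "('k, 'e, 'm) module_scheme \<Rightarrow> nat \<Rightarrow> (nat \<Rightarrow> 'e) \<Rightarrow> ((nat \<Rightarrow> 'e) \<Rightarrow> 'k) set set"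
  where "chi_vec E d x = chi_submodule K W \<chi> E d +>\<^bsub>tensor_power K E d\<^esub> pure_tensor K E d x"

definition chi_relations :: "('k, 'e, 'm) module_scheme \<Rightarrow> nat \<Rightarrow> ((nat \<Rightarrow> 'e) \<Rightarrow> 'k) set set"
  where "chi_relations E d = {(\<chi> d \<sigma> \<odot>\<^bsub>tensor_power K E d\<^esub> z) \<ominus>\<^bsub>tensor_power K E d\<^esub> tensor_act \<sigma> z | \<sigma> z.
    \<sigma> \<in> W d \<and> z \<in> carrier (tensor_power K E d)}"

lemma chi_submodule_eq: "chi_submodule K W \<chi> E d = submodule_gen K (tensor_power K E d) (chi_relations E d)"
proof -
  have "{((inv (\<chi> d \<sigma>)) \<odot>\<^bsub>T\<^esub> z) \<ominus>\<^bsub>T\<^esub> tensor_act \<sigma> z | \<sigma> z. \<sigma> \<in> W d \<and> z \<in> carrier T} =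
    {(\<chi> d \<sigma> \<odot>\<^bsub>T\<^esub> z) \<ominus>\<^bsub>T\<^esub> tensor_act \<sigma> z | \<sigma> z. \<sigma> \<in> W d \<and> z \<in> carrier T}"
    for T :: "('k, ((nat \<Rightarrow> 'a) \<Rightarrow> 'k) set) module"
    by (intro Collect_cong ex_cong1) (auto simp: chi_inv_eq)
  then show ?thesis by (simp add: chi_submodule_def chi_relations_def Let_def)
qed

lemma chi_dec_eq: "chi_dec K W \<chi> E d x = chi_incl K W \<chi> E d (chi_vec E d x)"
  by (simp add: chi_dec_def chi_vec_def)

lemma chi_dec_cong: "(\<And>i. i \<in> {1..d} \<Longrightarrow> x i = y i) \<Longrightarrow> chi_dec K W \<chi> E d x = chi_dec K W \<chi> E d y"
proof -
  assume "\<And>i. i \<in> {1..d} \<Longrightarrow> x i = y i"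
  then have "restrict x {1..d} = restrict y {1..d}" by (rule restrict_ext)
  then show ?thesis by (simp add: chi_dec_eq chi_vec_def pure_tensor_def)
qed

lemma chi_dec_restrict: "chi_dec K W \<chi> E d (restrict x {1..d}) = chi_dec K W \<chi> E d x"
  by (rule chi_dec_cong) simp

lemma chi_incl_eq_coprod_incl: "chi_incl K W \<chi> E d = coprod_incl UNIV (chi_power K W \<chi> E) d"
  by (auto simp: chi_incl_def coprod_incl_def fun_eq_iff)

lemma chi_algebra_simps [simp]:
  "carrier (chi_algebra K W \<chi> E) = carrier (chi_sum K W \<chi> E)"
  "add (chi_algebra K W \<chi> E) = add (chi_sum K W \<chi> E)"
  "zero (chi_algebra K W \<chi> E) = zero (chi_sum K W \<chi> E)"
  "smult (chi_algebra K W \<chi> E) = smult (chi_sum K W \<chi> E)"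
  "monoid.mult (chi_algebra K W \<chi> E) = chi_mult K W \<chi> E"
  by (simp_all add: chi_algebra_def)

lemma finsum_chi_algebra: "finsum (chi_algebra K W \<chi> E) = finsum (chi_sum K W \<chi> E)"
  by (simp add: fun_eq_iff finsum_def finprod_def)

lemma linear_maps_chi_algebra:
  "linear_maps K (chi_algebra K W \<chi> E) N = linear_maps K (chi_sum K W \<chi> E) N"
  "linear_maps K M (chi_algebra K W \<chi> E) = linear_maps K M (chi_sum K W \<chi> E)"
  by (rule linear_maps_cong; simp)+

context
  fixes E :: "('k, 'e, 'm) module_scheme"
  assumes E: "module K E"
begin

interpretation E: module K E by (rule E)

lemma chi_relations_closed: "chi_relations E d \<subseteq> carrier (tensor_power K E d)"
proof -
  interpret T: module K "tensor_power K E d" by (rule module_tensor_power[OF E])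
  have "tensor_act \<sigma> z \<in> carrier (tensor_power K E d)"
    if "\<sigma> \<in> W d" "z \<in> carrier (tensor_power K E d)" for \<sigma> z
    using linear_closed[OF tensor_act_linear[OF E W_permutes[OF that(1)]] that(2)] that by simp
  then show ?thesis
    by (auto simp: chi_relations_def intro!: T.M.minus_closed T.smult_closed chi_closed)
qed

lemma chi_submodule_submodule: "submodule (chi_submodule K W \<chi> E d) K (tensor_power K E d)"
  unfolding chi_submodule_eq by (rule submodule_gen_submodule[OF module_tensor_power[OF E] chi_relations_closed])

lemma module_chi_power: "module K (chi_power K W \<chi> E d)"
  unfolding chi_power_def by (rule module_quot_module[OF module_tensor_power[OF E] chi_submodule_submodule])

lemma chi_power_proj_linear:
  "(\<lambda>z\<in>carrier (tensor_power K E d). chi_submodule K W \<chi> E d +>\<^bsub>tensor_power K E d\<^esub> z)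
    \<in> linear_maps K (tensor_power K E d) (chi_power K W \<chi> E d)"
  unfolding chi_power_def by (rule quot_proj_linear[OF module_tensor_power[OF E] chi_submodule_submodule])

lemma chi_vec_multilinear: "chi_multilinear E d (chi_power K W \<chi> E d) (chi_vec E d)"
proof -
  let ?T = "tensor_power K E d" and ?P = "chi_power K W \<chi> E d"
  define p where "p = (\<lambda>z\<in>carrier ?T. chi_submodule K W \<chi> E d +>\<^bsub>?T\<^esub> z)"
  have p: "p \<in> linear_maps K ?T ?P" unfolding p_def by (rule chi_power_proj_linear)
  have pc: "pure_tensor K E d x \<in> carrier ?T" if "x \<in> tuples E d" for x
    using that by (rule pure_tensor_closed[OF E])
  have v: "chi_vec E d x = p (pure_tensor K E d x)" if "x \<in> tuples E d" for x
    using pc[OF that] by (simp add: chi_vec_def p_def)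
  note m = pure_tensor_multilinear[OF E, of d]
  interpret T: module K ?T by (rule module_tensor_power[OF E])
  have "multilinear_map K E d ?P (chi_vec E d)" by (rule multilinear_map_comp[OF E m p v])
  moreover have "chi_vec E d (x \<circ> inv' \<sigma>) = \<chi> d \<sigma> \<odot>\<^bsub>?P\<^esub> chi_vec E d x"
    if \<sigma>: "\<sigma> \<in> W d" and x: "x \<in> tuples E d" for \<sigma> x
  proof -
    let ?t = "pure_tensor K E d"
    have x': "x \<circ> inv' \<sigma> \<in> tuples E d" using x tuples_comp_iff[OF W_permutes[OF W_inv[OF \<sigma>]]] by blast
    have "(\<chi> d \<sigma> \<odot>\<^bsub>?T\<^esub> ?t x) \<ominus>\<^bsub>?T\<^esub> tensor_act \<sigma> (?t x) \<in> chi_relations E d"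
      using \<sigma> pc[OF x] by (auto simp: chi_relations_def)
    then have "(\<chi> d \<sigma> \<odot>\<^bsub>?T\<^esub> ?t x) \<ominus>\<^bsub>?T\<^esub> ?t (x \<circ> inv' \<sigma>) \<in> chi_submodule K W \<chi> E d"
      unfolding chi_submodule_eq tensor_act_pure[OF E W_permutes[OF \<sigma>] x]
      using submodule_gen_incl[of "chi_relations E d" K ?T] by blast
    then have "p (\<chi> d \<sigma> \<odot>\<^bsub>?T\<^esub> ?t x) = p (?t (x \<circ> inv' \<sigma>))"
      using coset_eq_iff[OF module_tensor_power[OF E] chi_submodule_submodule,
          where x = "\<chi> d \<sigma> \<odot>\<^bsub>?T\<^esub> ?t x" and y = "?t (x \<circ> inv' \<sigma>)"]
        pc[OF x] pc[OF x'] chi_closed[OF \<sigma>] by (simp add: p_def)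
    then show ?thesis using v[OF x] v[OF x'] linear_smult[OF p chi_closed[OF \<sigma>] pc[OF x]] by simp
  qed
  ultimately show ?thesis by (simp add: chi_multilinear_def)
qed

lemma chi_power_lift:
  assumes L: "module K L" and h: "chi_multilinear E d L h"
  shows "\<exists>H\<in>linear_maps K (chi_power K W \<chi> E d) L. \<forall>x\<in>tuples E d. H (chi_vec E d x) = h x"
proof -
  let ?T = "tensor_power K E d"
  interpret L: module K L by (rule L)
  interpret T: module K ?T by (rule module_tensor_power[OF E])
  obtain H0 where H0: "H0 \<in> linear_maps K ?T L" and H0p: "\<And>x. x \<in> tuples E d \<Longrightarrow> H0 (pure_tensor K E d x) = h x"
    using tensor_lift[OF E L chi_multilinearD(1)[OF h]] by blast
  \<comment> \<open>The hypothesis on h gives this rule on pure tensors, while the relations range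
    over all tensors; both sides are linear in z, so the rule extends.\<close>
  have act: "H0 (tensor_act \<sigma> z) = \<chi> d \<sigma> \<odot>\<^bsub>L\<^esub> H0 z" "tensor_act \<sigma> z \<in> carrier ?T"
    if \<sigma>: "\<sigma> \<in> W d" and z: "z \<in> carrier ?T" for \<sigma> z
  proof -
    define A where "A = (\<lambda>z\<in>carrier ?T. tensor_act \<sigma> z)"
    have A: "A \<in> linear_maps K ?T ?T" unfolding A_def by (rule tensor_act_linear[OF E W_permutes[OF \<sigma>]])
    have Az: "A z = tensor_act \<sigma> z" if "z \<in> carrier ?T" for z using that by (simp add: A_def)
    note c = chi_closed[OF \<sigma>]
    have "H0 (A z) = \<chi> d \<sigma> \<odot>\<^bsub>L\<^esub> H0 z" using z
    proof (rule tensor_induct[OF E])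
      show "H0 (A (pure_tensor K E d x)) = \<chi> d \<sigma> \<odot>\<^bsub>L\<^esub> H0 (pure_tensor K E d x)" if x: "x \<in> tuples E d" for x
      proof -
        have "x \<circ> inv' \<sigma> \<in> tuples E d" using x tuples_comp_iff[OF W_permutes[OF W_inv[OF \<sigma>]]] by blast
        then show ?thesis
          using x Az[OF pure_tensor_closed[OF E x]] tensor_act_pure[OF E W_permutes[OF \<sigma>] x]
            chi_multilinearD(2)[OF h \<sigma> x] by (simp add: H0p)
      qed
    qed (use c linear_closed[OF A] linear_closed[OF H0] in \<open>simp_all add: linear_zero[OF module_tensor_power[OF E] module_tensor_power[OF E] A]
        linear_zero[OF module_tensor_power[OF E] L H0] linear_add[OF A] linear_add[OF H0] linear_smult[OF A]
        linear_smult[OF H0] L.smult_r_distr L.smult_assoc1[symmetric] K.m_comm\<close>)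
    then show "H0 (tensor_act \<sigma> z) = \<chi> d \<sigma> \<odot>\<^bsub>L\<^esub> H0 z" using Az[OF z] by simp
    show "tensor_act \<sigma> z \<in> carrier ?T" using linear_closed[OF A z] Az[OF z] by simp
  qed
  have rel: "H0 s = \<zero>\<^bsub>L\<^esub>" if "s \<in> chi_relations E d" for s
    using that
    by (auto simp: chi_relations_def linear_minus[OF module_tensor_power[OF E] L H0] linear_smult[OF H0]
        act chi_closed linear_closed[OF H0] minus_eq_zero_iff[OF L.M.abelian_group_axioms])
  have "\<exists>H\<in>linear_maps K (chi_power K W \<chi> E d) L.
      \<forall>z\<in>carrier ?T. H (chi_submodule K W \<chi> E d +>\<^bsub>?T\<^esub> z) = H0 z"
    unfolding chi_power_def
  proof (rule quot_lift[OF module_tensor_power[OF E] chi_submodule_submodule L H0])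
    show "H0 z = \<zero>\<^bsub>L\<^esub>" if "z \<in> chi_submodule K W \<chi> E d" for z
      using linear_vanishes_on_submodule_gen[OF module_tensor_power[OF E] L H0 chi_relations_closed rel] that
      by (simp add: chi_submodule_eq)
  qed
  then obtain H where H: "H \<in> linear_maps K (chi_power K W \<chi> E d) L"
    "\<And>z. z \<in> carrier ?T \<Longrightarrow> H (chi_submodule K W \<chi> E d +>\<^bsub>?T\<^esub> z) = H0 z" by blast
  then have "H (chi_vec E d x) = h x" if "x \<in> tuples E d" for x
    using pure_tensor_closed[OF E that] H0p[OF that] by (simp add: chi_vec_def)
  with H(1) show ?thesis by blast
qed

lemma chi_power_induct:
  assumes c: "c \<in> carrier (chi_power K W \<chi> E d)"
    and gen: "\<And>x. x \<in> tuples E d \<Longrightarrow> P (chi_vec E d x)"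
    and zero: "P \<zero>\<^bsub>chi_power K W \<chi> E d\<^esub>"
    and add: "\<And>f g. f \<in> carrier (chi_power K W \<chi> E d) \<Longrightarrow> g \<in> carrier (chi_power K W \<chi> E d) \<Longrightarrow>
      P f \<Longrightarrow> P g \<Longrightarrow> P (f \<oplus>\<^bsub>chi_power K W \<chi> E d\<^esub> g)"
    and smult: "\<And>k f. k \<in> carrier K \<Longrightarrow> f \<in> carrier (chi_power K W \<chi> E d) \<Longrightarrow>
      P f \<Longrightarrow> P (k \<odot>\<^bsub>chi_power K W \<chi> E d\<^esub> f)"
  shows "P c"
proof -
  let ?T = "tensor_power K E d" and ?P = "chi_power K W \<chi> E d"
  define p where "p = (\<lambda>z\<in>carrier ?T. chi_submodule K W \<chi> E d +>\<^bsub>?T\<^esub> z)"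
  have p: "p \<in> linear_maps K ?T ?P" unfolding p_def by (rule chi_power_proj_linear)
  obtain z where z: "z \<in> carrier ?T" "c = p z"
    using c by (auto simp: p_def chi_power_def
        carrier_quot_module[OF module_tensor_power[OF E] chi_submodule_submodule])
  have "P (p z)" using z(1)
  proof (rule tensor_induct[OF E])
    show "P (p (pure_tensor K E d x))" if "x \<in> tuples E d" for x
      using gen[OF that] pure_tensor_closed[OF E that] by (simp add: p_def chi_vec_def)
    show "P (p \<zero>\<^bsub>?T\<^esub>)" using zero linear_zero[OF module_tensor_power[OF E] module_chi_power p] by simp
    show "P (p (f \<oplus>\<^bsub>?T\<^esub> g))" if "f \<in> carrier ?T" "g \<in> carrier ?T" "P (p f)" "P (p g)" for f g
      using add[OF linear_closed[OF p that(1)] linear_closed[OF p that(2)] that(3,4)] linear_add[OF p that(1,2)] by simp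
    show "P (p (k \<odot>\<^bsub>?T\<^esub> f))" if "k \<in> carrier K" "f \<in> carrier ?T" "P (p f)" for k f
      using smult[OF that(1) linear_closed[OF p that(2)] that(3)] linear_smult[OF p that(1,2)] by simp
  qed
  then show ?thesis using z by simp
qed

lemma module_chi_sum: "module K (chi_sum K W \<chi> E)"
  unfolding chi_sum_def by (rule module_coprod_module[OF cring_K module_chi_power])

lemma chi_incl_linear:
  "restrict (chi_incl K W \<chi> E d) (carrier (chi_power K W \<chi> E d))
    \<in> linear_maps K (chi_power K W \<chi> E d) (chi_sum K W \<chi> E)"
  unfolding chi_sum_def chi_incl_eq_coprod_incl by (rule coprod_incl_linear[OF cring_K module_chi_power]) simp

lemma chi_incl_closed: "c \<in> carrier (chi_power K W \<chi> E d) \<Longrightarrow> chi_incl K W \<chi> E d c \<in> carrier (chi_sum K W \<chi> E)"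
  using linear_closed[OF chi_incl_linear] by simp

lemma chi_dec_multilinear: "chi_multilinear E d (chi_sum K W \<chi> E) (chi_dec K W \<chi> E d)"
proof -
  note m = chi_multilinearD(1)[OF chi_vec_multilinear, of d]
  let ?P = "chi_power K W \<chi> E d" and ?S = "chi_sum K W \<chi> E"
  define i where "i = restrict (chi_incl K W \<chi> E d) (carrier ?P)"
  have i: "i \<in> linear_maps K ?P ?S" unfolding i_def by (rule chi_incl_linear)
  have vc: "chi_vec E d x \<in> carrier ?P" if "x \<in> tuples E d" for x using multilinear_map_closed[OF m that] .
  have dec: "chi_dec K W \<chi> E d x = i (chi_vec E d x)" if "x \<in> tuples E d" for x
    using vc[OF that] by (simp add: i_def chi_dec_eq)
  have "multilinear_map K E d ?S (chi_dec K W \<chi> E d)" by (rule multilinear_map_comp[OF E m i dec])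
  moreover have "chi_dec K W \<chi> E d (x \<circ> inv' \<sigma>) = \<chi> d \<sigma> \<odot>\<^bsub>?S\<^esub> chi_dec K W \<chi> E d x"
    if \<sigma>: "\<sigma> \<in> W d" and x: "x \<in> tuples E d" for \<sigma> x
  proof -
    have x': "x \<circ> inv' \<sigma> \<in> tuples E d" using x tuples_comp_iff[OF W_permutes[OF W_inv[OF \<sigma>]]] by blast
    show ?thesis
      using dec[OF x] dec[OF x'] chi_multilinearD(2)[OF chi_vec_multilinear \<sigma> x]
        linear_smult[OF i chi_closed[OF \<sigma>] vc[OF x]] by simp
  qed
  ultimately show ?thesis by (simp add: chi_multilinear_def)
qed

lemma chi_dec_closed: 
  assumes "x \<in> {1..d} \<rightarrow> carrier E"
  shows "chi_dec K W \<chi> E d x \<in> carrier (chi_sum K W \<chi> E)"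
proof -
  have "restrict x {1..d} \<in> tuples E d" using assms by (auto simp: tuples_def)
  from multilinear_map_closed[OF chi_multilinearD(1)[OF chi_dec_multilinear] this]
  show ?thesis unfolding chi_dec_restrict .
qed

text \<open>Universal property of the direct sum: a linear map on it amounts to one
  \<chi>-multilinear map in each degree. The uniqueness half is
  \<open>chi_linear_eqI\<close>.\<close>

lemma chi_sum_lift:
  assumes L: "module K L" and h: "\<And>d. chi_multilinear E d L (h d)"
  shows "\<exists>H\<in>linear_maps K (chi_sum K W \<chi> E) L. \<forall>d. \<forall>x\<in>tuples E d. H (chi_dec K W \<chi> E d x) = h d x"
proof -
  have "\<exists>H. \<forall>d. H d \<in> linear_maps K (chi_power K W \<chi> E d) L \<and> (\<forall>x\<in>tuples E d. H d (chi_vec E d x) = h d x)"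
    using chi_power_lift[OF L h] by (intro choice) blast
  then obtain G where G: "\<And>d. G d \<in> linear_maps K (chi_power K W \<chi> E d) L"
    and Gv: "\<And>d x. x \<in> tuples E d \<Longrightarrow> G d (chi_vec E d x) = h d x" by blast
  obtain H where H: "H \<in> linear_maps K (chi_sum K W \<chi> E) L"
    and Hi: "\<And>d c. c \<in> carrier (chi_power K W \<chi> E d) \<Longrightarrow> H (chi_incl K W \<chi> E d c) = G d c"
    unfolding chi_sum_def chi_incl_eq_coprod_incl
    using coprod_lift[where I = UNIV and h = G, OF cring_K module_chi_power L G] by blast
  have "H (chi_dec K W \<chi> E d x) = h d x" if "x \<in> tuples E d" for d x
    using Hi[OF multilinear_map_closed[OF chi_multilinearD(1)[OF chi_vec_multilinear] that]] Gv[OF that]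
    by (simp add: chi_dec_eq)
  with H show ?thesis by blast
qed

lemma chi_sum_induct:
  assumes c: "c \<in> carrier (chi_sum K W \<chi> E)"
    and gen: "\<And>d x. x \<in> tuples E d \<Longrightarrow> P (chi_dec K W \<chi> E d x)"
    and zero: "P \<zero>\<^bsub>chi_sum K W \<chi> E\<^esub>"
    and add: "\<And>f g. f \<in> carrier (chi_sum K W \<chi> E) \<Longrightarrow> g \<in> carrier (chi_sum K W \<chi> E) \<Longrightarrow>
      P f \<Longrightarrow> P g \<Longrightarrow> P (f \<oplus>\<^bsub>chi_sum K W \<chi> E\<^esub> g)"
    and smult: "\<And>k f. k \<in> carrier K \<Longrightarrow> f \<in> carrier (chi_sum K W \<chi> E) \<Longrightarrow>
      P f \<Longrightarrow> P (k \<odot>\<^bsub>chi_sum K W \<chi> E\<^esub> f)"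
  shows "P c"
proof (rule coprod_induct[where I = UNIV and M = "chi_power K W \<chi> E" and P = P and f = c, OF cring_K module_chi_power,
      folded chi_sum_def chi_incl_eq_coprod_incl])
  fix d b assume b: "b \<in> carrier (chi_power K W \<chi> E d)"
  define i where "i = restrict (chi_incl K W \<chi> E d) (carrier (chi_power K W \<chi> E d))"
  have i: "i \<in> linear_maps K (chi_power K W \<chi> E d) (chi_sum K W \<chi> E)"
    unfolding i_def by (rule chi_incl_linear)
  have "P (i b)" using b
  proof (rule chi_power_induct)
    show "P (i (chi_vec E d x))" if "x \<in> tuples E d" for x
      using gen[OF that] multilinear_map_closed[OF chi_multilinearD(1)[OF chi_vec_multilinear] that]
      by (simp add: i_def chi_dec_eq)
    show "P (i \<zero>\<^bsub>chi_power K W \<chi> E d\<^esub>)" using zero linear_zero[OF module_chi_power module_chi_sum i] by simp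
    show "P (i (f \<oplus>\<^bsub>chi_power K W \<chi> E d\<^esub> g))"
      if "f \<in> carrier (chi_power K W \<chi> E d)" "g \<in> carrier (chi_power K W \<chi> E d)" "P (i f)" "P (i g)" for f g
      using add[OF linear_closed[OF i that(1)] linear_closed[OF i that(2)] that(3,4)] linear_add[OF i that(1,2)] by simp
    show "P (i (k \<odot>\<^bsub>chi_power K W \<chi> E d\<^esub> f))"
      if "k \<in> carrier K" "f \<in> carrier (chi_power K W \<chi> E d)" "P (i f)" for k f
      using smult[OF that(1) linear_closed[OF i that(2)] that(3)] linear_smult[OF i that(1,2)] by simp
  qed
  then show "P (chi_incl K W \<chi> E d b)" using b by (simp add: i_def)
qed (use c zero add in auto)

lemma chi_linear_eqI:
  assumes N: "module K N" and f: "f \<in> linear_maps K (chi_sum K W \<chi> E) N" and g: "g \<in> linear_maps K (chi_sum K W \<chi> E) N"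
    and eq: "\<And>d x. x \<in> tuples E d \<Longrightarrow> f (chi_dec K W \<chi> E d x) = g (chi_dec K W \<chi> E d x)"
  shows "f = g"
proof (rule linear_eqI[OF f g])
  show "f c = g c" if "c \<in> carrier (chi_sum K W \<chi> E)" for c using that
  proof (rule chi_sum_induct)
  qed (simp_all add: eq linear_zero[OF module_chi_sum N f] linear_zero[OF module_chi_sum N g]
      linear_add[OF f] linear_add[OF g] linear_smult[OF f] linear_smult[OF g])
qed

end

lemma chi_bilinear_eqI:
  assumes "module K E" "module K F" "module K N"
    and f: "f \<in> linear_maps K (chi_sum K W \<chi> E) (hom_module K (chi_sum K W \<chi> F) N)"
    and g: "g \<in> linear_maps K (chi_sum K W \<chi> E) (hom_module K (chi_sum K W \<chi> F) N)"
    and eq: "\<And>d x e y. x \<in> tuples E d \<Longrightarrow> y \<in> tuples F e \<Longrightarrow>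
      f (chi_dec K W \<chi> E d x) (chi_dec K W \<chi> F e y) = g (chi_dec K W \<chi> E d x) (chi_dec K W \<chi> F e y)"
  shows "f = g"
proof (rule chi_linear_eqI[OF assms(1) module_hom_module[OF module_chi_sum[OF assms(2)] assms(3)] f g])
  fix d x assume x: "x \<in> tuples E d"
  have "chi_dec K W \<chi> E d x \<in> carrier (chi_sum K W \<chi> E)"
    using x by (intro chi_dec_closed[OF assms(1)]) (auto simp: tuples_def)
  from linear_closed[OF f this] linear_closed[OF g this]
  show "f (chi_dec K W \<chi> E d x) = g (chi_dec K W \<chi> E d x)"
    by (intro chi_linear_eqI[OF assms(2,3)]) (auto simp: eq x)
qed

text \<open>The universal property is used twice. For a fixed tuple x the values extend linearly in
  the second variable; the resulting family of homomorphisms is itself \<chi>-multilinear in x and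
  extends in the first variable.\<close>

lemma chi_bilinear_lift:
  assumes E: "module K E" and F: "module K F" and N: "module K N"
    and right: "\<And>d x e. x \<in> tuples E d \<Longrightarrow> chi_multilinear F e N (h d x e)"
    and left: "\<And>d e y. y \<in> tuples F e \<Longrightarrow> chi_multilinear E d N (\<lambda>x. h d x e y)"
  shows "\<exists>\<beta>\<in>linear_maps K (chi_sum K W \<chi> E) (hom_module K (chi_sum K W \<chi> F) N).
    \<forall>d e. \<forall>x\<in>tuples E d. \<forall>y\<in>tuples F e. \<beta> (chi_dec K W \<chi> E d x) (chi_dec K W \<chi> F e y) = h d x e y"
proof -
  let ?S = "chi_sum K W \<chi> F"
  interpret E: module K E by (rule E)
  \<comment> \<open>The choice is harmless: values on decomposables determine the map, so identities
    between such maps, in particular the multilinearity of L, can be tested there.\<close>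
  define L where "L d x = (SOME f. f \<in> linear_maps K ?S N \<and>
      (\<forall>e. \<forall>y\<in>tuples F e. f (chi_dec K W \<chi> F e y) = h d x e y))" for d x
  have "L d x \<in> linear_maps K ?S N \<and> (\<forall>e. \<forall>y\<in>tuples F e. L d x (chi_dec K W \<chi> F e y) = h d x e y)"
    if "x \<in> tuples E d" for d x
  proof -
    have "\<exists>f. f \<in> linear_maps K ?S N \<and> (\<forall>e. \<forall>y\<in>tuples F e. f (chi_dec K W \<chi> F e y) = h d x e y)"
      using chi_sum_lift[OF F N right[OF that]] by blast
    from someI_ex[OF this] show ?thesis unfolding L_def .
  qed
  then have L: "\<And>d x. x \<in> tuples E d \<Longrightarrow> L d x \<in> linear_maps K ?S N"
    and Lh: "\<And>d x e y. x \<in> tuples E d \<Longrightarrow> y \<in> tuples F e \<Longrightarrow> L d x (chi_dec K W \<chi> F e y) = h d x e y"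
    by blast+
  let ?H = "hom_module K ?S N"
  have H: "module K ?H" by (rule module_hom_module[OF module_chi_sum[OF F] N])
  interpret H: module K ?H by (rule H)
  have dc: "chi_dec K W \<chi> F e y \<in> carrier ?S" if "y \<in> tuples F e" for e y
    using that by (intro chi_dec_closed[OF F]) (auto simp: tuples_def)
  have "chi_multilinear E d ?H (L d)" for d
    unfolding chi_multilinear_def
  proof (intro conjI ballI multilinear_mapI)
    show "L d x \<in> carrier ?H" if "x \<in> tuples E d" for x using L[OF that] by simp
    show "L d (x(i := u \<oplus>\<^bsub>E\<^esub> v)) = L d (x(i := u)) \<oplus>\<^bsub>?H\<^esub> L d (x(i := v))"
      if "x \<in> tuples E d" "i \<in> {1..d}" "u \<in> carrier E" "v \<in> carrier E" for x i u v
    proof -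
      have t: "x(i := u) \<in> tuples E d" "x(i := v) \<in> tuples E d" "x(i := u \<oplus>\<^bsub>E\<^esub> v) \<in> tuples E d"
        using that by (auto intro: tuples_upd)
      show ?thesis
      proof (rule chi_linear_eqI[OF F N L[OF t(3)]])
        show "L d (x(i := u)) \<oplus>\<^bsub>?H\<^esub> L d (x(i := v)) \<in> linear_maps K ?S N"
          using H.M.a_closed L[OF t(1)] L[OF t(2)] by simp
        show "L d (x(i := u \<oplus>\<^bsub>E\<^esub> v)) (chi_dec K W \<chi> F e y) = (L d (x(i := u)) \<oplus>\<^bsub>?H\<^esub> L d (x(i := v))) (chi_dec K W \<chi> F e y)"
          if y: "y \<in> tuples F e" for e y
          using multilinear_map_add[OF chi_multilinearD(1)[OF left[OF y]] \<open>x \<in> tuples E d\<close> \<open>i \<in> {1..d}\<close> \<open>u \<in> carrier E\<close> \<open>v \<in> carrier E\<close>]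
          by (simp add: hom_module_apply dc y Lh t)
      qed
    qed
    show "L d (x(i := k \<odot>\<^bsub>E\<^esub> u)) = k \<odot>\<^bsub>?H\<^esub> L d (x(i := u))"
      if "x \<in> tuples E d" "i \<in> {1..d}" "k \<in> carrier K" "u \<in> carrier E" for x i k u
    proof -
      have t: "x(i := u) \<in> tuples E d" "x(i := k \<odot>\<^bsub>E\<^esub> u) \<in> tuples E d"
        using that by (auto intro: tuples_upd)
      show ?thesis
      proof (rule chi_linear_eqI[OF F N L[OF t(2)]])
        show "k \<odot>\<^bsub>?H\<^esub> L d (x(i := u)) \<in> linear_maps K ?S N"
          using H.smult_closed[OF that(3)] L[OF t(1)] by simp
        show "L d (x(i := k \<odot>\<^bsub>E\<^esub> u)) (chi_dec K W \<chi> F e y) = (k \<odot>\<^bsub>?H\<^esub> L d (x(i := u))) (chi_dec K W \<chi> F e y)"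
          if y: "y \<in> tuples F e" for e y
          using multilinear_map_smult[OF chi_multilinearD(1)[OF left[OF y]] \<open>x \<in> tuples E d\<close> \<open>i \<in> {1..d}\<close> \<open>k \<in> carrier K\<close> \<open>u \<in> carrier E\<close>]
          by (simp add: hom_module_apply dc y Lh t)
      qed
    qed
    show "L d (x \<circ> inv' \<sigma>) = \<chi> d \<sigma> \<odot>\<^bsub>?H\<^esub> L d x" if \<sigma>: "\<sigma> \<in> W d" and x: "x \<in> tuples E d" for \<sigma> x
    proof -
      have x': "x \<circ> inv' \<sigma> \<in> tuples E d" using x tuples_comp_iff[OF W_permutes[OF W_inv[OF \<sigma>]]] by blast
      show ?thesis
      proof (rule chi_linear_eqI[OF F N L[OF x']])
        show "\<chi> d \<sigma> \<odot>\<^bsub>?H\<^esub> L d x \<in> linear_maps K ?S N"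
          using H.smult_closed[OF chi_closed[OF \<sigma>]] L[OF x] by simp
        show "L d (x \<circ> inv' \<sigma>) (chi_dec K W \<chi> F e y) = (\<chi> d \<sigma> \<odot>\<^bsub>?H\<^esub> L d x) (chi_dec K W \<chi> F e y)"
          if y: "y \<in> tuples F e" for e y
          using chi_multilinearD(2)[OF left[OF y] \<sigma> x] by (simp add: hom_module_apply dc y Lh x x')
      qed
    qed
  qed
  then obtain \<beta> where \<beta>: "\<beta> \<in> linear_maps K (chi_sum K W \<chi> E) ?H"
    and \<beta>d: "\<And>d x. x \<in> tuples E d \<Longrightarrow> \<beta> (chi_dec K W \<chi> E d x) = L d x"
    using chi_sum_lift[OF E H, of L] by blast
  then show ?thesis by (intro bexI[of _ \<beta>]) (simp_all add: Lh)
qed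

end

section \<open>Concatenation of tuples\<close>

definition append_tuple :: "nat \<Rightarrow> (nat \<Rightarrow> 'e) \<Rightarrow> (nat \<Rightarrow> 'e) \<Rightarrow> nat \<Rightarrow> 'e"
  where "append_tuple d x y = (\<lambda>t. if t \<le> d then x t else y (t - d))"

lemma append_tuple_closed: "x \<in> tuples E d \<Longrightarrow> y \<in> tuples E e \<Longrightarrow> append_tuple d x y \<in> tuples E (d + e)"
proof -
  assume x: "x \<in> tuples E d" and y: "y \<in> tuples E e"
  have "append_tuple d x y t \<in> carrier E" if "t \<in> {1..d + e}" for t
  proof (cases "t \<le> d")
    case True
    then show ?thesis using that x by (auto simp: append_tuple_def tuples_def)
  next
    case False
    then have "t - d \<in> {1..e}" using that by auto
    then show ?thesis using False y by (auto simp: append_tuple_def tuples_def)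
  qed
  moreover have "append_tuple d x y t = undefined" if "t \<notin> {1..d + e}" for t
  proof (cases "t \<le> d")
    case True
    then have "t \<notin> {1..d}" using that by auto
    then show ?thesis using True x by (auto simp: append_tuple_def tuples_def PiE_def extensional_def)
  next
    case False
    then have "t - d \<notin> {1..e}" using that by auto
    then show ?thesis using False y by (auto simp: append_tuple_def tuples_def PiE_def extensional_def)
  qed
  ultimately show ?thesis by (auto simp: tuples_def PiE_def extensional_def)
qed

lemma append_tuple_upd_left: "i \<in> {1..d} \<Longrightarrow> append_tuple d (x(i := u)) y = (append_tuple d x y)(i := u)"
  by (auto simp: append_tuple_def fun_eq_iff)

lemma append_tuple_upd_right:
  "i \<in> {1..e} \<Longrightarrow> append_tuple d x (y(i := u)) = (append_tuple d x y)(d + i := u)"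
  by (auto simp: append_tuple_def fun_eq_iff)

lemma append_tuple_comp_left:
  assumes "\<sigma> permutes {1..d}"
  shows "append_tuple d (x \<circ> \<sigma>) y = append_tuple d x y \<circ> \<sigma>"
proof
  fix t
  show "append_tuple d (x \<circ> \<sigma>) y t = (append_tuple d x y \<circ> \<sigma>) t"
    using permutes_in_image[OF assms, of t] permutes_not_in[OF assms, of t]
    by (cases "t \<in> {1..d}") (auto simp: append_tuple_def)
qed

text \<open>Through this identity, invariance of \<chi> under \<omega> makes the product compatible
  with the relations of the right factor, just as invariance under the inclusions does for the left
  one.\<close>

lemma append_tuple_comp_right:
  assumes "\<sigma> permutes {1..e}"
  shows "append_tuple d x (y \<circ> \<sigma>) = append_tuple d x y \<circ> (\<omega> ^^ d) \<sigma>"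
proof
  fix t
  show "append_tuple d x (y \<circ> \<sigma>) t = (append_tuple d x y \<circ> (\<omega> ^^ d) \<sigma>) t"
    using permutes_interval_0[OF assms] permutes_interval_pos[OF assms, of "t - d"]
    by (auto simp: append_tuple_def omega_funpow)
qed

lemma inv_omega_funpow:
  assumes "\<sigma> permutes {1..e}"
  shows "inv' ((\<omega> ^^ d) \<sigma>) = (\<omega> ^^ d) (inv' \<sigma>)"
proof (rule inv_unique_comp)
  have "(\<omega> ^^ d) id = id" by (auto simp: omega_funpow)
  then show "(\<omega> ^^ d) \<sigma> \<circ> (\<omega> ^^ d) (inv' \<sigma>) = id" "(\<omega> ^^ d) (inv' \<sigma>) \<circ> (\<omega> ^^ d) \<sigma> = id"
    using omega_funpow_comp[OF assms permutes_inv[OF assms]] omega_funpow_comp[OF permutes_inv[OF assms] assms]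
      permutes_inv_o[OF assms] by metis+
qed

section \<open>Finite products that are linear in one factor\<close>

context cring
begin

lemma finprod_split:
  assumes "finite A" "i \<in> A" "g \<in> A \<rightarrow> carrier R"
  shows "finprod R g A = g i \<otimes> finprod R g (A - {i})"
proof -
  have "finprod R g (insert i (A - {i})) = g i \<otimes> finprod R g (A - {i})"
    using assms by (intro finprod_insert) auto
  then show ?thesis using assms(2) by (simp add: insert_absorb)
qed

text \<open>The three families agree off i, so the rest of the product is a common factor and
  distributivity does the work at i.\<close>

lemma finprod_add_at:
  assumes "finite A" "i \<in> A" "g' \<in> A \<rightarrow> carrier R" "g'' \<in> A \<rightarrow> carrier R" "g i = g' i \<oplus> g'' i"
    and "\<And>t. t \<in> A \<Longrightarrow> t \<noteq> i \<Longrightarrow> g t = g' t" "\<And>t. t \<in> A \<Longrightarrow> t \<noteq> i \<Longrightarrow> g t = g'' t"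
  shows "finprod R g A = finprod R g' A \<oplus> finprod R g'' A"
proof -
  have g: "g \<in> A \<rightarrow> carrier R"
  proof
    show "g t \<in> carrier R" if "t \<in> A" for t using that assms(3-6) by (cases "t = i") auto
  qed
  have "finprod R g (A - {i}) = finprod R g' (A - {i})"
    by (rule finprod_cong') (use assms(3,6) in auto)
  moreover have "finprod R g (A - {i}) = finprod R g'' (A - {i})"
    by (rule finprod_cong') (use assms(4,7) in auto)
  moreover have "finprod R g (A - {i}) \<in> carrier R" by (rule finprod_closed) (use g in auto)
  moreover have "g' i \<in> carrier R" "g'' i \<in> carrier R" using assms by auto
  ultimately show ?thesis
    using finprod_split[OF assms(1,2) g] finprod_split[OF assms(1,2,3)] finprod_split[OF assms(1,2,4)]
    by (simp add: assms(5) l_distr)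
qed

lemma finprod_smult_at:
  assumes "finite A" "i \<in> A" "g' \<in> A \<rightarrow> carrier R" "k \<in> carrier R" "g i = k \<otimes> g' i"
    and "\<And>t. t \<in> A \<Longrightarrow> t \<noteq> i \<Longrightarrow> g t = g' t"
  shows "finprod R g A = k \<otimes> finprod R g' A"
proof -
  have g: "g \<in> A \<rightarrow> carrier R"
  proof
    show "g t \<in> carrier R" if "t \<in> A" for t using that assms(3-6) by (cases "t = i") auto
  qed
  have "finprod R g (A - {i}) = finprod R g' (A - {i})"
    by (rule finprod_cong') (use assms(3,6) in auto)
  moreover have "finprod R g (A - {i}) \<in> carrier R" by (rule finprod_closed) (use g in auto)
  moreover have "g' i \<in> carrier R" using assms by auto
  ultimately show ?thesis
    using finprod_split[OF assms(1,2) g] finprod_split[OF assms(1,2,3)]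
    by (simp add: assms(4,5) m_assoc)
qed

end

section \<open>The product of the graded algebra\<close>

context character_sequence
begin

lemma chi_mult_ex1:
  assumes E: "module K E"
  shows "\<exists>!\<mu>. \<mu> \<in> bilinear_maps K (chi_sum K W \<chi> E) (chi_sum K W \<chi> E) (chi_sum K W \<chi> E) \<and>
      (\<forall>d e. \<forall>x \<in> {1..d} \<rightarrow> carrier E. \<forall>y \<in> {1..e} \<rightarrow> carrier E.
        \<mu> (chi_dec K W \<chi> E d x) (chi_dec K W \<chi> E e y) =
          chi_dec K W \<chi> E (d + e) (\<lambda>t. if t \<le> d then x t else y (t - d)))"
proof (rule ex_ex1I)
  let ?S = "chi_sum K W \<chi> E"
  note S = module_chi_sum[OF E]
  note bil = bilinear_maps_eq[OF S S S]
  \<comment> \<open>Decomposables depend on the entries 1, ..., d + e alone. This bridges tuples,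
    which are undefined outside their range, and the arbitrary functions that occur in the
    definition of the product.\<close>
  have res: "chi_dec K W \<chi> E (d + e) (append_tuple d (restrict x {1..d}) (restrict y {1..e})) =
      chi_dec K W \<chi> E (d + e) (\<lambda>t. if t \<le> d then x t else y (t - d))" for d e x y
    by (rule chi_dec_cong) (auto simp: append_tuple_def)
  note m = chi_multilinearD(1)[OF chi_dec_multilinear[OF E]] and alt = chi_multilinearD(2)[OF chi_dec_multilinear[OF E]]
  have "\<exists>\<mu>\<in>linear_maps K ?S (hom_module K ?S ?S). \<forall>d e. \<forall>x\<in>tuples E d. \<forall>y\<in>tuples E e.
      \<mu> (chi_dec K W \<chi> E d x) (chi_dec K W \<chi> E e y) = chi_dec K W \<chi> E (d + e) (append_tuple d x y)"
  proof (rule chi_bilinear_lift[OF E E S])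
    fix d e x assume x: "x \<in> tuples E d"
    show "chi_multilinear E e ?S (\<lambda>y. chi_dec K W \<chi> E (d + e) (append_tuple d x y))"
      unfolding chi_multilinear_def
    proof (intro conjI ballI multilinear_mapI)
      show "chi_dec K W \<chi> E (d + e) (append_tuple d x y) \<in> carrier ?S" if "y \<in> tuples E e" for y
        using multilinear_map_closed[OF m append_tuple_closed[OF x that]] .
      show "chi_dec K W \<chi> E (d + e) (append_tuple d x (y(i := u \<oplus>\<^bsub>E\<^esub> v))) =
          chi_dec K W \<chi> E (d + e) (append_tuple d x (y(i := u))) \<oplus>\<^bsub>?S\<^esub> chi_dec K W \<chi> E (d + e) (append_tuple d x (y(i := v)))"
        if "y \<in> tuples E e" "i \<in> {1..e}" "u \<in> carrier E" "v \<in> carrier E" for y i u v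
        unfolding append_tuple_upd_right[OF that(2)]
        by (rule multilinear_map_add[OF m append_tuple_closed[OF x that(1)] _ that(3,4)]) (use that(2) in auto)
      show "chi_dec K W \<chi> E (d + e) (append_tuple d x (y(i := k \<odot>\<^bsub>E\<^esub> u))) =
          k \<odot>\<^bsub>?S\<^esub> chi_dec K W \<chi> E (d + e) (append_tuple d x (y(i := u)))"
        if "y \<in> tuples E e" "i \<in> {1..e}" "k \<in> carrier K" "u \<in> carrier E" for y i k u
        unfolding append_tuple_upd_right[OF that(2)]
        by (rule multilinear_map_smult[OF m append_tuple_closed[OF x that(1)] _ that(3,4)]) (use that(2) in auto)
      show "chi_dec K W \<chi> E (d + e) (append_tuple d x (y \<circ> inv' \<sigma>)) =
          \<chi> e \<sigma> \<odot>\<^bsub>?S\<^esub> chi_dec K W \<chi> E (d + e) (append_tuple d x y)"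
        if \<sigma>: "\<sigma> \<in> W e" and y: "y \<in> tuples E e" for \<sigma> y
        using alt[OF W_shift[OF \<sigma>] append_tuple_closed[OF x y]]
        by (simp add: append_tuple_comp_right[OF permutes_inv[OF W_permutes[OF \<sigma>]]]
            inv_omega_funpow[OF W_permutes[OF \<sigma>]] chi_shift[OF \<sigma>])
    qed
  next
    fix d e y assume y: "y \<in> tuples E e"
    show "chi_multilinear E d ?S (\<lambda>x. chi_dec K W \<chi> E (d + e) (append_tuple d x y))"
      unfolding chi_multilinear_def
    proof (intro conjI ballI multilinear_mapI)
      show "chi_dec K W \<chi> E (d + e) (append_tuple d x y) \<in> carrier ?S" if "x \<in> tuples E d" for x
        using multilinear_map_closed[OF m append_tuple_closed[OF that y]] .
      show "chi_dec K W \<chi> E (d + e) (append_tuple d (x(i := u \<oplus>\<^bsub>E\<^esub> v)) y) =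
          chi_dec K W \<chi> E (d + e) (append_tuple d (x(i := u)) y) \<oplus>\<^bsub>?S\<^esub> chi_dec K W \<chi> E (d + e) (append_tuple d (x(i := v)) y)"
        if "x \<in> tuples E d" "i \<in> {1..d}" "u \<in> carrier E" "v \<in> carrier E" for x i u v
        unfolding append_tuple_upd_left[OF that(2)]
        by (rule multilinear_map_add[OF m append_tuple_closed[OF that(1) y] _ that(3,4)]) (use that(2) in auto)
      show "chi_dec K W \<chi> E (d + e) (append_tuple d (x(i := k \<odot>\<^bsub>E\<^esub> u)) y) =
          k \<odot>\<^bsub>?S\<^esub> chi_dec K W \<chi> E (d + e) (append_tuple d (x(i := u)) y)"
        if "x \<in> tuples E d" "i \<in> {1..d}" "k \<in> carrier K" "u \<in> carrier E" for x i k u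
        unfolding append_tuple_upd_left[OF that(2)]
        by (rule multilinear_map_smult[OF m append_tuple_closed[OF that(1) y] _ that(3,4)]) (use that(2) in auto)
      show "chi_dec K W \<chi> E (d + e) (append_tuple d (x \<circ> inv' \<sigma>) y) =
          \<chi> d \<sigma> \<odot>\<^bsub>?S\<^esub> chi_dec K W \<chi> E (d + e) (append_tuple d x y)"
        if \<sigma>: "\<sigma> \<in> W d" and x: "x \<in> tuples E d" for \<sigma> x
        using alt[OF W_le[OF _ \<sigma>] append_tuple_closed[OF x y]] chi_le[OF _ \<sigma>, of "d + e"]
        by (simp add: append_tuple_comp_left[OF permutes_inv[OF W_permutes[OF \<sigma>]]])
    qed
  qed
  then obtain \<mu> where \<mu>: "\<mu> \<in> linear_maps K ?S (hom_module K ?S ?S)"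
    and \<mu>d: "\<And>d e x y. x \<in> tuples E d \<Longrightarrow> y \<in> tuples E e \<Longrightarrow>
      \<mu> (chi_dec K W \<chi> E d x) (chi_dec K W \<chi> E e y) = chi_dec K W \<chi> E (d + e) (append_tuple d x y)"
    by blast
  have "\<mu> (chi_dec K W \<chi> E d x) (chi_dec K W \<chi> E e y) =
          chi_dec K W \<chi> E (d + e) (\<lambda>t. if t \<le> d then x t else y (t - d))"
    if "x \<in> {1..d} \<rightarrow> carrier E" "y \<in> {1..e} \<rightarrow> carrier E" for d e x y
  proof -
    have "restrict x {1..d} \<in> tuples E d" "restrict y {1..e} \<in> tuples E e" using that by (auto simp: tuples_def)
    from \<mu>d[OF this] show ?thesis unfolding chi_dec_restrict res .
  qed
  with \<mu> show "\<exists>\<mu>. \<mu> \<in> bilinear_maps K ?S ?S ?S \<and>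
      (\<forall>d e. \<forall>x \<in> {1..d} \<rightarrow> carrier E. \<forall>y \<in> {1..e} \<rightarrow> carrier E.
        \<mu> (chi_dec K W \<chi> E d x) (chi_dec K W \<chi> E e y) =
          chi_dec K W \<chi> E (d + e) (\<lambda>t. if t \<le> d then x t else y (t - d)))"
    unfolding bil by blast
  fix \<mu> \<nu>
  assume 1: "\<mu> \<in> bilinear_maps K ?S ?S ?S \<and> (\<forall>d e. \<forall>x \<in> {1..d} \<rightarrow> carrier E. \<forall>y \<in> {1..e} \<rightarrow> carrier E.
        \<mu> (chi_dec K W \<chi> E d x) (chi_dec K W \<chi> E e y) =
          chi_dec K W \<chi> E (d + e) (\<lambda>t. if t \<le> d then x t else y (t - d)))"
    and 2: "\<nu> \<in> bilinear_maps K ?S ?S ?S \<and> (\<forall>d e. \<forall>x \<in> {1..d} \<rightarrow> carrier E. \<forall>y \<in> {1..e} \<rightarrow> carrier E.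
        \<nu> (chi_dec K W \<chi> E d x) (chi_dec K W \<chi> E e y) =
          chi_dec K W \<chi> E (d + e) (\<lambda>t. if t \<le> d then x t else y (t - d)))"
  have t: "x \<in> {1..d} \<rightarrow> carrier E" if "x \<in> tuples E d" for x d using that by (auto simp: tuples_def)
  show "\<mu> = \<nu>"
    by (rule chi_bilinear_eqI[OF E E S]) (use 1 2 t in \<open>simp_all add: bil\<close>)
qed

lemma chi_mult_linear:
  assumes "module K E"
  shows "chi_mult K W \<chi> E \<in> linear_maps K (chi_sum K W \<chi> E) (hom_module K (chi_sum K W \<chi> E) (chi_sum K W \<chi> E))"
  using theI'[OF chi_mult_ex1[OF assms]] bilinear_maps_eq[OF module_chi_sum module_chi_sum module_chi_sum, OF assms assms assms]
  unfolding chi_mult_def Let_def by blast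

lemma chi_mult_dec:
  assumes "module K E" "x \<in> {1..d} \<rightarrow> carrier E" "y \<in> {1..e} \<rightarrow> carrier E"
  shows "chi_mult K W \<chi> E (chi_dec K W \<chi> E d x) (chi_dec K W \<chi> E e y) =
    chi_dec K W \<chi> E (d + e) (\<lambda>t. if t \<le> d then x t else y (t - d))"
  using theI'[OF chi_mult_ex1[OF assms(1)]] assms(2,3)
  unfolding chi_mult_def Let_def by blast

section \<open>The pairing\<close>

text \<open>The defining sum of \<open>chi_form\<close> with t = \<sigma> s substituted in each
  product. No inverse is left, and permuting the vectors or the forms becomes a translation of the
  summation index.\<close>

definition pairing :: "nat \<Rightarrow> (nat \<Rightarrow> 'e) \<Rightarrow> (nat \<Rightarrow> 'e \<Rightarrow> 'k) \<Rightarrow> 'k"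
  where "pairing d x f = (\<Oplus>\<sigma>\<in>W d. \<chi> d \<sigma> \<otimes> (\<Otimes>s\<in>{1..d}. f (\<sigma> s) (x s)))"

context
  fixes E :: "('k, 'e, 'm) module_scheme"
  assumes E: "module K E"
begin

interpretation E: module K E by (rule E)

lemma module_dual: "module K (dual_module K E)"
  unfolding dual_module_eq_hom_module by (rule module_hom_module[OF E module_self_module[OF cring_K]])

lemma dual_apply_closed: "u \<in> carrier (dual_module K E) \<Longrightarrow> z \<in> carrier E \<Longrightarrow> u z \<in> carrier K"
  using linear_closed[of u K E "self_module K"] by (simp add: dual_module_eq_hom_module)

lemma pairing_factor_closed:
  assumes "x \<in> {1..d} \<rightarrow> carrier E" "f \<in> {1..d} \<rightarrow> carrier (dual_module K E)" "\<sigma> permutes {1..d}"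
  shows "(\<lambda>s. f (\<sigma> s) (x s)) \<in> {1..d} \<rightarrow> carrier K"
proof
  fix s assume s: "s \<in> {1..d}"
  then have "\<sigma> s \<in> {1..d}" using permutes_in_image[OF assms(3)] by blast
  then show "f (\<sigma> s) (x s) \<in> carrier K" using s assms(1,2) by (intro dual_apply_closed) blast+
qed

lemma pairing_term_closed:
  assumes "x \<in> {1..d} \<rightarrow> carrier E" "f \<in> {1..d} \<rightarrow> carrier (dual_module K E)" "\<sigma> \<in> W d"
  shows "\<chi> d \<sigma> \<otimes> (\<Otimes>s\<in>{1..d}. f (\<sigma> s) (x s)) \<in> carrier K"
  using K.finprod_closed[OF pairing_factor_closed[OF assms(1,2) W_permutes[OF assms(3)]]] chi_closed[OF assms(3)]
  by simp

lemma pairing_closed: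
  assumes "x \<in> {1..d} \<rightarrow> carrier E" "f \<in> {1..d} \<rightarrow> carrier (dual_module K E)"
  shows "pairing d x f \<in> carrier K"
  unfolding pairing_def using pairing_term_closed[OF assms] by (intro K.finsum_closed) auto

lemma finprod_permute:
  assumes "\<tau> permutes {1..d}" "g \<in> {1..d} \<rightarrow> carrier K"
  shows "(\<Otimes>t\<in>{1..d}. g t) = (\<Otimes>s\<in>{1..d}. g (\<tau> s))"
  using K.finprod_reindex[of g \<tau> "{1..d}"] assms permutes_image[OF assms(1)]
    inj_on_subset[OF permutes_inj[OF assms(1)], of "{1..d}"] by simp

lemma pairing_eq:
  assumes x: "x \<in> {1..d} \<rightarrow> carrier E" and f: "f \<in> {1..d} \<rightarrow> carrier (dual_module K E)"
  shows "pairing d x f = (\<Oplus>\<sigma>\<in>W d. \<chi> d \<sigma> \<otimes> (\<Otimes>t\<in>{1..d}. f t (x (inv' \<sigma> t))))"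
  unfolding pairing_def
proof (rule K.finsum_cong'[OF refl])
  fix \<sigma> assume \<sigma>: "\<sigma> \<in> W d"
  note p = W_permutes[OF \<sigma>]
  have c: "(\<lambda>t. f t (x (inv' \<sigma> t))) \<in> {1..d} \<rightarrow> carrier K"
  proof
    fix t assume t: "t \<in> {1..d}"
    then have "inv' \<sigma> t \<in> {1..d}" using permutes_in_image[OF permutes_inv[OF p]] by blast
    then show "f t (x (inv' \<sigma> t)) \<in> carrier K" using t x f by (intro dual_apply_closed) blast+
  qed
  have "(\<Otimes>t\<in>{1..d}. f t (x (inv' \<sigma> t))) = (\<Otimes>s\<in>{1..d}. f (\<sigma> s) (x s))"
    using finprod_permute[OF p c] by (simp add: permutes_inverses[OF p])
  then show "\<chi> d \<sigma> \<otimes> (\<Otimes>s\<in>{1..d}. f (\<sigma> s) (x s)) = \<chi> d \<sigma> \<otimes> (\<Otimes>t\<in>{1..d}. f t (x (inv' \<sigma> t)))"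
    by simp
next
  show "(\<lambda>\<sigma>. \<chi> d \<sigma> \<otimes> (\<Otimes>t\<in>{1..d}. f t (x (inv' \<sigma> t)))) \<in> W d \<rightarrow> carrier K"
  proof
    fix \<sigma> assume \<sigma>: "\<sigma> \<in> W d"
    have "f t (x (inv' \<sigma> t)) \<in> carrier K" if t: "t \<in> {1..d}" for t
    proof -
      have "inv' \<sigma> t \<in> {1..d}" using t permutes_in_image[OF permutes_inv[OF W_permutes[OF \<sigma>]]] by blast
      then show ?thesis using t x f by (intro dual_apply_closed) blast+
    qed
    then show "\<chi> d \<sigma> \<otimes> (\<Otimes>t\<in>{1..d}. f t (x (inv' \<sigma> t))) \<in> carrier K"
      using chi_closed[OF \<sigma>] by (intro K.m_closed K.finprod_closed) auto
  qed
qed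

lemma pairing_restrict:
  assumes x: "x \<in> {1..d} \<rightarrow> carrier E" and f: "f \<in> {1..d} \<rightarrow> carrier (dual_module K E)"
  shows "pairing d (restrict x {1..d}) (restrict f {1..d}) = pairing d x f"
  unfolding pairing_def
proof (rule K.finsum_cong'[OF refl])
  show "(\<lambda>\<sigma>. \<chi> d \<sigma> \<otimes> (\<Otimes>s\<in>{1..d}. f (\<sigma> s) (x s))) \<in> W d \<rightarrow> carrier K"
    using pairing_term_closed[OF x f] by blast
  fix \<sigma> assume \<sigma>: "\<sigma> \<in> W d"
  have "(\<Otimes>s\<in>{1..d}. restrict f {1..d} (\<sigma> s) (restrict x {1..d} s)) = (\<Otimes>s\<in>{1..d}. f (\<sigma> s) (x s))"
  proof (rule K.finprod_cong'[OF refl pairing_factor_closed[OF x f W_permutes[OF \<sigma>]]])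
    fix s assume s: "s \<in> {1..d}"
    then have "\<sigma> s \<in> {1..d}" using permutes_in_image[OF W_permutes[OF \<sigma>]] by blast
    with s show "restrict f {1..d} (\<sigma> s) (restrict x {1..d} s) = f (\<sigma> s) (x s)"
      by (simp only: restrict_apply if_True)
  qed
  then show "\<chi> d \<sigma> \<otimes> (\<Otimes>s\<in>{1..d}. restrict f {1..d} (\<sigma> s) (restrict x {1..d} s)) =
      \<chi> d \<sigma> \<otimes> (\<Otimes>s\<in>{1..d}. f (\<sigma> s) (x s))" by simp
qed

lemma tuples_Pi: "x \<in> tuples F d \<Longrightarrow> x \<in> {1..d} \<rightarrow> carrier F"
  by (auto simp: tuples_def)

lemma pairing_addI:
  assumes x: "x \<in> {1..d} \<rightarrow> carrier E" "x' \<in> {1..d} \<rightarrow> carrier E"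
    and f: "f \<in> {1..d} \<rightarrow> carrier (dual_module K E)" "f' \<in> {1..d} \<rightarrow> carrier (dual_module K E)"
    and eq: "\<And>\<sigma>. \<sigma> \<in> W d \<Longrightarrow> (\<Otimes>s\<in>{1..d}. f'' (\<sigma> s) (x'' s)) =
      (\<Otimes>s\<in>{1..d}. f (\<sigma> s) (x s)) \<oplus> (\<Otimes>s\<in>{1..d}. f' (\<sigma> s) (x' s))"
  shows "pairing d x'' f'' = pairing d x f \<oplus> pairing d x' f'"
proof -
  note c = pairing_term_closed[OF x(1) f(1)] pairing_term_closed[OF x(2) f(2)]
  have "pairing d x'' f'' = (\<Oplus>\<sigma>\<in>W d. \<chi> d \<sigma> \<otimes> (\<Otimes>s\<in>{1..d}. f (\<sigma> s) (x s)) \<oplus>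
      \<chi> d \<sigma> \<otimes> (\<Otimes>s\<in>{1..d}. f' (\<sigma> s) (x' s)))"
    unfolding pairing_def
  proof (rule K.finsum_cong'[OF refl])
    fix \<sigma> assume \<sigma>: "\<sigma> \<in> W d"
    note p = W_permutes[OF \<sigma>]
    show "\<chi> d \<sigma> \<otimes> (\<Otimes>s\<in>{1..d}. f'' (\<sigma> s) (x'' s)) = \<chi> d \<sigma> \<otimes> (\<Otimes>s\<in>{1..d}. f (\<sigma> s) (x s)) \<oplus>
      \<chi> d \<sigma> \<otimes> (\<Otimes>s\<in>{1..d}. f' (\<sigma> s) (x' s))"
      unfolding eq[OF \<sigma>]
      by (intro K.r_distr chi_closed[OF \<sigma>] K.finprod_closed pairing_factor_closed x f p)
  qed (use c in auto)
  also have "\<dots> = pairing d x f \<oplus> pairing d x' f'"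
    unfolding pairing_def by (rule K.finsum_addf) (use c in auto)
  finally show ?thesis .
qed

text \<open>Covers two situations: a scalar pulled out of one slot, with h the identity, and a
  permutation of the arguments, with h a translation of W d that multiplies the character by
  k.\<close>

lemma pairing_smultI:
  assumes k: "k \<in> carrier K" and x: "x \<in> {1..d} \<rightarrow> carrier E"
    and f: "f \<in> {1..d} \<rightarrow> carrier (dual_module K E)"
    and bij: "bij_betw h (W d) (W d)"
    and eq: "\<And>\<sigma>. \<sigma> \<in> W d \<Longrightarrow> \<chi> d (h \<sigma>) \<otimes> (\<Otimes>s\<in>{1..d}. f'' (h \<sigma> s) (x'' s)) =
      k \<otimes> (\<chi> d \<sigma> \<otimes> (\<Otimes>s\<in>{1..d}. f (\<sigma> s) (x s)))"
  shows "pairing d x'' f'' = k \<otimes> pairing d x f"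
proof -
  note c = pairing_term_closed[OF x f]
  let ?t = "\<lambda>\<sigma>. \<chi> d \<sigma> \<otimes> (\<Otimes>s\<in>{1..d}. f'' (\<sigma> s) (x'' s))"
  have im: "h ` W d = W d" and inj: "inj_on h (W d)" using bij by (auto simp: bij_betw_def)
  \<comment> \<open>Membership in K of the terms for \<open>x''\<close> and \<open>f''\<close> is
    read off, through the equation, from that of the terms for x and f.\<close>
  have "?t \<sigma> \<in> carrier K" if "\<sigma> \<in> W d" for \<sigma>
  proof -
    obtain \<rho> where "\<rho> \<in> W d" "\<sigma> = h \<rho>" using \<open>\<sigma> \<in> W d\<close> im by (metis imageE)
    then show ?thesis using eq[of \<rho>] c[of \<rho>] k by simp
  qed
  then have "pairing d x'' f'' = (\<Oplus>\<sigma>\<in>W d. ?t (h \<sigma>))"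
    unfolding pairing_def using K.finsum_reindex[of ?t h "W d"] inj im by auto
  also have "\<dots> = (\<Oplus>\<sigma>\<in>W d. k \<otimes> (\<chi> d \<sigma> \<otimes> (\<Otimes>s\<in>{1..d}. f (\<sigma> s) (x s))))"
    by (rule K.finsum_cong'[OF refl]) (use eq c k in auto)
  also have "\<dots> = k \<otimes> pairing d x f"
    unfolding pairing_def by (rule K.finsum_rdistr[symmetric]) (use c k finite_W in auto)
  finally show ?thesis .
qed

lemma Pi_upd: "x \<in> {1..d::nat} \<rightarrow> A \<Longrightarrow> u \<in> A \<Longrightarrow> x(i := u) \<in> {1..d} \<rightarrow> A"
  by (auto simp: Pi_iff)

lemma Pi_comp_inv: "x \<in> {1..d} \<rightarrow> A \<Longrightarrow> \<sigma> permutes {1..d::nat} \<Longrightarrow> x \<circ> \<sigma> \<in> {1..d} \<rightarrow> A"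
  using permutes_in_image by fastforce

lemma pairing_right_multilinear:
  assumes x: "x \<in> tuples E d"
  shows "chi_multilinear (dual_module K E) d (self_module K) (pairing d x)"
  unfolding chi_multilinear_def
proof (intro conjI ballI multilinear_mapI)
  let ?D = "dual_module K E"
  note x' = tuples_Pi[OF x]
  interpret D: module K ?D by (rule module_dual)
  show "pairing d x f \<in> carrier (self_module K)" if "f \<in> tuples ?D d" for f
    using pairing_closed[OF x' tuples_Pi[OF that]] by simp
  fix f i assume f: "f \<in> tuples ?D d" and i: "i \<in> {1..d}"
  note f' = tuples_Pi[OF f]
  \<comment> \<open>In the product indexed by s, the form in slot i occurs at s =
    \<open>inv' \<sigma> i\<close> and nowhere else.\<close>
  have j: "inv' \<sigma> i \<in> {1..d}" "\<sigma> (inv' \<sigma> i) = i" "\<And>t. t \<noteq> inv' \<sigma> i \<Longrightarrow> \<sigma> t \<noteq> i" if "\<sigma> \<in> W d" for \<sigma>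
    using i permutes_in_image[OF permutes_inv[OF W_permutes[OF that]]] permutes_inverses[OF W_permutes[OF that]] by auto
  {
    fix u v assume u: "u \<in> carrier ?D" and v: "v \<in> carrier ?D"
    note fu = Pi_upd[OF f' u, of i] and fv = Pi_upd[OF f' v, of i]
    show "pairing d x (f(i := u \<oplus>\<^bsub>?D\<^esub> v)) = pairing d x (f(i := u)) \<oplus>\<^bsub>self_module K\<^esub> pairing d x (f(i := v))"
      unfolding self_module_simps
    proof (rule pairing_addI[OF x' x' fu fv])
      fix \<sigma> assume \<sigma>: "\<sigma> \<in> W d"
      have xj: "x (inv' \<sigma> i) \<in> carrier E" using j(1)[OF \<sigma>] x' by blast
      show "(\<Otimes>s\<in>{1..d}. (f(i := u \<oplus>\<^bsub>?D\<^esub> v)) (\<sigma> s) (x s)) =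
        (\<Otimes>s\<in>{1..d}. (f(i := u)) (\<sigma> s) (x s)) \<oplus> (\<Otimes>s\<in>{1..d}. (f(i := v)) (\<sigma> s) (x s))"
      proof (rule K.finprod_add_at[where i = "inv' \<sigma> i"])
        show "(f(i := u \<oplus>\<^bsub>?D\<^esub> v)) (\<sigma> (inv' \<sigma> i)) (x (inv' \<sigma> i)) =
          (f(i := u)) (\<sigma> (inv' \<sigma> i)) (x (inv' \<sigma> i)) \<oplus> (f(i := v)) (\<sigma> (inv' \<sigma> i)) (x (inv' \<sigma> i))"
          using xj by (simp add: j(2)[OF \<sigma>] dual_module_eq_hom_module hom_module_apply)
      qed (use j[OF \<sigma>] pairing_factor_closed[OF x' fu W_permutes[OF \<sigma>]] pairing_factor_closed[OF x' fv W_permutes[OF \<sigma>]] in auto)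
    qed
  next
    fix k u assume k: "k \<in> carrier K" and u: "u \<in> carrier ?D"
    note fu = Pi_upd[OF f' u, of i]
    show "pairing d x (f(i := k \<odot>\<^bsub>?D\<^esub> u)) = k \<odot>\<^bsub>self_module K\<^esub> pairing d x (f(i := u))"
      unfolding self_module_simps
    proof (rule pairing_smultI[OF k x' fu bij_betw_id])
      fix \<sigma> assume \<sigma>: "\<sigma> \<in> W d"
      have xj: "x (inv' \<sigma> i) \<in> carrier E" using j(1)[OF \<sigma>] x' by blast
      note pc = pairing_factor_closed[OF x' fu W_permutes[OF \<sigma>]]
      have "(\<Otimes>s\<in>{1..d}. (f(i := k \<odot>\<^bsub>?D\<^esub> u)) (\<sigma> s) (x s)) = k \<otimes> (\<Otimes>s\<in>{1..d}. (f(i := u)) (\<sigma> s) (x s))"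
      proof (rule K.finprod_smult_at[where i = "inv' \<sigma> i"])
        show "(f(i := k \<odot>\<^bsub>?D\<^esub> u)) (\<sigma> (inv' \<sigma> i)) (x (inv' \<sigma> i)) =
          k \<otimes> (f(i := u)) (\<sigma> (inv' \<sigma> i)) (x (inv' \<sigma> i))"
          using xj by (simp add: j(2)[OF \<sigma>] dual_module_eq_hom_module hom_module_apply)
      qed (use j[OF \<sigma>] pc k in auto)
      then show "\<chi> d (id \<sigma>) \<otimes> (\<Otimes>s\<in>{1..d}. (f(i := k \<odot>\<^bsub>?D\<^esub> u)) (id \<sigma> s) (x s)) =
        k \<otimes> (\<chi> d \<sigma> \<otimes> (\<Otimes>s\<in>{1..d}. (f(i := u)) (\<sigma> s) (x s)))"
        using k chi_closed[OF \<sigma>] K.finprod_closed[OF pc] by (simp add: K.m_lcomm)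
    qed
  }
next
  let ?D = "dual_module K E"
  note x' = tuples_Pi[OF x]
  fix \<tau> f assume \<tau>: "\<tau> \<in> W d" and f: "f \<in> tuples ?D d"
  note f' = tuples_Pi[OF f]
  \<comment> \<open>Left translation by \<tau> cancels the inverse of \<tau> in the index of each
    form, at the price of the factor \<chi> \<tau>.\<close>
  have "bij_betw ((\<circ>) \<tau>) (W d) (W d)"
    by (rule bij_betw_byWitness[where f' = "(\<circ>) (inv' \<tau>)"])
      (auto simp: W_comp W_inv \<tau> permutes_inv_o[OF W_permutes[OF \<tau>]] simp flip: comp_assoc)
  then show "pairing d x (f \<circ> inv' \<tau>) = \<chi> d \<tau> \<odot>\<^bsub>self_module K\<^esub> pairing d x f"
    unfolding self_module_simps
  proof (rule pairing_smultI[OF chi_closed[OF \<tau>] x' f'])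
    fix \<sigma> assume \<sigma>: "\<sigma> \<in> W d"
    show "\<chi> d (\<tau> \<circ> \<sigma>) \<otimes> (\<Otimes>s\<in>{1..d}. (f \<circ> inv' \<tau>) ((\<tau> \<circ> \<sigma>) s) (x s)) =
      \<chi> d \<tau> \<otimes> (\<chi> d \<sigma> \<otimes> (\<Otimes>s\<in>{1..d}. f (\<sigma> s) (x s)))"
      using K.finprod_closed[OF pairing_factor_closed[OF x' f' W_permutes[OF \<sigma>]]]
      by (simp add: chi_comp \<tau> \<sigma> permutes_inverses[OF W_permutes[OF \<tau>]] K.m_assoc chi_closed)
  qed
qed

lemma pairing_left_multilinear:
  assumes f: "f \<in> tuples (dual_module K E) d"
  shows "chi_multilinear E d (self_module K) (\<lambda>x. pairing d x f)"
  unfolding chi_multilinear_def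
proof (intro conjI ballI multilinear_mapI)
  let ?D = "dual_module K E"
  note f' = tuples_Pi[OF f]
  show "pairing d x f \<in> carrier (self_module K)" if "x \<in> tuples E d" for x
    using pairing_closed[OF tuples_Pi[OF that] f'] by simp
  have lin: "f i \<in> linear_maps K E (self_module K)" if "i \<in> {1..d}" for i
    using f' that by (auto simp: dual_module_eq_hom_module)
  fix x i assume x: "x \<in> tuples E d" and i: "i \<in> {1..d}"
  note x' = tuples_Pi[OF x]
  have si: "\<sigma> i \<in> {1..d}" if "\<sigma> \<in> W d" for \<sigma>
    using i permutes_in_image[OF W_permutes[OF that]] by blast
  {
    fix u v assume u: "u \<in> carrier E" and v: "v \<in> carrier E"
    note xu = Pi_upd[OF x' u, of i] and xv = Pi_upd[OF x' v, of i]
    show "pairing d (x(i := u \<oplus>\<^bsub>E\<^esub> v)) f = pairing d (x(i := u)) f \<oplus>\<^bsub>self_module K\<^esub> pairing d (x(i := v)) f"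
      unfolding self_module_simps
    proof (rule pairing_addI[OF xu xv f' f'])
      fix \<sigma> assume \<sigma>: "\<sigma> \<in> W d"
      show "(\<Otimes>s\<in>{1..d}. f (\<sigma> s) ((x(i := u \<oplus>\<^bsub>E\<^esub> v)) s)) =
        (\<Otimes>s\<in>{1..d}. f (\<sigma> s) ((x(i := u)) s)) \<oplus> (\<Otimes>s\<in>{1..d}. f (\<sigma> s) ((x(i := v)) s))"
      proof (rule K.finprod_add_at[where i = i])
        show "f (\<sigma> i) ((x(i := u \<oplus>\<^bsub>E\<^esub> v)) i) = f (\<sigma> i) ((x(i := u)) i) \<oplus> f (\<sigma> i) ((x(i := v)) i)"
          using linear_add[OF lin[OF si[OF \<sigma>]] u v] by simp
      qed (use i pairing_factor_closed[OF xu f' W_permutes[OF \<sigma>]] pairing_factor_closed[OF xv f' W_permutes[OF \<sigma>]] in auto)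
    qed
  next
    fix k u assume k: "k \<in> carrier K" and u: "u \<in> carrier E"
    note xu = Pi_upd[OF x' u, of i]
    show "pairing d (x(i := k \<odot>\<^bsub>E\<^esub> u)) f = k \<odot>\<^bsub>self_module K\<^esub> pairing d (x(i := u)) f"
      unfolding self_module_simps
    proof (rule pairing_smultI[OF k xu f' bij_betw_id])
      fix \<sigma> assume \<sigma>: "\<sigma> \<in> W d"
      note pc = pairing_factor_closed[OF xu f' W_permutes[OF \<sigma>]]
      have "(\<Otimes>s\<in>{1..d}. f (\<sigma> s) ((x(i := k \<odot>\<^bsub>E\<^esub> u)) s)) = k \<otimes> (\<Otimes>s\<in>{1..d}. f (\<sigma> s) ((x(i := u)) s))"
      proof (rule K.finprod_smult_at[where i = i])
        show "f (\<sigma> i) ((x(i := k \<odot>\<^bsub>E\<^esub> u)) i) = k \<otimes> f (\<sigma> i) ((x(i := u)) i)"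
          using linear_smult[OF lin[OF si[OF \<sigma>]] k u] by simp
      qed (use i pc k in auto)
      then show "\<chi> d (id \<sigma>) \<otimes> (\<Otimes>s\<in>{1..d}. f (id \<sigma> s) ((x(i := k \<odot>\<^bsub>E\<^esub> u)) s)) =
        k \<otimes> (\<chi> d \<sigma> \<otimes> (\<Otimes>s\<in>{1..d}. f (\<sigma> s) ((x(i := u)) s)))"
        using k chi_closed[OF \<sigma>] K.finprod_closed[OF pc] by (simp add: K.m_lcomm)
    qed
  }
next
  let ?D = "dual_module K E"
  note f' = tuples_Pi[OF f]
  fix \<tau> x assume \<tau>: "\<tau> \<in> W d" and x: "x \<in> tuples E d"
  note x' = tuples_Pi[OF x]
  \<comment> \<open>Right translation, together with a substitution in the product, absorbs the
    permutation of the vectors. The factor that appears is the value at the inverse of \<tau>, which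
    equals \<chi> \<tau> since values are self-inverse.\<close>
  have "bij_betw (\<lambda>\<rho>. \<rho> \<circ> inv' \<tau>) (W d) (W d)"
    by (rule bij_betw_byWitness[where f' = "\<lambda>\<rho>. \<rho> \<circ> \<tau>"])
      (auto simp: W_comp W_inv \<tau> permutes_inv_o[OF W_permutes[OF \<tau>]] comp_assoc)
  then show "pairing d (x \<circ> inv' \<tau>) f = \<chi> d \<tau> \<odot>\<^bsub>self_module K\<^esub> pairing d x f"
    unfolding self_module_simps
  proof (rule pairing_smultI[OF chi_closed[OF \<tau>] x' f'])
    fix \<sigma> assume \<sigma>: "\<sigma> \<in> W d"
    have \<sigma>\<tau>: "\<sigma> \<circ> inv' \<tau> \<in> W d" using \<sigma> \<tau> by (simp add: W_comp W_inv)
    have xt: "x \<circ> inv' \<tau> \<in> {1..d} \<rightarrow> carrier E" by (rule Pi_comp_inv[OF x' permutes_inv[OF W_permutes[OF \<tau>]]])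
    have "(\<Otimes>s\<in>{1..d}. f ((\<sigma> \<circ> inv' \<tau>) s) ((x \<circ> inv' \<tau>) s)) = (\<Otimes>s\<in>{1..d}. f (\<sigma> s) (x s))"
      using finprod_permute[OF W_permutes[OF \<tau>] pairing_factor_closed[OF xt f' W_permutes[OF \<sigma>\<tau>]]]
      by (simp add: permutes_inverses[OF W_permutes[OF \<tau>]])
    then show "\<chi> d (\<sigma> \<circ> inv' \<tau>) \<otimes> (\<Otimes>s\<in>{1..d}. f ((\<sigma> \<circ> inv' \<tau>) s) ((x \<circ> inv' \<tau>) s)) =
      \<chi> d \<tau> \<otimes> (\<chi> d \<sigma> \<otimes> (\<Otimes>s\<in>{1..d}. f (\<sigma> s) (x s)))"
      using K.finprod_closed[OF pairing_factor_closed[OF x' f' W_permutes[OF \<sigma>]]]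
      by (simp add: chi_comp W_inv chi_inv chi_inv_eq \<tau> \<sigma> K.m_ac chi_closed)
  qed
qed

end

end

section \<open>Existence and uniqueness of the bilinear form\<close>

context character_sequence
begin

lemma chi_multilinear_zero:
  assumes "module K N"
  shows "chi_multilinear E d N (\<lambda>_. \<zero>\<^bsub>N\<^esub>)"
proof -
  interpret N: module K N by fact
  show ?thesis by (auto simp: chi_multilinear_def multilinear_map_def chi_closed)
qed

lemma bilinear_maps_chi_algebra:
  "bilinear_maps K (chi_algebra K W \<chi> E) (chi_algebra K W \<chi> F) N = bilinear_maps K (chi_sum K W \<chi> E) (chi_sum K W \<chi> F) N"
  by (simp add: bilinear_maps_def linear_maps_chi_algebra)

lemma bilinear_left_linear:
  assumes "\<beta> \<in> linear_maps K L (hom_module K M N)" "y \<in> carrier M"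
  shows "x \<in> carrier L \<Longrightarrow> x' \<in> carrier L \<Longrightarrow> \<beta> (x \<oplus>\<^bsub>L\<^esub> x') y = \<beta> x y \<oplus>\<^bsub>N\<^esub> \<beta> x' y"
    "k \<in> carrier K \<Longrightarrow> x \<in> carrier L \<Longrightarrow> \<beta> (k \<odot>\<^bsub>L\<^esub> x) y = k \<odot>\<^bsub>N\<^esub> \<beta> x y"
  by (simp_all add: linear_add[OF assms(1)] linear_smult[OF assms(1)] hom_module_apply assms(2))

context
  fixes E :: "('k, 'e, 'm) module_scheme"
  assumes E: "module K E"
begin

interpretation E: module K E by (rule E)

abbreviation (input) D where "D \<equiv> dual_module K E"

lemma chi_dec_tuples_closed: "module K F \<Longrightarrow> x \<in> tuples F d \<Longrightarrow> chi_dec K W \<chi> F d x \<in> carrier (chi_sum K W \<chi> F)"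
  using chi_dec_closed tuples_Pi[OF E] by blast

text \<open>In mixed degrees the prescribed value is zero, which is \<chi>-multilinear in either
  variable, so the two-variable universal property covers all degrees at once.\<close>

lemma chi_form_exists:
  "\<exists>\<beta>\<in>linear_maps K (chi_sum K W \<chi> E) (hom_module K (chi_sum K W \<chi> D) (self_module K)).
    \<forall>d e. \<forall>x\<in>tuples E d. \<forall>f\<in>tuples D e.
      \<beta> (chi_dec K W \<chi> E d x) (chi_dec K W \<chi> D e f) = (if d = e then pairing d x f else \<zero>)"
proof (rule chi_bilinear_lift[OF E module_dual[OF E] module_self_module[OF cring_K]])
  note z = chi_multilinear_zero[OF module_self_module[OF cring_K], simplified]
  show "chi_multilinear D e (self_module K) (\<lambda>f. if d = e then pairing d x f else \<zero>)"
    if "x \<in> tuples E d" for d e x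
    using pairing_right_multilinear[OF E that] z by (cases "d = e") simp_all
  show "chi_multilinear E d (self_module K) (\<lambda>x. if d = e then pairing d x f else \<zero>)"
    if "f \<in> tuples D e" for d e f
    using pairing_left_multilinear[OF E that] z by (cases "d = e") simp_all
qed

text \<open>The condition under the definite description in \<open>chi_form\<close>, in the same
  wording so that it folds; existence, uniqueness and the computation rules can then be stated for a
  predicate.\<close>

definition is_chi_form where
  "is_chi_form \<beta> \<longleftrightarrow> \<beta> \<in> bilinear_maps K (chi_algebra K W \<chi> E) (chi_algebra K W \<chi> D) (self_module K) \<and>
      (\<forall>d e. \<forall>c \<in> carrier (chi_power K W \<chi> E d). \<forall>c' \<in> carrier (chi_power K W \<chi> D e).
        d \<noteq> e \<longrightarrow> \<beta> (chi_incl K W \<chi> E d c) (chi_incl K W \<chi> D e c') = \<zero>) \<and>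
      (\<forall>d. \<forall>x \<in> {1..d} \<rightarrow> carrier E. \<forall>f \<in> {1..d} \<rightarrow> carrier D.
        \<beta> (chi_dec K W \<chi> E d x) (chi_dec K W \<chi> D d f) =
          (\<Oplus>\<sigma>\<in>W d. \<chi> d \<sigma> \<otimes> (\<Otimes>t\<in>{1..d}. f t (x (inv' \<sigma> t)))))"

lemma is_chi_form_bilinear:
  "is_chi_form \<beta> \<Longrightarrow> \<beta> \<in> linear_maps K (chi_sum K W \<chi> E) (hom_module K (chi_sum K W \<chi> D) (self_module K))"
  using bilinear_maps_eq[OF module_chi_sum[OF module_dual[OF E]] module_self_module[OF cring_K] module_chi_sum[OF E]]
  by (simp add: is_chi_form_def bilinear_maps_chi_algebra)

lemma is_chi_form_dec:
  assumes "is_chi_form \<beta>" and x: "x \<in> {1..d} \<rightarrow> carrier E" and f: "f \<in> {1..e} \<rightarrow> carrier D"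
  shows "\<beta> (chi_dec K W \<chi> E d x) (chi_dec K W \<chi> D e f) = (if d = e then pairing d x f else \<zero>)"
proof (cases "d = e")
  case True
  then show ?thesis using assms pairing_eq[OF E x, of f] by (simp add: is_chi_form_def)
next
  case False
  have "restrict x {1..d} \<in> tuples E d" "restrict f {1..e} \<in> tuples D e" using x f by (auto simp: tuples_def)
  note c = multilinear_map_closed[OF chi_multilinearD(1)[OF chi_vec_multilinear[OF E]] this(1)]
    multilinear_map_closed[OF chi_multilinearD(1)[OF chi_vec_multilinear[OF module_dual[OF E]]] this(2)]
  have "\<beta> (chi_dec K W \<chi> E d (restrict x {1..d})) (chi_dec K W \<chi> D e (restrict f {1..e})) = \<zero>"
    unfolding chi_dec_eq using assms(1) False c by (simp only: is_chi_form_def) blast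
  then show ?thesis using False by (simp only: chi_dec_restrict if_False)
qed

lemma chi_form_ex1: "\<exists>!\<beta>. is_chi_form \<beta>"
proof (rule ex_ex1I)
  have D: "module K D" by (rule module_dual[OF E])
  have S: "module K (self_module K)" by (rule module_self_module[OF cring_K])
  obtain \<beta> where \<beta>: "\<beta> \<in> linear_maps K (chi_sum K W \<chi> E) (hom_module K (chi_sum K W \<chi> D) (self_module K))"
    and \<beta>d: "\<And>d e x f. x \<in> tuples E d \<Longrightarrow> f \<in> tuples D e \<Longrightarrow>
      \<beta> (chi_dec K W \<chi> E d x) (chi_dec K W \<chi> D e f) = (if d = e then pairing d x f else \<zero>)"
    using chi_form_exists by blast
  have \<beta>l: "\<beta> u \<in> linear_maps K (chi_sum K W \<chi> D) (self_module K)" if "u \<in> carrier (chi_sum K W \<chi> E)" for u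
    using linear_closed[OF \<beta> that] by simp
  \<comment> \<open>Orthogonality is demanded for arbitrary homogeneous elements but known for
    decomposable ones. Linearity extends it in the form while the vector is still decomposable, and
    in the vector afterwards.\<close>
  have 1: "\<beta> (chi_dec K W \<chi> E d x) (chi_incl K W \<chi> D e c') = \<zero>"
    if x: "x \<in> tuples E d" and c': "c' \<in> carrier (chi_power K W \<chi> D e)" and ne: "d \<noteq> e" for d e x c'
  proof -
    define i where "i = restrict (chi_incl K W \<chi> D e) (carrier (chi_power K W \<chi> D e))"
    have i: "i \<in> linear_maps K (chi_power K W \<chi> D e) (chi_sum K W \<chi> D)" unfolding i_def by (rule chi_incl_linear[OF D])
    note b = \<beta>l[OF chi_dec_tuples_closed[OF E x]]
    have "\<beta> (chi_dec K W \<chi> E d x) (i c') = \<zero>" using c'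
    proof (rule chi_power_induct[OF D])
      show "\<beta> (chi_dec K W \<chi> E d x) (i (chi_vec D e f)) = \<zero>" if "f \<in> tuples D e" for f
        using \<beta>d[OF x that] ne multilinear_map_closed[OF chi_multilinearD(1)[OF chi_vec_multilinear[OF D]] that]
        by (simp add: i_def chi_dec_eq)
    qed (use linear_closed[OF i] in \<open>simp_all add: linear_zero[OF module_chi_power[OF D] module_chi_sum[OF D] i]
        linear_zero[OF module_chi_sum[OF D] S b, simplified] linear_add[OF i] linear_smult[OF i]
        linear_add[OF b, simplified] linear_smult[OF b, simplified]\<close>)
    then show ?thesis using c' by (simp add: i_def)
  qed
  have 2: "\<beta> (chi_incl K W \<chi> E d c) (chi_incl K W \<chi> D e c') = \<zero>"
    if c: "c \<in> carrier (chi_power K W \<chi> E d)" and c': "c' \<in> carrier (chi_power K W \<chi> D e)" and ne: "d \<noteq> e" for d e c c'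
  proof -
    let ?y = "chi_incl K W \<chi> D e c'"
    have y: "?y \<in> carrier (chi_sum K W \<chi> D)" using chi_incl_closed[OF D c'] .
    define i where "i = restrict (chi_incl K W \<chi> E d) (carrier (chi_power K W \<chi> E d))"
    have i: "i \<in> linear_maps K (chi_power K W \<chi> E d) (chi_sum K W \<chi> E)" unfolding i_def by (rule chi_incl_linear[OF E])
    have z: "\<beta> \<zero>\<^bsub>chi_sum K W \<chi> E\<^esub> ?y = \<zero>"
      using linear_zero[OF module_chi_sum[OF E] module_hom_module[OF module_chi_sum[OF D] S] \<beta>]
      by (simp add: hom_module_apply y)
    have "\<beta> (i c) ?y = \<zero>" using c
    proof (rule chi_power_induct[OF E])
      show "\<beta> (i (chi_vec E d x)) ?y = \<zero>" if "x \<in> tuples E d" for x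
        using 1[OF that c' ne] multilinear_map_closed[OF chi_multilinearD(1)[OF chi_vec_multilinear[OF E]] that]
        by (simp add: i_def chi_dec_eq)
    qed (use linear_closed[OF i] in \<open>simp_all add: linear_zero[OF module_chi_power[OF E] module_chi_sum[OF E] i]
        z linear_add[OF i] linear_smult[OF i] bilinear_left_linear[OF \<beta> y]\<close>)
    then show ?thesis using c by (simp add: i_def)
  qed
  have 3: "\<beta> (chi_dec K W \<chi> E d x) (chi_dec K W \<chi> D d f) =
          (\<Oplus>\<sigma>\<in>W d. \<chi> d \<sigma> \<otimes> (\<Otimes>t\<in>{1..d}. f t (x (inv' \<sigma> t))))"
    if x: "x \<in> {1..d} \<rightarrow> carrier E" and f: "f \<in> {1..d} \<rightarrow> carrier D" for d x f
  proof -
    have "restrict x {1..d} \<in> tuples E d" "restrict f {1..d} \<in> tuples D d" using x f by (auto simp: tuples_def)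
    from \<beta>d[OF this] show ?thesis
      unfolding chi_dec_restrict pairing_restrict[OF E x f] pairing_eq[OF E x f] by simp
  qed
  show "\<exists>\<beta>. is_chi_form \<beta>"
    using \<beta> 2 3 bilinear_maps_eq[OF module_chi_sum[OF D] S module_chi_sum[OF E]]
    by (intro exI[of _ \<beta>]) (simp add: is_chi_form_def bilinear_maps_chi_algebra)
  fix \<beta> \<gamma> assume b: "is_chi_form \<beta>" "is_chi_form \<gamma>"
  show "\<beta> = \<gamma>"
  proof (rule chi_bilinear_eqI[OF E D S is_chi_form_bilinear[OF b(1)] is_chi_form_bilinear[OF b(2)]])
    fix d x e f assume "x \<in> tuples E d" "f \<in> tuples D e"
    from this[THEN tuples_Pi[OF E]] show "\<beta> (chi_dec K W \<chi> E d x) (chi_dec K W \<chi> D e f) = \<gamma> (chi_dec K W \<chi> E d x) (chi_dec K W \<chi> D e f)"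
      using is_chi_form_dec[OF b(1)] is_chi_form_dec[OF b(2)] by metis
  qed
qed

lemma is_chi_form_chi_form: "is_chi_form (chi_form K W \<chi> E)"
  unfolding chi_form_def is_chi_form_def[symmetric] by (rule theI'[OF chi_form_ex1])

lemmas chi_form_bilinear = is_chi_form_bilinear[OF is_chi_form_chi_form]
lemmas chi_form_dec = is_chi_form_dec[OF is_chi_form_chi_form]

end

end

section \<open>Expansion in a basis\<close>

lemma (in abelian_monoid) finsum_Sigma:
  assumes "finite A" "finite B" "\<And>a b. a \<in> A \<Longrightarrow> b \<in> B \<Longrightarrow> g a b \<in> carrier G"
  shows "(\<Oplus>a\<in>A. \<Oplus>b\<in>B. g a b) = (\<Oplus>p\<in>A \<times> B. g (fst p) (snd p))"
  using assms(1,3)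
proof (induction A)
  case empty
  then show ?case by simp
next
  case (insert x A)
  have "(\<Oplus>p\<in>insert x A \<times> B. g (fst p) (snd p)) = (\<Oplus>p\<in>Pair x ` B \<union> A \<times> B. g (fst p) (snd p))"
    by (rule arg_cong[where f = "finsum G _"]) auto
  also have "\<dots> = (\<Oplus>p\<in>Pair x ` B. g (fst p) (snd p)) \<oplus> (\<Oplus>p\<in>A \<times> B. g (fst p) (snd p))"
    using insert assms(2) by (intro finsum_Un_disjoint) auto
  also have "(\<Oplus>p\<in>Pair x ` B. g (fst p) (snd p)) = (\<Oplus>b\<in>B. g x b)"
    using insert by (subst finsum_reindex) (auto simp: inj_on_def)
  also have "(\<Oplus>p\<in>A \<times> B. g (fst p) (snd p)) = (\<Oplus>a\<in>A. \<Oplus>b\<in>B. g a b)"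
    using insert by simp
  finally show ?case using insert by (simp add: finsum_closed Pi_iff)
qed

lemma (in abelian_monoid) finsum_swap:
  assumes "finite A" "finite B" "\<And>a b. a \<in> A \<Longrightarrow> b \<in> B \<Longrightarrow> g a b \<in> carrier G"
  shows "(\<Oplus>a\<in>A. \<Oplus>b\<in>B. g a b) = (\<Oplus>b\<in>B. \<Oplus>a\<in>A. g a b)"
proof -
  have "(\<Oplus>p\<in>A \<times> B. g (fst p) (snd p)) = (\<Oplus>p\<in>prod.swap ` (B \<times> A). g (fst p) (snd p))"
    by (simp add: product_swap)
  also have "\<dots> = (\<Oplus>p\<in>B \<times> A. g (snd p) (fst p))"
    using assms(3) by (subst finsum_reindex) (auto simp: inj_on_def)
  finally show ?thesis
    using finsum_Sigma[OF assms] finsum_Sigma[OF assms(2,1), of "\<lambda>b a. g a b"] assms(3) by simp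
qed

lemma (in module) finsum_smult_rdistr:
  assumes "finite A" "f \<in> A \<rightarrow> carrier R" "x \<in> carrier M"
  shows "(\<Oplus>\<^bsub>R\<^esub>i\<in>A. f i) \<odot>\<^bsub>M\<^esub> x = (\<Oplus>\<^bsub>M\<^esub>i\<in>A. f i \<odot>\<^bsub>M\<^esub> x)"
  using assms(1,2)
proof (induction A)
  case empty
  then show ?case using assms(3) by simp
next
  case (insert a A)
  then have "f a \<in> carrier R" "f \<in> A \<rightarrow> carrier R" by auto
  then show ?case using insert assms(3) by (simp add: smult_l_distr Pi_iff)
qed

text \<open>With all slots but i frozen, h is a linear map of the entry in slot i, and linear maps
  commute with finite sums.\<close>

lemma multilinear_map_finsum:
  assumes F: "module K F" and N: "module K N" and h: "multilinear_map K F d N h"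
    and x: "x \<in> tuples F d" and i: "i \<in> {1..d}" and u: "u \<in> B \<rightarrow> carrier F"
  shows "h (x(i := \<Oplus>\<^bsub>F\<^esub>b\<in>B. u b)) = (\<Oplus>\<^bsub>N\<^esub>b\<in>B. h (x(i := u b)))"
proof -
  interpret F: module K F by (rule F)
  interpret N: module K N by (rule N)
  have l: "(\<lambda>v\<in>carrier F. h (x(i := v))) \<in> linear_maps K F N"
    by (rule linear_maps_restrictI[OF F])
      (simp_all add: multilinear_map_closed[OF h tuples_upd[OF x i]] multilinear_map_add[OF h x i] multilinear_map_smult[OF h x i])
  have "(\<Oplus>\<^bsub>F\<^esub>b\<in>B. u b) \<in> carrier F" using u by (rule F.M.finsum_closed)
  then have "h (x(i := \<Oplus>\<^bsub>F\<^esub>b\<in>B. u b)) = (\<Oplus>\<^bsub>N\<^esub>b\<in>B. (\<lambda>v\<in>carrier F. h (x(i := v))) (u b))"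
    using linear_finsum[OF F N l u] by simp
  also have "\<dots> = (\<Oplus>\<^bsub>N\<^esub>b\<in>B. h (x(i := u b)))"
    by (rule N.M.finsum_cong'[OF refl]) (use u multilinear_map_closed[OF h tuples_upd[OF x i]] in auto)
  finally show ?thesis .
qed

text \<open>Induction on the set S of slots already expanded. Adding a slot replaces each term by a
  sum over B, and the double sum over functions on S and elements of B is a sum over functions on
  the larger set.\<close>

lemma multilinear_map_expand:
  assumes F: "module K F" and N: "module K N" and h: "multilinear_map K F d N h"
    and B: "finite B" and e: "\<And>b. b \<in> B \<Longrightarrow> e b \<in> carrier F"
    and c: "\<And>t b. t \<in> {1..d} \<Longrightarrow> b \<in> B \<Longrightarrow> c t b \<in> carrier K"
    and y: "y \<in> tuples F d" and yc: "\<And>t. t \<in> {1..d} \<Longrightarrow> y t = (\<Oplus>\<^bsub>F\<^esub>b\<in>B. c t b \<odot>\<^bsub>F\<^esub> e b)"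
  shows "h y = (\<Oplus>\<^bsub>N\<^esub>\<beta>\<in>{1..d} \<rightarrow>\<^sub>E B. (\<Otimes>\<^bsub>K\<^esub>t\<in>{1..d}. c t (\<beta> t)) \<odot>\<^bsub>N\<^esub> h (\<lambda>t\<in>{1..d}. e (\<beta> t)))"
proof -
  interpret F: module K F by (rule F)
  interpret N: module K N by (rule N)
  \<comment> \<open>The intermediate tuple: slots in S carry the vectors selected by \<beta>, the
    others still those of y.\<close>
  define z where "z S \<beta> t = (if t \<in> S then e (\<beta> t) else y t)" for S :: "nat set" and \<beta> t
  have zt: "z S \<beta> \<in> tuples F d" if "S \<subseteq> {1..d}" "\<beta> \<in> S \<rightarrow> B" for S \<beta>
    using that y e by (auto simp: z_def tuples_def PiE_def extensional_def Pi_iff)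
  have pc: "(\<Otimes>\<^bsub>K\<^esub>t\<in>S. c t (\<beta> t)) \<in> carrier K" if "S \<subseteq> {1..d}" "\<beta> \<in> S \<rightarrow> B" for S \<beta>
    by (rule F.R.finprod_closed, rule Pi_I, rule c) (use that in auto)
  have "h y = (\<Oplus>\<^bsub>N\<^esub>\<beta>\<in>S \<rightarrow>\<^sub>E B. (\<Otimes>\<^bsub>K\<^esub>t\<in>S. c t (\<beta> t)) \<odot>\<^bsub>N\<^esub> h (z S \<beta>))"
    if "finite S" "S \<subseteq> {1..d}" for S
    using that
  proof (induction S)
    case empty
    have "z {} \<beta> = y" for \<beta> by (simp add: z_def fun_eq_iff)
    then show ?case using multilinear_map_closed[OF h y] by simp
  next
    case (insert a S)
    have a: "a \<in> {1..d}" and S: "S \<subseteq> {1..d}" and aS: "a \<notin> S" using insert by auto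
    have fin: "finite (S \<rightarrow>\<^sub>E B)" using insert B by (simp add: finite_PiE)
    let ?g = "\<lambda>\<beta> b. ((\<Otimes>\<^bsub>K\<^esub>t\<in>S. c t (\<beta> t)) \<otimes>\<^bsub>K\<^esub> c a b) \<odot>\<^bsub>N\<^esub> h ((z S \<beta>)(a := e b))"
    have gc: "?g \<beta> b \<in> carrier N" if "\<beta> \<in> S \<rightarrow>\<^sub>E B" "b \<in> B" for \<beta> b
    proof -
      have "\<beta> \<in> S \<rightarrow> B" using that by auto
      then show ?thesis using pc[OF S, of \<beta>] c[OF a that(2)]
          multilinear_map_closed[OF h tuples_upd[OF zt[OF S, of \<beta>] a e[OF that(2)]]] by simp
    qed
    have step: "(\<Otimes>\<^bsub>K\<^esub>t\<in>S. c t (\<beta> t)) \<odot>\<^bsub>N\<^esub> h (z S \<beta>) = (\<Oplus>\<^bsub>N\<^esub>b\<in>B. ?g \<beta> b)"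
      if "\<beta> \<in> S \<rightarrow>\<^sub>E B" for \<beta>
    proof -
      have \<beta>: "\<beta> \<in> S \<rightarrow> B" using that by auto
      have hc: "h ((z S \<beta>)(a := e b)) \<in> carrier N" if "b \<in> B" for b
        using multilinear_map_closed[OF h tuples_upd[OF zt[OF S \<beta>] a e[OF that]]] .
      have "z S \<beta> = (z S \<beta>)(a := \<Oplus>\<^bsub>F\<^esub>b\<in>B. c a b \<odot>\<^bsub>F\<^esub> e b)"
        using aS yc[OF a] by (auto simp: fun_eq_iff z_def)
      then have "h (z S \<beta>) = h ((z S \<beta>)(a := \<Oplus>\<^bsub>F\<^esub>b\<in>B. c a b \<odot>\<^bsub>F\<^esub> e b))" by (rule arg_cong)
      also have "\<dots> = (\<Oplus>\<^bsub>N\<^esub>b\<in>B. h ((z S \<beta>)(a := c a b \<odot>\<^bsub>F\<^esub> e b)))"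
        by (rule multilinear_map_finsum[OF F N h zt[OF S \<beta>] a]) (use c[OF a] e in auto)
      also have "\<dots> = (\<Oplus>\<^bsub>N\<^esub>b\<in>B. c a b \<odot>\<^bsub>N\<^esub> h ((z S \<beta>)(a := e b)))"
        by (rule N.M.finsum_cong'[OF refl])
          (use c[OF a] e hc multilinear_map_smult[OF h zt[OF S \<beta>] a] in auto)
      finally have "(\<Otimes>\<^bsub>K\<^esub>t\<in>S. c t (\<beta> t)) \<odot>\<^bsub>N\<^esub> h (z S \<beta>) =
          (\<Oplus>\<^bsub>N\<^esub>b\<in>B. (\<Otimes>\<^bsub>K\<^esub>t\<in>S. c t (\<beta> t)) \<odot>\<^bsub>N\<^esub> (c a b \<odot>\<^bsub>N\<^esub> h ((z S \<beta>)(a := e b))))"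
        using N.finsum_smult_ldistr[OF B pc[OF S \<beta>], of "\<lambda>b. c a b \<odot>\<^bsub>N\<^esub> h ((z S \<beta>)(a := e b))"] c[OF a] hc by auto
      also have "\<dots> = (\<Oplus>\<^bsub>N\<^esub>b\<in>B. ?g \<beta> b)"
        by (rule N.M.finsum_cong'[OF refl]) (use gc[OF that] c[OF a] hc pc[OF S \<beta>] in \<open>auto simp: N.smult_assoc1\<close>)
      finally show ?thesis .
    qed
    \<comment> \<open>Extends a function on S by a value at a. As the functions are extensional and
      a is not in S, this is a bijection onto the functions on the larger set.\<close>
    let ?\<phi> = "\<lambda>p. (fst p)(a := snd p)"
    have im: "?\<phi> ` ((S \<rightarrow>\<^sub>E B) \<times> B) = insert a S \<rightarrow>\<^sub>E B"
    proof (intro equalityI subsetI)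
      fix \<gamma> assume \<gamma>: "\<gamma> \<in> insert a S \<rightarrow>\<^sub>E B"
      then have "\<gamma> = ?\<phi> (restrict \<gamma> S, \<gamma> a)" using aS by (auto simp: fun_eq_iff PiE_def extensional_def)
      moreover have "(restrict \<gamma> S, \<gamma> a) \<in> (S \<rightarrow>\<^sub>E B) \<times> B" using \<gamma> by auto
      ultimately show "\<gamma> \<in> ?\<phi> ` ((S \<rightarrow>\<^sub>E B) \<times> B)" by (rule image_eqI)
    qed (auto simp: PiE_def extensional_def)
    have inj: "inj_on ?\<phi> ((S \<rightarrow>\<^sub>E B) \<times> B)"
    proof (rule inj_onI)
      fix p p' assume p: "p \<in> (S \<rightarrow>\<^sub>E B) \<times> B" and p': "p' \<in> (S \<rightarrow>\<^sub>E B) \<times> B" and eq: "?\<phi> p = ?\<phi> p'"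
      have "fst p t = fst p' t" for t
        using p p' aS fun_cong[OF eq, of t] by (cases "t = a") (auto simp: PiE_def extensional_def)
      moreover have "snd p = snd p'" using fun_cong[OF eq, of a] by simp
      ultimately show "p = p'" by (auto simp: prod_eq_iff)
    qed
    have tm: "(\<Otimes>\<^bsub>K\<^esub>t\<in>insert a S. c t (?\<phi> p t)) \<odot>\<^bsub>N\<^esub> h (z (insert a S) (?\<phi> p)) = ?g (fst p) (snd p)"
      if p: "p \<in> (S \<rightarrow>\<^sub>E B) \<times> B" for p
    proof -
      have \<beta>: "fst p \<in> S \<rightarrow> B" and b: "snd p \<in> B" using p by auto
      have "(\<Otimes>\<^bsub>K\<^esub>t\<in>insert a S. c t (?\<phi> p t)) = c a (snd p) \<otimes>\<^bsub>K\<^esub> (\<Otimes>\<^bsub>K\<^esub>t\<in>S. c t (?\<phi> p t))"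
        using insert.hyps \<beta> b c a S by (subst F.R.finprod_insert) (auto simp: Pi_iff)
      also have "(\<Otimes>\<^bsub>K\<^esub>t\<in>S. c t (?\<phi> p t)) = (\<Otimes>\<^bsub>K\<^esub>t\<in>S. c t (fst p t))"
      proof (rule F.R.finprod_cong'[OF refl])
        show "(\<lambda>t. c t (fst p t)) \<in> S \<rightarrow> carrier K"
          by (rule Pi_I, rule c) (use S \<beta> in auto)
      qed (use aS in auto)
      finally have "(\<Otimes>\<^bsub>K\<^esub>t\<in>insert a S. c t (?\<phi> p t)) = (\<Otimes>\<^bsub>K\<^esub>t\<in>S. c t (fst p t)) \<otimes>\<^bsub>K\<^esub> c a (snd p)"
        using pc[OF S \<beta>] c[OF a b] by (simp add: F.R.m_comm)
      moreover have "z (insert a S) (?\<phi> p) = (z S (fst p))(a := e (snd p))"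
        using aS by (auto simp: z_def fun_eq_iff)
      ultimately show ?thesis by simp
    qed
    have "h y = (\<Oplus>\<^bsub>N\<^esub>\<beta>\<in>S \<rightarrow>\<^sub>E B. (\<Otimes>\<^bsub>K\<^esub>t\<in>S. c t (\<beta> t)) \<odot>\<^bsub>N\<^esub> h (z S \<beta>))" using insert.IH S by simp
    also have "\<dots> = (\<Oplus>\<^bsub>N\<^esub>\<beta>\<in>S \<rightarrow>\<^sub>E B. \<Oplus>\<^bsub>N\<^esub>b\<in>B. ?g \<beta> b)"
      by (rule N.M.finsum_cong'[OF refl]) (use step gc in \<open>auto intro!: N.M.finsum_closed\<close>)
    also have "\<dots> = (\<Oplus>\<^bsub>N\<^esub>p\<in>(S \<rightarrow>\<^sub>E B) \<times> B. ?g (fst p) (snd p))"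
      by (rule N.M.finsum_Sigma[OF fin B gc])
    also have "\<dots> = (\<Oplus>\<^bsub>N\<^esub>p\<in>(S \<rightarrow>\<^sub>E B) \<times> B. (\<Otimes>\<^bsub>K\<^esub>t\<in>insert a S. c t (?\<phi> p t)) \<odot>\<^bsub>N\<^esub> h (z (insert a S) (?\<phi> p)))"
      by (rule N.M.finsum_cong'[OF refl]) (use tm gc in auto)
    also have "\<dots> = (\<Oplus>\<^bsub>N\<^esub>\<beta>\<in>?\<phi> ` ((S \<rightarrow>\<^sub>E B) \<times> B). (\<Otimes>\<^bsub>K\<^esub>t\<in>insert a S. c t (\<beta> t)) \<odot>\<^bsub>N\<^esub> h (z (insert a S) \<beta>))"
    proof (rule N.M.finsum_reindex[symmetric, OF Pi_I inj], erule imageE)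
      fix \<gamma> p assume \<gamma>: "\<gamma> = ?\<phi> p" and p: "p \<in> (S \<rightarrow>\<^sub>E B) \<times> B"
      then have "?g (fst p) (snd p) \<in> carrier N" by (intro gc) auto
      then show "(\<Otimes>\<^bsub>K\<^esub>t\<in>insert a S. c t (\<gamma> t)) \<odot>\<^bsub>N\<^esub> h (z (insert a S) \<gamma>) \<in> carrier N"
        unfolding \<gamma> tm[OF p] .
    qed
    finally show ?case unfolding im .
  qed
  from this[of "{1..d}"] have "h y = (\<Oplus>\<^bsub>N\<^esub>\<beta>\<in>{1..d} \<rightarrow>\<^sub>E B. (\<Otimes>\<^bsub>K\<^esub>t\<in>{1..d}. c t (\<beta> t)) \<odot>\<^bsub>N\<^esub> h (z {1..d} \<beta>))" by simp
  moreover have "z {1..d} \<beta> = (\<lambda>t\<in>{1..d}. e (\<beta> t))" for \<beta>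
    using y by (auto simp: z_def fun_eq_iff tuples_def PiE_def extensional_def)
  ultimately show ?thesis by (simp only:)
qed

text \<open>The forms \<open>b'\<close> are the coordinate functions of the basis; uniqueness of
  coordinates makes them linear. The expansion of u is verified at each x by applying u to the
  expansion of x.\<close>

lemma dual_basis:
  assumes E: "module K E" and fb: "finite_basis K E B"
  obtains b' where "\<And>b. b \<in> B \<Longrightarrow> b' b \<in> carrier (dual_module K E)"
    "\<And>u. u \<in> carrier (dual_module K E) \<Longrightarrow> u = (\<Oplus>\<^bsub>dual_module K E\<^esub>b\<in>B. u b \<odot>\<^bsub>dual_module K E\<^esub> b' b)"
proof -
  interpret E: module K E by (rule E)
  have S: "module K (self_module K)" by (rule module_self_module[OF E.R.is_cring])
  have fin: "finite B" and BE: "B \<subseteq> carrier E"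
    and ex1: "\<And>x. x \<in> carrier E \<Longrightarrow> \<exists>!c. c \<in> B \<rightarrow>\<^sub>E carrier K \<and> x = (\<Oplus>\<^bsub>E\<^esub>b\<in>B. c b \<odot>\<^bsub>E\<^esub> b)"
    using fb by (auto simp: finite_basis_def)
  define coord where "coord x = (THE c. c \<in> B \<rightarrow>\<^sub>E carrier K \<and> x = (\<Oplus>\<^bsub>E\<^esub>b\<in>B. c b \<odot>\<^bsub>E\<^esub> b))" for x
  have coord: "coord x \<in> B \<rightarrow>\<^sub>E carrier K" "x = (\<Oplus>\<^bsub>E\<^esub>b\<in>B. coord x b \<odot>\<^bsub>E\<^esub> b)" if "x \<in> carrier E" for x
    using theI'[OF ex1[OF that]] unfolding coord_def by blast+
  have coord_eq: "coord x = c" if "x \<in> carrier E" "c \<in> B \<rightarrow>\<^sub>E carrier K" "x = (\<Oplus>\<^bsub>E\<^esub>b\<in>B. c b \<odot>\<^bsub>E\<^esub> b)" for x c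
    using ex1[OF that(1)] coord[OF that(1)] that(2,3) by blast
  have cc: "coord x b \<in> carrier K" if "x \<in> carrier E" "b \<in> B" for x b using coord(1)[OF that(1)] that(2) by blast
  have sc: "coord x b \<odot>\<^bsub>E\<^esub> b \<in> carrier E" if "x \<in> carrier E" "b \<in> B" for x b
    using cc[OF that] that BE by auto
  define b' where "b' b = (\<lambda>x\<in>carrier E. coord x b)" for b
  have b': "b' b \<in> carrier (dual_module K E)" if b: "b \<in> B" for b
    unfolding dual_module_eq_hom_module carrier_hom_module b'_def
  proof (rule linear_maps_restrictI[OF E])
    show "coord x b \<in> carrier (self_module K)" if "x \<in> carrier E" for x using cc[OF that b] by simp
    show "coord (x \<oplus>\<^bsub>E\<^esub> y) b = coord x b \<oplus>\<^bsub>self_module K\<^esub> coord y b" if x: "x \<in> carrier E" and y: "y \<in> carrier E" for x y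
    proof -
      have "x \<oplus>\<^bsub>E\<^esub> y = (\<Oplus>\<^bsub>E\<^esub>b\<in>B. coord x b \<odot>\<^bsub>E\<^esub> b) \<oplus>\<^bsub>E\<^esub> (\<Oplus>\<^bsub>E\<^esub>b\<in>B. coord y b \<odot>\<^bsub>E\<^esub> b)"
        using coord(2)[OF x] coord(2)[OF y] by simp
      also have "\<dots> = (\<Oplus>\<^bsub>E\<^esub>b\<in>B. coord x b \<odot>\<^bsub>E\<^esub> b \<oplus>\<^bsub>E\<^esub> coord y b \<odot>\<^bsub>E\<^esub> b)"
        by (rule E.M.finsum_addf[symmetric]) (use sc x y in auto)
      also have "\<dots> = (\<Oplus>\<^bsub>E\<^esub>b\<in>B. (\<lambda>b\<in>B. coord x b \<oplus>\<^bsub>K\<^esub> coord y b) b \<odot>\<^bsub>E\<^esub> b)"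
        by (rule E.M.finsum_cong'[OF refl]) (use cc x y BE in \<open>auto simp: E.smult_l_distr subset_eq\<close>)
      finally have "coord (x \<oplus>\<^bsub>E\<^esub> y) = (\<lambda>b\<in>B. coord x b \<oplus>\<^bsub>K\<^esub> coord y b)"
        by (rule coord_eq[OF E.M.a_closed[OF x y], rotated]) (use cc x y in auto)
      then show ?thesis using b by simp
    qed
    show "coord (k \<odot>\<^bsub>E\<^esub> x) b = k \<odot>\<^bsub>self_module K\<^esub> coord x b" if k: "k \<in> carrier K" and x: "x \<in> carrier E" for k x
    proof -
      have "k \<odot>\<^bsub>E\<^esub> x = k \<odot>\<^bsub>E\<^esub> (\<Oplus>\<^bsub>E\<^esub>b\<in>B. coord x b \<odot>\<^bsub>E\<^esub> b)" using coord(2)[OF x] by simp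
      also have "\<dots> = (\<Oplus>\<^bsub>E\<^esub>b\<in>B. k \<odot>\<^bsub>E\<^esub> (coord x b \<odot>\<^bsub>E\<^esub> b))"
        by (rule E.finsum_smult_ldistr[OF fin k]) (use sc x in auto)
      also have "\<dots> = (\<Oplus>\<^bsub>E\<^esub>b\<in>B. (\<lambda>b\<in>B. k \<otimes>\<^bsub>K\<^esub> coord x b) b \<odot>\<^bsub>E\<^esub> b)"
        by (rule E.M.finsum_cong'[OF refl]) (use cc x k BE in \<open>auto simp: E.smult_assoc1 subset_eq\<close>)
      finally have "coord (k \<odot>\<^bsub>E\<^esub> x) = (\<lambda>b\<in>B. k \<otimes>\<^bsub>K\<^esub> coord x b)"
        by (rule coord_eq[OF E.smult_closed[OF k x], rotated]) (use cc k x in auto)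
      then show ?thesis using b by simp
    qed
  qed
  let ?D = "hom_module K E (self_module K)"
  interpret D: module K ?D by (rule module_hom_module[OF E S])
  have "u = (\<Oplus>\<^bsub>?D\<^esub>b\<in>B. u b \<odot>\<^bsub>?D\<^esub> b' b)" if u: "u \<in> linear_maps K E (self_module K)" for u
  proof (rule linear_eqI[OF u])
    have ub: "u b \<in> carrier K" if "b \<in> B" for b using linear_closed[OF u, of b] that BE by auto
    have tc: "(\<lambda>b. u b \<odot>\<^bsub>?D\<^esub> b' b) \<in> B \<rightarrow> carrier ?D"
      using ub b' by (auto simp: dual_module_eq_hom_module intro!: D.smult_closed[simplified])
    then show sumc: "(\<Oplus>\<^bsub>?D\<^esub>b\<in>B. u b \<odot>\<^bsub>?D\<^esub> b' b) \<in> linear_maps K E (self_module K)"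
      using D.M.finsum_closed by simp
    fix x assume x: "x \<in> carrier E"
    have "u x = u (\<Oplus>\<^bsub>E\<^esub>b\<in>B. coord x b \<odot>\<^bsub>E\<^esub> b)" using coord(2)[OF x] by simp
    also have "\<dots> = (\<Oplus>\<^bsub>K\<^esub>b\<in>B. u (coord x b \<odot>\<^bsub>E\<^esub> b))"
      using linear_finsum[OF E S u, of "\<lambda>b. coord x b \<odot>\<^bsub>E\<^esub> b" B] sc[OF x] by auto
    also have "\<dots> = (\<Oplus>\<^bsub>K\<^esub>b\<in>B. (u b \<odot>\<^bsub>?D\<^esub> b' b) x)"
      by (rule E.R.finsum_cong'[OF refl])
        (use x cc ub BE linear_smult[OF u] in \<open>auto simp: hom_module_apply b'_def E.R.m_comm subset_eq\<close>)
    \<comment> \<open>Evaluation at x is written as a linear map on the dual in order to pull it out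
      of the sum.\<close>
    also have "\<dots> = (\<Oplus>\<^bsub>K\<^esub>b\<in>B. (\<lambda>v\<in>linear_maps K E (self_module K). v x) (u b \<odot>\<^bsub>?D\<^esub> b' b))"
      by (rule E.R.finsum_cong'[OF refl]) (use tc x linear_closed[of _ K E "self_module K" x] in auto)
    also have "\<dots> = (\<lambda>v\<in>linear_maps K E (self_module K). v x) (\<Oplus>\<^bsub>?D\<^esub>b\<in>B. u b \<odot>\<^bsub>?D\<^esub> b' b)"
      using linear_finsum[OF module_hom_module[OF E S] S evaluation_linear[OF E S x] tc] by simp
    finally show "u x = (\<Oplus>\<^bsub>?D\<^esub>b\<in>B. u b \<odot>\<^bsub>?D\<^esub> b' b) x" using sumc by simp
  qed
  then show ?thesis using that[of b'] b' by (simp add: dual_module_eq_hom_module)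
qed

text \<open>The homomorphism from the rationals sends the reciprocal of the cardinality to an
  inverse in K.\<close>

lemma card_unit:
  assumes K: "cring K" and r: "rational_ring K" and A: "finite A" "A \<noteq> {}"
  shows "(\<Oplus>\<^bsub>K\<^esub>a\<in>A. \<one>\<^bsub>K\<^esub>) \<in> Units K"
proof -
  interpret K: cring K by (rule K)
  obtain \<phi> where \<phi>: "\<phi> \<in> ring_hom rat_ring K" using r by (auto simp: rational_ring_def)
  have c: "\<phi> x \<in> carrier K" for x using ring_hom_closed[OF \<phi>] by (simp add: rat_ring_def)
  have m: "\<phi> (x * y) = \<phi> x \<otimes>\<^bsub>K\<^esub> \<phi> y" and a: "\<phi> (x + y) = \<phi> x \<oplus>\<^bsub>K\<^esub> \<phi> y" for x y
    using ring_hom_mult[OF \<phi>, of x y] ring_hom_add[OF \<phi>, of x y] by (simp_all add: rat_ring_def)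
  have o: "\<phi> 1 = \<one>\<^bsub>K\<^esub>" using ring_hom_one[OF \<phi>] by (simp add: rat_ring_def)
  have z: "\<phi> 0 = \<zero>\<^bsub>K\<^esub>" using a[of 0 0] c[of 0] K.add.l_cancel_one[of "\<phi> 0" "\<phi> 0"] by simp
  have "(\<Oplus>\<^bsub>K\<^esub>a\<in>A. \<one>\<^bsub>K\<^esub>) = \<phi> (of_nat (card A))"
    using A(1) by (induction A) (auto simp: z a o)
  moreover have "\<phi> (of_nat (card A)) \<otimes>\<^bsub>K\<^esub> \<phi> (1 / of_nat (card A)) = \<one>\<^bsub>K\<^esub>"
    using A by (simp flip: m add: o)
  ultimately show ?thesis using c K.m_comm by (auto simp: Units_def intro!: bexI[of _ "\<phi> (1 / of_nat (card A))"])
qed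

context character_sequence
begin

text \<open>The transformation rule for the inverse permutation; as the character is self-inverse,
  the scalar is again \<chi> \<sigma>.\<close>

lemma chi_dec_comp:
  assumes "module K F" and \<sigma>: "\<sigma> \<in> W d" and f: "f \<in> tuples F d"
  shows "chi_dec K W \<chi> F d (f \<circ> \<sigma>) = \<chi> d \<sigma> \<odot>\<^bsub>chi_sum K W \<chi> F\<^esub> chi_dec K W \<chi> F d f"
  using chi_multilinearD(2)[OF chi_dec_multilinear[OF assms(1)] W_inv[OF \<sigma>] f]
  by (simp add: permutes_inv_inv[OF W_permutes[OF \<sigma>]] chi_inv[OF \<sigma>] chi_inv_eq[OF \<sigma>])

text \<open>The scalar on the right is the order of \<open>W d\<close>.\<close>

lemma sum_pairing_dual_basis:
  assumes E: "module K E" and fb: "finite_basis K E B"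
    and b': "\<And>b. b \<in> B \<Longrightarrow> b' b \<in> carrier (dual_module K E)"
    and exp: "\<And>u. u \<in> carrier (dual_module K E) \<Longrightarrow> u = (\<Oplus>\<^bsub>dual_module K E\<^esub>b\<in>B. u b \<odot>\<^bsub>dual_module K E\<^esub> b' b)"
    and f: "f \<in> tuples (dual_module K E) d"
  shows "(\<Oplus>\<^bsub>chi_sum K W \<chi> (dual_module K E)\<^esub>\<beta>\<in>{1..d} \<rightarrow>\<^sub>E B. pairing d \<beta> f \<odot>\<^bsub>chi_sum K W \<chi> (dual_module K E)\<^esub>
      chi_dec K W \<chi> (dual_module K E) d (\<lambda>t\<in>{1..d}. b' (\<beta> t))) =
    (\<Oplus>\<sigma>\<in>W d. \<one>) \<odot>\<^bsub>chi_sum K W \<chi> (dual_module K E)\<^esub> chi_dec K W \<chi> (dual_module K E) d f"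
proof -
  let ?D = "dual_module K E"
  let ?S = "chi_sum K W \<chi> ?D" and ?dec = "chi_dec K W \<chi> ?D d"
  have D: "module K ?D" by (rule module_dual[OF E])
  interpret S: module K ?S by (rule module_chi_sum[OF D])
  have fin: "finite B" and BE: "B \<subseteq> carrier E" using fb by (auto simp: finite_basis_def)
  have finP: "finite ({1..d} \<rightarrow>\<^sub>E B)" using fin by (simp add: finite_PiE)
  let ?v = "\<lambda>\<beta>. ?dec (\<lambda>t\<in>{1..d}. b' (\<beta> t))"
  let ?p = "\<lambda>\<sigma> \<beta>. \<Otimes>s\<in>{1..d}. f (\<sigma> s) (\<beta> s)"
  note f' = tuples_Pi[OF E f]
  have \<beta>E: "\<beta> \<in> {1..d} \<rightarrow> carrier E" if "\<beta> \<in> {1..d} \<rightarrow>\<^sub>E B" for \<beta> using that BE by (auto simp: Pi_iff)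
  have vc: "?v \<beta> \<in> carrier ?S" if "\<beta> \<in> {1..d} \<rightarrow>\<^sub>E B" for \<beta>
    by (rule chi_dec_closed[OF D]) (use that b' in auto)
  have pc: "?p \<sigma> \<beta> \<in> carrier K" if "\<sigma> \<in> W d" "\<beta> \<in> {1..d} \<rightarrow>\<^sub>E B" for \<sigma> \<beta>
    by (rule K.finprod_closed[OF pairing_factor_closed[OF E \<beta>E[OF that(2)] f' W_permutes[OF that(1)]]])
  have dc: "?dec f \<in> carrier ?S" using chi_dec_closed[OF D f'] .
  \<comment> \<open>The sum over basis tuples is the expansion of f \<circ> \<sigma> in the dual
    basis, scaled by \<chi> \<sigma>. Permuting the forms produces \<chi> \<sigma> a second time, so
    every \<sigma> contributes f with coefficient 1.\<close>
  have inner: "(\<Oplus>\<^bsub>?S\<^esub>\<beta>\<in>{1..d} \<rightarrow>\<^sub>E B. (\<chi> d \<sigma> \<otimes> ?p \<sigma> \<beta>) \<odot>\<^bsub>?S\<^esub> ?v \<beta>) = \<one> \<odot>\<^bsub>?S\<^esub> ?dec f" if \<sigma>: "\<sigma> \<in> W d" for \<sigma>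
  proof -
    have f\<sigma>: "f \<circ> \<sigma> \<in> tuples ?D d" using f tuples_comp_iff[OF W_permutes[OF \<sigma>]] by blast
    have st: "\<sigma> t \<in> {1..d}" if "t \<in> {1..d}" for t using that permutes_in_image[OF W_permutes[OF \<sigma>]] by blast
    have "?dec (f \<circ> \<sigma>) = (\<Oplus>\<^bsub>?S\<^esub>\<beta>\<in>{1..d} \<rightarrow>\<^sub>E B. ?p \<sigma> \<beta> \<odot>\<^bsub>?S\<^esub> ?v \<beta>)"
    proof (rule multilinear_map_expand[OF D module_chi_sum[OF D] chi_multilinearD(1)[OF chi_dec_multilinear[OF D]] fin b' _ f\<sigma>])
      show "f (\<sigma> t) b \<in> carrier K" if "t \<in> {1..d}" "b \<in> B" for t b
        using f' st[OF that(1)] that(2) BE by (intro dual_apply_closed[OF E]) auto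
      show "(f \<circ> \<sigma>) t = (\<Oplus>\<^bsub>?D\<^esub>b\<in>B. f (\<sigma> t) b \<odot>\<^bsub>?D\<^esub> b' b)" if "t \<in> {1..d}" for t
        unfolding comp_apply by (rule exp) (use f' st[OF that] in blast)
    qed
    then have "\<chi> d \<sigma> \<odot>\<^bsub>?S\<^esub> ?dec (f \<circ> \<sigma>) = (\<Oplus>\<^bsub>?S\<^esub>\<beta>\<in>{1..d} \<rightarrow>\<^sub>E B. \<chi> d \<sigma> \<odot>\<^bsub>?S\<^esub> (?p \<sigma> \<beta> \<odot>\<^bsub>?S\<^esub> ?v \<beta>))"
      using S.finsum_smult_ldistr[OF finP chi_closed[OF \<sigma>], of "\<lambda>\<beta>. ?p \<sigma> \<beta> \<odot>\<^bsub>?S\<^esub> ?v \<beta>"] pc[OF \<sigma>] vc by simp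
    also have "\<dots> = (\<Oplus>\<^bsub>?S\<^esub>\<beta>\<in>{1..d} \<rightarrow>\<^sub>E B. (\<chi> d \<sigma> \<otimes> ?p \<sigma> \<beta>) \<odot>\<^bsub>?S\<^esub> ?v \<beta>)"
      by (rule S.M.finsum_cong'[OF refl])
        (use pc[OF \<sigma>] vc chi_closed[OF \<sigma>] in \<open>auto simp: S.smult_assoc1 simp del: atLeastAtMost_iff\<close>)
    finally show ?thesis
      using chi_dec_comp[OF D \<sigma> f] chi_square[OF \<sigma>] dc chi_closed[OF \<sigma>]
      by (simp flip: S.smult_assoc1)
  qed
  have "(\<Oplus>\<^bsub>?S\<^esub>\<beta>\<in>{1..d} \<rightarrow>\<^sub>E B. pairing d \<beta> f \<odot>\<^bsub>?S\<^esub> ?v \<beta>) =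
      (\<Oplus>\<^bsub>?S\<^esub>\<beta>\<in>{1..d} \<rightarrow>\<^sub>E B. \<Oplus>\<^bsub>?S\<^esub>\<sigma>\<in>W d. (\<chi> d \<sigma> \<otimes> ?p \<sigma> \<beta>) \<odot>\<^bsub>?S\<^esub> ?v \<beta>)"
  proof (rule S.M.finsum_cong'[OF refl])
    show "(\<lambda>\<beta>. \<Oplus>\<^bsub>?S\<^esub>\<sigma>\<in>W d. (\<chi> d \<sigma> \<otimes> ?p \<sigma> \<beta>) \<odot>\<^bsub>?S\<^esub> ?v \<beta>) \<in> ({1..d} \<rightarrow>\<^sub>E B) \<rightarrow> carrier ?S"
      by (intro Pi_I S.M.finsum_closed S.smult_closed K.m_closed chi_closed pc vc)
    show "pairing d \<beta> f \<odot>\<^bsub>?S\<^esub> ?v \<beta> = (\<Oplus>\<^bsub>?S\<^esub>\<sigma>\<in>W d. (\<chi> d \<sigma> \<otimes> ?p \<sigma> \<beta>) \<odot>\<^bsub>?S\<^esub> ?v \<beta>)"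
      if "\<beta> \<in> {1..d} \<rightarrow>\<^sub>E B" for \<beta>
      unfolding pairing_def
      by (rule S.finsum_smult_rdistr[OF finite_W _ vc[OF that]]) (intro Pi_I K.m_closed chi_closed pc that)
  qed
  also have "\<dots> = (\<Oplus>\<^bsub>?S\<^esub>\<sigma>\<in>W d. \<Oplus>\<^bsub>?S\<^esub>\<beta>\<in>{1..d} \<rightarrow>\<^sub>E B. (\<chi> d \<sigma> \<otimes> ?p \<sigma> \<beta>) \<odot>\<^bsub>?S\<^esub> ?v \<beta>)"
    by (rule S.M.finsum_swap[OF finP finite_W]) (intro S.smult_closed K.m_closed chi_closed pc vc)
  also have "\<dots> = (\<Oplus>\<^bsub>?S\<^esub>\<sigma>\<in>W d. \<one> \<odot>\<^bsub>?S\<^esub> ?dec f)"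
    by (rule S.M.finsum_cong'[OF refl]) (use inner dc in auto)
  also have "\<dots> = (\<Oplus>\<sigma>\<in>W d. \<one>) \<odot>\<^bsub>?S\<^esub> ?dec f"
    by (rule S.finsum_smult_rdistr[symmetric, OF finite_W _ dc]) auto
  finally show ?thesis .
qed

text \<open>The reconstruction identity is known for decomposable forms. It is linear in the form
  and therefore extends to the whole direct sum, with the component of degree d in place of the
  form, since d-tuples of vectors see no other degree.\<close>

lemma chi_form_nondegenerate:
  assumes E: "module K E" and fb: "finite_basis K E B" and r: "rational_ring K"
    and g: "g \<in> carrier (chi_sum K W \<chi> (dual_module K E))"
    and zero: "\<And>x. x \<in> carrier (chi_sum K W \<chi> E) \<Longrightarrow> chi_form K W \<chi> E x g = \<zero>"
  shows "g = \<zero>\<^bsub>chi_sum K W \<chi> (dual_module K E)\<^esub>"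
proof -
  let ?D = "dual_module K E"
  let ?S = "chi_sum K W \<chi> ?D" and ?dec = "chi_dec K W \<chi> ?D" and ?fo = "chi_form K W \<chi> E"
  have D: "module K ?D" by (rule module_dual[OF E])
  have SM: "module K (self_module K)" by (rule module_self_module[OF cring_K])
  interpret S: module K ?S by (rule module_chi_sum[OF D])
  obtain b' where b': "\<And>b. b \<in> B \<Longrightarrow> b' b \<in> carrier ?D"
    and exp: "\<And>u. u \<in> carrier ?D \<Longrightarrow> u = (\<Oplus>\<^bsub>?D\<^esub>b\<in>B. u b \<odot>\<^bsub>?D\<^esub> b' b)"
    using dual_basis[OF E fb] by metis
  have fin: "finite B" and BE: "B \<subseteq> carrier E" using fb by (auto simp: finite_basis_def)
  let ?w = "\<lambda>d. \<Oplus>\<sigma>\<in>W d. \<one>"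
  have wU: "?w d \<in> Units K" for d using card_unit[OF cring_K r finite_W, of d] W_id by blast
  have w: "?w d \<in> carrier K" for d using wU K.Units_closed by blast
  let ?v = "\<lambda>d \<beta>. ?dec d (\<lambda>t\<in>{1..d}. b' (\<beta> t))"
  \<comment> \<open>The reconstruction operator in degree d. Its coefficients are values of
    \<open>chi_form\<close> rather than of \<open>pairing\<close>, so that it makes sense for every
    h, decomposable or not.\<close>
  let ?\<Phi> = "\<lambda>d h. \<Oplus>\<^bsub>?S\<^esub>\<beta>\<in>{1..d} \<rightarrow>\<^sub>E B. ?fo (chi_dec K W \<chi> E d \<beta>) h \<odot>\<^bsub>?S\<^esub> ?v d \<beta>"
  let ?inc = "\<lambda>d. chi_incl K W \<chi> ?D d"
  have finP: "finite ({1..d} \<rightarrow>\<^sub>E B)" for d :: nat using fin by (simp add: finite_PiE)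
  have \<beta>E: "\<beta> \<in> {1..d} \<rightarrow> carrier E" if "\<beta> \<in> {1..d} \<rightarrow>\<^sub>E B" for d \<beta> using that BE by (auto simp: Pi_iff)
  have \<beta>c: "chi_dec K W \<chi> E d \<beta> \<in> carrier (chi_sum K W \<chi> E)" if "\<beta> \<in> {1..d} \<rightarrow>\<^sub>E B" for d \<beta>
    by (rule chi_dec_closed[OF E \<beta>E[OF that]])
  have vc: "?v d \<beta> \<in> carrier ?S" if "\<beta> \<in> {1..d} \<rightarrow>\<^sub>E B" for d \<beta>
    by (rule chi_dec_closed[OF D]) (use that b' in auto)
  have fl: "?fo (chi_dec K W \<chi> E d \<beta>) \<in> linear_maps K ?S (self_module K)" if "\<beta> \<in> {1..d} \<rightarrow>\<^sub>E B" for d \<beta>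
    using linear_closed[OF chi_form_bilinear[OF E] \<beta>c[OF that]] by simp
  have fc: "?fo (chi_dec K W \<chi> E d \<beta>) h \<in> carrier K" if "\<beta> \<in> {1..d} \<rightarrow>\<^sub>E B" "h \<in> carrier ?S" for d \<beta> h
    using linear_closed[OF fl[OF that(1)] that(2)] by simp
  have hd: "h d \<in> carrier (chi_power K W \<chi> ?D d)" if "h \<in> carrier ?S" for h d
    using that by (auto simp: chi_sum_def carrier_coprod_module)
  have incl: "(\<lambda>c\<in>carrier (chi_power K W \<chi> ?D d). ?inc d c) \<in> linear_maps K (chi_power K W \<chi> ?D d) ?S" for d
    by (rule chi_incl_linear[OF D])
  have inc_add: "?inc d (c \<oplus>\<^bsub>chi_power K W \<chi> ?D d\<^esub> c') = ?inc d c \<oplus>\<^bsub>?S\<^esub> ?inc d c'"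
    if "c \<in> carrier (chi_power K W \<chi> ?D d)" "c' \<in> carrier (chi_power K W \<chi> ?D d)" for d c c'
    using linear_add[OF incl that] that abelian_monoid.a_closed[of "chi_power K W \<chi> ?D d" c c'] module_chi_power[OF D, of d]
    by (simp add: module_def abelian_group_def)
  have inc_smult: "?inc d (k \<odot>\<^bsub>chi_power K W \<chi> ?D d\<^esub> c) = k \<odot>\<^bsub>?S\<^esub> ?inc d c"
    if "k \<in> carrier K" "c \<in> carrier (chi_power K W \<chi> ?D d)" for d k c
    using linear_smult[OF incl that] that module.smult_closed[OF module_chi_power[OF D] that] by simp
  have inc_zero: "?inc d \<zero>\<^bsub>chi_power K W \<chi> ?D d\<^esub> = \<zero>\<^bsub>?S\<^esub>" for d
    by (auto simp: chi_incl_def chi_sum_def coprod_module_def fun_eq_iff)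
  have inc_c: "?inc d c \<in> carrier ?S" if "c \<in> carrier (chi_power K W \<chi> ?D d)" for d c
    using chi_incl_closed[OF D that] .
  have key: "?\<Phi> d h = ?w d \<odot>\<^bsub>?S\<^esub> ?inc d (h d)" if "h \<in> carrier ?S" for d h
    using that
  proof (rule chi_sum_induct[OF D])
    fix e f assume f: "f \<in> tuples ?D e"
    note f' = tuples_Pi[OF E f]
    show "?\<Phi> d (?dec e f) = ?w d \<odot>\<^bsub>?S\<^esub> ?inc d (?dec e f d)"
    proof (cases "d = e")
      case True
      have "?\<Phi> d (?dec e f) = (\<Oplus>\<^bsub>?S\<^esub>\<beta>\<in>{1..d} \<rightarrow>\<^sub>E B. pairing d \<beta> f \<odot>\<^bsub>?S\<^esub> ?v d \<beta>)"
      proof (rule S.M.finsum_cong'[OF refl])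
        show "(\<lambda>\<beta>. pairing d \<beta> f \<odot>\<^bsub>?S\<^esub> ?v d \<beta>) \<in> ({1..d} \<rightarrow>\<^sub>E B) \<rightarrow> carrier ?S"
          by (rule Pi_I, rule S.smult_closed, rule pairing_closed[OF E \<beta>E]) (use f' True vc in blast)+
        show "?fo (chi_dec K W \<chi> E d \<beta>) (?dec e f) \<odot>\<^bsub>?S\<^esub> ?v d \<beta> = pairing d \<beta> f \<odot>\<^bsub>?S\<^esub> ?v d \<beta>"
          if "\<beta> \<in> {1..d} \<rightarrow>\<^sub>E B" for \<beta>
          using chi_form_dec[OF E \<beta>E[OF that] f'] True by simp
      qed
      also have "\<dots> = ?w d \<odot>\<^bsub>?S\<^esub> ?dec d f"
        by (rule sum_pairing_dual_basis[OF E fb b' exp]) (use f True in simp_all)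
      also have "?dec d f = ?inc d (?dec e f d)" using True by (simp add: chi_dec_eq chi_incl_def)
      finally show ?thesis .
    next
      case False
      have "?\<Phi> d (?dec e f) = (\<Oplus>\<^bsub>?S\<^esub>\<beta>\<in>{1..d} \<rightarrow>\<^sub>E B. \<zero>\<^bsub>?S\<^esub>)"
      proof (rule S.M.finsum_cong'[OF refl])
        show "?fo (chi_dec K W \<chi> E d \<beta>) (?dec e f) \<odot>\<^bsub>?S\<^esub> ?v d \<beta> = \<zero>\<^bsub>?S\<^esub>"
          if "\<beta> \<in> {1..d} \<rightarrow>\<^sub>E B" for \<beta>
          using chi_form_dec[OF E \<beta>E[OF that] f'] vc[OF that] False by simp
      qed auto
      moreover have "?dec e f d = \<zero>\<^bsub>chi_power K W \<chi> ?D d\<^esub>" using False by (simp add: chi_dec_eq chi_incl_def)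
      ultimately show ?thesis using w by (simp add: inc_zero)
    qed
  next
    have "?\<Phi> d \<zero>\<^bsub>?S\<^esub> = (\<Oplus>\<^bsub>?S\<^esub>\<beta>\<in>{1..d} \<rightarrow>\<^sub>E B. \<zero>\<^bsub>?S\<^esub>)"
    proof (rule S.M.finsum_cong'[OF refl])
      show "?fo (chi_dec K W \<chi> E d \<beta>) \<zero>\<^bsub>?S\<^esub> \<odot>\<^bsub>?S\<^esub> ?v d \<beta> = \<zero>\<^bsub>?S\<^esub>"
        if "\<beta> \<in> {1..d} \<rightarrow>\<^sub>E B" for \<beta>
        using linear_zero[OF module_chi_sum[OF D] SM fl[OF that]] vc[OF that] by simp
    qed auto
    moreover have "\<zero>\<^bsub>?S\<^esub> d = \<zero>\<^bsub>chi_power K W \<chi> ?D d\<^esub>" by (simp add: chi_sum_def coprod_module_apply)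
    ultimately show "?\<Phi> d \<zero>\<^bsub>?S\<^esub> = ?w d \<odot>\<^bsub>?S\<^esub> ?inc d (\<zero>\<^bsub>?S\<^esub> d)" using w by (simp add: inc_zero)
  next
    fix h h' assume h: "h \<in> carrier ?S" "h' \<in> carrier ?S"
      and eq: "?\<Phi> d h = ?w d \<odot>\<^bsub>?S\<^esub> ?inc d (h d)" "?\<Phi> d h' = ?w d \<odot>\<^bsub>?S\<^esub> ?inc d (h' d)"
    have "?\<Phi> d (h \<oplus>\<^bsub>?S\<^esub> h') = (\<Oplus>\<^bsub>?S\<^esub>\<beta>\<in>{1..d} \<rightarrow>\<^sub>E B. ?fo (chi_dec K W \<chi> E d \<beta>) h \<odot>\<^bsub>?S\<^esub> ?v d \<beta> \<oplus>\<^bsub>?S\<^esub>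
        ?fo (chi_dec K W \<chi> E d \<beta>) h' \<odot>\<^bsub>?S\<^esub> ?v d \<beta>)"
    proof (rule S.M.finsum_cong'[OF refl])
      show "?fo (chi_dec K W \<chi> E d \<beta>) (h \<oplus>\<^bsub>?S\<^esub> h') \<odot>\<^bsub>?S\<^esub> ?v d \<beta> = ?fo (chi_dec K W \<chi> E d \<beta>) h \<odot>\<^bsub>?S\<^esub> ?v d \<beta> \<oplus>\<^bsub>?S\<^esub>
        ?fo (chi_dec K W \<chi> E d \<beta>) h' \<odot>\<^bsub>?S\<^esub> ?v d \<beta>" if "\<beta> \<in> {1..d} \<rightarrow>\<^sub>E B" for \<beta>
        using linear_add[OF fl[OF that] h] S.smult_l_distr[OF fc[OF that h(1)] fc[OF that h(2)] vc[OF that]] by simp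
    qed (intro Pi_I S.M.a_closed S.smult_closed fc vc h)
    also have "\<dots> = ?\<Phi> d h \<oplus>\<^bsub>?S\<^esub> ?\<Phi> d h'"
      by (rule S.M.finsum_addf) (use S.smult_closed[OF fc[OF _ h(1)] vc] S.smult_closed[OF fc[OF _ h(2)] vc] in blast)+
    also have "\<dots> = ?w d \<odot>\<^bsub>?S\<^esub> (?inc d (h d) \<oplus>\<^bsub>?S\<^esub> ?inc d (h' d))"
      unfolding eq by (rule S.smult_r_distr[symmetric]) (intro w inc_c hd h)+
    also have "?inc d (h d) \<oplus>\<^bsub>?S\<^esub> ?inc d (h' d) = ?inc d ((h \<oplus>\<^bsub>?S\<^esub> h') d)"
      using inc_add[OF hd[OF h(1)] hd[OF h(2)]] by (simp add: chi_sum_def coprod_module_apply)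
    finally show "?\<Phi> d (h \<oplus>\<^bsub>?S\<^esub> h') = ?w d \<odot>\<^bsub>?S\<^esub> ?inc d ((h \<oplus>\<^bsub>?S\<^esub> h') d)" .
  next
    fix k h assume k: "k \<in> carrier K" and h: "h \<in> carrier ?S" and eq: "?\<Phi> d h = ?w d \<odot>\<^bsub>?S\<^esub> ?inc d (h d)"
    have "?\<Phi> d (k \<odot>\<^bsub>?S\<^esub> h) = (\<Oplus>\<^bsub>?S\<^esub>\<beta>\<in>{1..d} \<rightarrow>\<^sub>E B. k \<odot>\<^bsub>?S\<^esub> (?fo (chi_dec K W \<chi> E d \<beta>) h \<odot>\<^bsub>?S\<^esub> ?v d \<beta>))"
    proof (rule S.M.finsum_cong'[OF refl])
      show "?fo (chi_dec K W \<chi> E d \<beta>) (k \<odot>\<^bsub>?S\<^esub> h) \<odot>\<^bsub>?S\<^esub> ?v d \<beta> = k \<odot>\<^bsub>?S\<^esub> (?fo (chi_dec K W \<chi> E d \<beta>) h \<odot>\<^bsub>?S\<^esub> ?v d \<beta>)"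
        if "\<beta> \<in> {1..d} \<rightarrow>\<^sub>E B" for \<beta>
        using linear_smult[OF fl[OF that] k h] S.smult_assoc1[OF k fc[OF that h] vc[OF that]] by simp
    qed (intro Pi_I S.smult_closed fc vc h k)
    also have "\<dots> = k \<odot>\<^bsub>?S\<^esub> ?\<Phi> d h"
      by (rule S.finsum_smult_ldistr[symmetric, OF finP k]) (intro Pi_I S.smult_closed fc vc h)
    also have "\<dots> = ?w d \<odot>\<^bsub>?S\<^esub> (k \<odot>\<^bsub>?S\<^esub> ?inc d (h d))"
      unfolding eq using k w[of d] inc_c[OF hd[OF h]] by (simp flip: S.smult_assoc1 add: K.m_comm)
    also have "k \<odot>\<^bsub>?S\<^esub> ?inc d (h d) = ?inc d ((k \<odot>\<^bsub>?S\<^esub> h) d)"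
      using inc_smult[OF k hd[OF h]] by (simp add: chi_sum_def coprod_module_apply)
    finally show "?\<Phi> d (k \<odot>\<^bsub>?S\<^esub> h) = ?w d \<odot>\<^bsub>?S\<^esub> ?inc d ((k \<odot>\<^bsub>?S\<^esub> h) d)" .
  qed
  have "g d = \<zero>\<^bsub>chi_power K W \<chi> ?D d\<^esub>" for d
  proof -
    have "?\<Phi> d g = (\<Oplus>\<^bsub>?S\<^esub>\<beta>\<in>{1..d} \<rightarrow>\<^sub>E B. \<zero>\<^bsub>?S\<^esub>)"
      by (rule S.M.finsum_cong'[OF refl]) (use zero[OF \<beta>c] vc in \<open>auto simp del: atLeastAtMost_iff\<close>)
    then have "?w d \<odot>\<^bsub>?S\<^esub> ?inc d (g d) = \<zero>\<^bsub>?S\<^esub>" using key[OF g, of d] by simp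
    then have "inv (?w d) \<odot>\<^bsub>?S\<^esub> (?w d \<odot>\<^bsub>?S\<^esub> ?inc d (g d)) = \<zero>\<^bsub>?S\<^esub>" using wU by simp
    then have "?inc d (g d) = \<zero>\<^bsub>?S\<^esub>"
      using wU[of d] w[of d] inc_c[OF hd[OF g]] by (simp flip: S.smult_assoc1)
    from fun_cong[OF this, of d] show ?thesis by (simp add: chi_incl_def chi_sum_def coprod_module_apply)
  qed
  then show ?thesis
    unfolding chi_sum_def
    by (intro coprod_eqI[OF cring_K module_chi_power[OF D]])
      (use g S.M.zero_closed in \<open>simp_all add: chi_sum_def coprod_module_apply\<close>)
qed

end

section \<open>Cosets and the Laplace expansion\<close>

text \<open>With \<alpha> in W d and \<beta> in W q this is the general element of the subgroup
  modulo which the minimal representatives are taken.\<close>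

definition block :: "nat \<Rightarrow> (nat \<Rightarrow> nat) \<Rightarrow> (nat \<Rightarrow> nat) \<Rightarrow> nat \<Rightarrow> nat"
  where "block d \<alpha> \<beta> = \<alpha> \<circ> (\<omega> ^^ d) \<beta>"

lemma block_apply:
  assumes "\<alpha> permutes {1..d}" "\<beta> permutes {1..q}"
  shows "block d \<alpha> \<beta> t = (if t \<le> d then \<alpha> t else \<beta> (t - d) + d)"
  using permutes_interval_0[OF assms(2)] permutes_interval_pos[OF assms(2), of "t - d"]
  by (auto simp: block_def omega_funpow intro!: permutes_not_in[OF assms(1)])

lemma permutes_le: "\<alpha> permutes {1..d::nat} \<Longrightarrow> t \<le> d \<Longrightarrow> \<alpha> t \<le> d"
  using permutes_in_image[of \<alpha> "{1..d}" t] permutes_interval_0[of \<alpha> d] by (cases "t = 0") auto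

lemma block_comp:
  assumes "\<alpha> permutes {1..d}" "\<beta> permutes {1..q}" "\<alpha>' permutes {1..d}" "\<beta>' permutes {1..q}"
  shows "block d \<alpha> \<beta> \<circ> block d \<alpha>' \<beta>' = block d (\<alpha> \<circ> \<alpha>') (\<beta> \<circ> \<beta>')"
proof
  fix t
  show "(block d \<alpha> \<beta> \<circ> block d \<alpha>' \<beta>') t = block d (\<alpha> \<circ> \<alpha>') (\<beta> \<circ> \<beta>') t"
    using permutes_le[OF assms(3), of t] permutes_interval_pos[OF assms(4), of "t - d"]
    unfolding block_apply[OF permutes_compose[OF assms(3,1)] permutes_compose[OF assms(4,2)]] comp_apply
      block_apply[OF assms(1,2)] block_apply[OF assms(3,4)] by auto
qed

lemma word_inj:
  assumes "\<rho> permutes {1..n}" "\<tau> permutes {1..n}" "word n \<rho> = word n \<tau>"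
  shows "\<rho> = \<tau>"
proof
  fix t
  show "\<rho> t = \<tau> t"
  proof (cases "t \<in> {1..n}")
    case True
    then have "t \<in> set [1..<Suc n]" by auto
    then show ?thesis using assms(3) unfolding word_def by (metis map_eq_conv)
  next
    case False
    then show ?thesis using permutes_not_in assms(1,2) by metis
  qed
qed

lemma lex_less_than_asym: "(u, v) \<in> lex less_than \<Longrightarrow> (v, u) \<notin> lex less_than"
  using wf_not_sym[OF wf_lex[OF wf_less_than]] by blast

text \<open>\<open>lex\<close> relates only lists of equal length, hence the length hypothesis;
  totality is borrowed from \<open>lenlex\<close>, which coincides with it on such lists.\<close>

lemma lex_less_than_total:
  assumes "length u = length v" "u \<noteq> v"
  shows "(u, v) \<in> lex less_than \<or> (v, u) \<in> lex less_than"
proof -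
  have "total (lenlex less_than)" by (rule total_lenlex) simp
  then have "(u, v) \<in> lenlex less_than \<or> (v, u) \<in> lenlex less_than"
    using assms(2) by (auto simp: total_on_def)
  then show ?thesis using assms(1) by (auto simp: lenlex_conv)
qed

context character_sequence
begin

lemma block_W: "\<alpha> \<in> W d \<Longrightarrow> \<beta> \<in> W q \<Longrightarrow> block d \<alpha> \<beta> \<in> W (d + q)"
  unfolding block_def by (rule W_comp[OF W_le W_shift]) auto

lemma chi_block: "\<alpha> \<in> W d \<Longrightarrow> \<beta> \<in> W q \<Longrightarrow> \<chi> (d + q) (block d \<alpha> \<beta>) = \<chi> d \<alpha> \<otimes> \<chi> q \<beta>"
  unfolding block_def
  using chi_comp[OF W_le[of d "d + q" \<alpha>] W_shift[of \<beta> q d]] chi_le[of d "d + q" \<alpha>] chi_shift[of \<beta> q d] by simp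

text \<open>The coset is given through an arbitrary representative \<sigma>, and \<rho> is its
  member with the least word; resolving the coset notation into blocks makes all members
  explicit.\<close>

lemma min_reps_iff:
  "\<rho> \<in> min_reps W n d q \<longleftrightarrow> (\<exists>\<sigma>\<in>W n. \<exists>\<alpha>\<in>W d. \<exists>\<beta>\<in>W q. \<rho> = \<sigma> \<circ> block d \<alpha> \<beta> \<and>
    (\<forall>\<alpha>'\<in>W d. \<forall>\<beta>'\<in>W q. \<sigma> \<circ> block d \<alpha>' \<beta>' = \<rho> \<or> (word n \<rho>, word n (\<sigma> \<circ> block d \<alpha>' \<beta>')) \<in> lex less_than))"
proof -
  have X: "W d <#>\<^bsub>sym_group n\<^esub> (\<omega> ^^ d) ` W q = (\<lambda>p. block d (fst p) (snd p)) ` (W d \<times> W q)"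
    by (force simp: set_mult_def sym_group_def block_def)
  have C: "lcosets\<^bsub>(sym_group n)\<lparr>carrier := W n\<rparr>\<^esub> Y = (\<lambda>\<sigma>. (\<circ>) \<sigma> ` Y) ` W n" for Y
    by (auto simp: LCOSETS_def l_coset_def sym_group_def)
  show ?thesis
    unfolding min_reps_def X C
    by (simp add: image_image image_iff)
qed

lemma block_W_group:
  assumes "\<alpha> \<in> W d" "\<beta> \<in> W q" "\<alpha>' \<in> W d" "\<beta>' \<in> W q"
  shows "block d \<alpha> \<beta> \<circ> block d \<alpha>' \<beta>' = block d (\<alpha> \<circ> \<alpha>') (\<beta> \<circ> \<beta>')"
  using assms by (intro block_comp W_permutes)

lemma block_inv:
  assumes \<alpha>: "\<alpha> \<in> W d" and \<beta>: "\<beta> \<in> W q"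
  shows "block d \<alpha> \<beta> \<circ> block d (inv' \<alpha>) (inv' \<beta>) = id"
proof -
  have "(\<omega> ^^ d) id = id" by (auto simp: omega_funpow)
  then show ?thesis
    using block_W_group[OF \<alpha> \<beta> W_inv[OF \<alpha>] W_inv[OF \<beta>]]
    by (simp add: permutes_inv_o[OF W_permutes[OF \<alpha>]] permutes_inv_o[OF W_permutes[OF \<beta>]] block_def)
qed

text \<open>A minimal representative represents its own coset, so \<sigma> can be eliminated and the
  comparison runs over the products of \<rho> itself with blocks.\<close>

lemma min_repsE:
  assumes "\<rho> \<in> min_reps W (d + q) d q"
  shows "\<rho> \<in> W (d + q)"
    and "\<alpha> \<in> W d \<Longrightarrow> \<beta> \<in> W q \<Longrightarrow> \<rho> \<circ> block d \<alpha> \<beta> = \<rho> \<or>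
      (word (d + q) \<rho>, word (d + q) (\<rho> \<circ> block d \<alpha> \<beta>)) \<in> lex less_than"
proof -
  obtain \<sigma> \<alpha>0 \<beta>0 where *: "\<sigma> \<in> W (d + q)" "\<alpha>0 \<in> W d" "\<beta>0 \<in> W q" "\<rho> = \<sigma> \<circ> block d \<alpha>0 \<beta>0"
    and min: "\<And>\<alpha>' \<beta>'. \<alpha>' \<in> W d \<Longrightarrow> \<beta>' \<in> W q \<Longrightarrow> \<sigma> \<circ> block d \<alpha>' \<beta>' = \<rho> \<or>
      (word (d + q) \<rho>, word (d + q) (\<sigma> \<circ> block d \<alpha>' \<beta>')) \<in> lex less_than"
    using assms unfolding min_reps_iff by blast
  show "\<rho> \<in> W (d + q)" unfolding *(4) by (intro W_comp *(1) block_W *(2,3))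
  show "\<rho> \<circ> block d \<alpha> \<beta> = \<rho> \<or> (word (d + q) \<rho>, word (d + q) (\<rho> \<circ> block d \<alpha> \<beta>)) \<in> lex less_than"
    if "\<alpha> \<in> W d" "\<beta> \<in> W q"
  proof -
    have "\<rho> \<circ> block d \<alpha> \<beta> = \<sigma> \<circ> block d (\<alpha>0 \<circ> \<alpha>) (\<beta>0 \<circ> \<beta>)"
      unfolding *(4) comp_assoc block_W_group[OF *(2,3) that] ..
    then show ?thesis using min[OF W_comp[OF *(2) that(1)] W_comp[OF *(3) that(2)]] by simp
  qed
qed

text \<open>Every coset has exactly one member with least word: well-foundedness and totality of the
  order on words give one, asymmetry excludes a second. Once the representative is fixed, the block
  is found by cancellation, and its components are read off from its values up to d and beyond
  d.\<close>

lemma W_decomposition: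
  "bij_betw (\<lambda>(\<rho>, \<alpha>, \<beta>). \<rho> \<circ> block d \<alpha> \<beta>) (min_reps W (d + q) d q \<times> W d \<times> W q) (W (d + q))"
  unfolding bij_betw_def
proof (intro conjI inj_onI equalityI subsetI)
  fix p p' assume p: "p \<in> min_reps W (d + q) d q \<times> W d \<times> W q" and p': "p' \<in> min_reps W (d + q) d q \<times> W d \<times> W q"
    and eq: "(case p of (\<rho>, \<alpha>, \<beta>) \<Rightarrow> \<rho> \<circ> block d \<alpha> \<beta>) = (case p' of (\<rho>, \<alpha>, \<beta>) \<Rightarrow> \<rho> \<circ> block d \<alpha> \<beta>)"
  obtain \<rho> \<alpha> \<beta> where p_eq: "p = (\<rho>, \<alpha>, \<beta>)" and \<rho>: "\<rho> \<in> min_reps W (d + q) d q" and \<alpha>: "\<alpha> \<in> W d" and \<beta>: "\<beta> \<in> W q"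
    using p by auto
  obtain \<rho>' \<alpha>' \<beta>' where p'_eq: "p' = (\<rho>', \<alpha>', \<beta>')" and \<rho>': "\<rho>' \<in> min_reps W (d + q) d q"
    and \<alpha>': "\<alpha>' \<in> W d" and \<beta>': "\<beta>' \<in> W q"
    using p' by auto
  have e: "\<rho> \<circ> block d \<alpha> \<beta> = \<rho>' \<circ> block d \<alpha>' \<beta>'" using eq p_eq p'_eq by simp
  \<comment> \<open>Stated for arbitrary data so that it applies in both directions: each
    representative is the other times a block, so minimality of either one compares the two
    words.\<close>
  have 1: "\<rho>' = \<rho> \<circ> block d (\<alpha> \<circ> inv' \<alpha>') (\<beta> \<circ> inv' \<beta>')"
    if "\<rho> \<circ> block d \<alpha> \<beta> = \<rho>' \<circ> block d \<alpha>' \<beta>'" "\<alpha> \<in> W d" "\<beta> \<in> W q" "\<alpha>' \<in> W d" "\<beta>' \<in> W q" for \<rho> \<rho>' \<alpha> \<beta> \<alpha>' \<beta>'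
  proof -
    have "\<rho>' = \<rho>' \<circ> (block d \<alpha>' \<beta>' \<circ> block d (inv' \<alpha>') (inv' \<beta>'))" using block_inv[OF that(4,5)] by simp
    also have "\<dots> = \<rho> \<circ> (block d \<alpha> \<beta> \<circ> block d (inv' \<alpha>') (inv' \<beta>'))" using that(1) by (metis comp_assoc)
    finally show ?thesis using block_W_group[OF that(2,3) W_inv[OF that(4)] W_inv[OF that(5)]] by simp
  qed
  have "\<rho>' = \<rho> \<or> (word (d + q) \<rho>, word (d + q) \<rho>') \<in> lex less_than"
    using 1[OF e \<alpha> \<beta> \<alpha>' \<beta>'] min_repsE(2)[OF \<rho>, of "\<alpha> \<circ> inv' \<alpha>'" "\<beta> \<circ> inv' \<beta>'"] \<alpha> \<alpha>' \<beta> \<beta>'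
    by (metis W_comp W_inv)
  moreover have "\<rho> = \<rho>' \<or> (word (d + q) \<rho>', word (d + q) \<rho>) \<in> lex less_than"
    using 1[OF e[symmetric] \<alpha>' \<beta>' \<alpha> \<beta>] min_repsE(2)[OF \<rho>', of "\<alpha>' \<circ> inv' \<alpha>" "\<beta>' \<circ> inv' \<beta>"] \<alpha> \<alpha>' \<beta> \<beta>'
    by (metis W_comp W_inv)
  ultimately have \<rho>\<rho>': "\<rho> = \<rho>'" using lex_less_than_asym by blast
  have inj: "inj \<rho>" using permutes_inj[OF W_permutes[OF min_repsE(1)[OF \<rho>]]] .
  have b: "block d \<alpha> \<beta> t = block d \<alpha>' \<beta>' t" for t
    using fun_cong[OF e, of t] \<rho>\<rho>' inj by (simp add: inj_eq)
  note ba = block_apply[OF W_permutes[OF \<alpha>] W_permutes[OF \<beta>]] block_apply[OF W_permutes[OF \<alpha>'] W_permutes[OF \<beta>']]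
  have "\<alpha> = \<alpha>'"
  proof
    fix t show "\<alpha> t = \<alpha>' t"
      using b[of t] permutes_not_in[OF W_permutes[OF \<alpha>], of t] permutes_not_in[OF W_permutes[OF \<alpha>'], of t]
      by (cases "t \<le> d") (auto simp: ba)
  qed
  moreover have "\<beta> = \<beta>'"
  proof
    fix t show "\<beta> t = \<beta>' t"
      using b[of "t + d"] permutes_interval_0[OF W_permutes[OF \<beta>]] permutes_interval_0[OF W_permutes[OF \<beta>']]
      by (cases "t = 0") (auto simp: ba)
  qed
  ultimately show "p = p'" using p_eq p'_eq \<rho>\<rho>' by simp
next
  fix \<sigma> assume "\<sigma> \<in> (\<lambda>(\<rho>, \<alpha>, \<beta>). \<rho> \<circ> block d \<alpha> \<beta>) ` (min_reps W (d + q) d q \<times> W d \<times> W q)"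
  then show "\<sigma> \<in> W (d + q)" using W_comp min_repsE(1) block_W by auto
next
  fix \<sigma> assume \<sigma>: "\<sigma> \<in> W (d + q)"
  define C where "C = {\<sigma> \<circ> block d \<alpha> \<beta> | \<alpha> \<beta>. \<alpha> \<in> W d \<and> \<beta> \<in> W q}"
  have CW: "\<tau> permutes {1..d + q}" if "\<tau> \<in> C" for \<tau>
    using that W_permutes[OF W_comp[OF \<sigma> block_W]] by (auto simp: C_def)
  have ne: "\<sigma> \<circ> block d id id \<in> C" using W_id unfolding C_def by blast
  \<comment> \<open>Well-foundedness only gives an element with no smaller word in C. That it is
    smaller than all others follows from totality, as all words have length d + q and determine
    their permutations.\<close>
  obtain \<rho> where \<rho>: "\<rho> \<in> C"
    and min: "\<And>\<tau>. (\<tau>, \<rho>) \<in> inv_image (lex less_than) (word (d + q)) \<Longrightarrow> \<tau> \<notin> C"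
    by (rule wfE_min[OF wf_inv_image[OF wf_lex[OF wf_less_than]] ne]) blast
  obtain \<alpha> \<beta> where \<alpha>: "\<alpha> \<in> W d" and \<beta>: "\<beta> \<in> W q" and \<rho>eq: "\<rho> = \<sigma> \<circ> block d \<alpha> \<beta>"
    using \<rho> unfolding C_def by blast
  have "\<tau> = \<rho> \<or> (word (d + q) \<rho>, word (d + q) \<tau>) \<in> lex less_than" if \<tau>: "\<tau> \<in> C" for \<tau>
  proof (cases "word (d + q) \<rho> = word (d + q) \<tau>")
    case True
    from word_inj[OF CW[OF \<rho>] CW[OF \<tau>] this] show ?thesis by simp
  next
    case False
    have "length (word (d + q) \<rho>) = length (word (d + q) \<tau>)" by (simp add: word_def)
    then have "(word (d + q) \<rho>, word (d + q) \<tau>) \<in> lex less_than \<or> (word (d + q) \<tau>, word (d + q) \<rho>) \<in> lex less_than"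
      using False by (rule lex_less_than_total)
    moreover have "(word (d + q) \<tau>, word (d + q) \<rho>) \<notin> lex less_than" using min[of \<tau>] \<tau> by auto
    ultimately show ?thesis by blast
  qed
  then have "\<sigma> \<circ> block d \<alpha>' \<beta>' = \<rho> \<or> (word (d + q) \<rho>, word (d + q) (\<sigma> \<circ> block d \<alpha>' \<beta>')) \<in> lex less_than"
    if "\<alpha>' \<in> W d" "\<beta>' \<in> W q" for \<alpha>' \<beta>'
    using that unfolding C_def by blast
  then have "\<rho> \<in> min_reps W (d + q) d q"
    unfolding min_reps_iff by (intro bexI[OF _ \<sigma>] bexI[OF _ \<alpha>] bexI[OF _ \<beta>] conjI ballI \<rho>eq)
  moreover have "\<sigma> = \<rho> \<circ> block d (inv' \<alpha>) (inv' \<beta>)"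
    unfolding \<rho>eq comp_assoc block_inv[OF \<alpha> \<beta>] by simp
  ultimately show "\<sigma> \<in> (\<lambda>(\<rho>, \<alpha>, \<beta>). \<rho> \<circ> block d \<alpha> \<beta>) ` (min_reps W (d + q) d q \<times> W d \<times> W q)"
    using W_inv[OF \<alpha>] W_inv[OF \<beta>] by force
qed

lemma finite_min_reps: "finite (min_reps W (d + q) d q)"
  by (rule finite_subset[OF _ finite_W]) (use min_repsE(1) in blast)

lemma pairing_laplace:
  assumes E: "module K E" and y: "y \<in> {1..d} \<rightarrow> carrier E" and a: "a \<in> {1..q} \<rightarrow> carrier E"
    and f: "f \<in> {1..d + q} \<rightarrow> carrier (dual_module K E)"
  shows "pairing (d + q) (\<lambda>t. if t \<le> d then y t else a (t - d)) f =
    (\<Oplus>\<rho>\<in>min_reps W (d + q) d q. (\<chi> (d + q) \<rho> \<otimes> pairing q a (\<lambda>j. f (\<rho> (d + j)))) \<otimes>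
      pairing d y (\<lambda>i. f (\<rho> i)))"
proof -
  let ?M = "min_reps W (d + q) d q" and ?x = "\<lambda>t. if t \<le> d then y t else a (t - d)"
  let ?T = "\<lambda>\<sigma>. \<chi> (d + q) \<sigma> \<otimes> (\<Otimes>s\<in>{1..d + q}. f (\<sigma> s) (?x s))"
  let ?A = "\<lambda>\<rho> \<alpha>. \<chi> d \<alpha> \<otimes> (\<Otimes>s\<in>{1..d}. f (\<rho> (\<alpha> s)) (y s))"
  let ?B = "\<lambda>\<rho> \<beta>. \<chi> q \<beta> \<otimes> (\<Otimes>j\<in>{1..q}. f (\<rho> (d + \<beta> j)) (a j))"
  have x: "?x \<in> {1..d + q} \<rightarrow> carrier E"
  proof
    fix t assume t: "t \<in> {1..d + q}"
    show "?x t \<in> carrier E"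
    proof (cases "t \<le> d")
      case True
      then show ?thesis using t y by auto
    next
      case False
      then have "t - d \<in> {1..q}" using t by auto
      then show ?thesis using False a by auto
    qed
  qed
  have \<rho>n: "\<rho> s \<in> {1..d + q}" if "\<rho> \<in> ?M" "s \<in> {1..d + q}" for \<rho> s
    using that permutes_in_image[OF W_permutes[OF min_repsE(1)]] by blast
  have f1: "(\<lambda>i. f (\<rho> i)) \<in> {1..d} \<rightarrow> carrier (dual_module K E)" if \<rho>: "\<rho> \<in> ?M" for \<rho>
    by (rule Pi_I, rule funcset_mem[OF f], rule \<rho>n[OF \<rho>]) auto
  have f2: "(\<lambda>j. f (\<rho> (d + j))) \<in> {1..q} \<rightarrow> carrier (dual_module K E)" if \<rho>: "\<rho> \<in> ?M" for \<rho>
    by (rule Pi_I, rule funcset_mem[OF f], rule \<rho>n[OF \<rho>]) auto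
  have Ac: "?A \<rho> \<alpha> \<in> carrier K" if "\<rho> \<in> ?M" "\<alpha> \<in> W d" for \<rho> \<alpha>
    by (rule pairing_term_closed[OF E y f1[OF that(1)] that(2)])
  have Bc: "?B \<rho> \<beta> \<in> carrier K" if "\<rho> \<in> ?M" "\<beta> \<in> W q" for \<rho> \<beta>
    by (rule pairing_term_closed[OF E a f2[OF that(1)] that(2)])
  have \<chi>c: "\<chi> (d + q) \<rho> \<in> carrier K" if "\<rho> \<in> ?M" for \<rho> using chi_closed[OF min_repsE(1)[OF that]] .
  \<comment> \<open>The first d slots meet the vectors y and only \<alpha>, the last q slots the
    vectors a and only \<beta>, so the product over all slots splits at d.\<close>
  have T: "?T (\<rho> \<circ> block d \<alpha> \<beta>) = \<chi> (d + q) \<rho> \<otimes> ?B \<rho> \<beta> \<otimes> ?A \<rho> \<alpha>"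
    if \<rho>: "\<rho> \<in> ?M" and \<alpha>: "\<alpha> \<in> W d" and \<beta>: "\<beta> \<in> W q" for \<rho> \<alpha> \<beta>
  proof -
    let ?\<sigma> = "\<rho> \<circ> block d \<alpha> \<beta>"
    let ?g = "\<lambda>s. f (?\<sigma> s) (?x s)"
    have \<sigma>: "?\<sigma> \<in> W (d + q)" by (rule W_comp[OF min_repsE(1)[OF \<rho>] block_W[OF \<alpha> \<beta>]])
    note gc = pairing_factor_closed[OF E x f W_permutes[OF \<sigma>]]
    note ba = block_apply[OF W_permutes[OF \<alpha>] W_permutes[OF \<beta>]]
    note A1 = pairing_factor_closed[OF E y f1[OF \<rho>] W_permutes[OF \<alpha>]]
    note B1 = pairing_factor_closed[OF E a f2[OF \<rho>] W_permutes[OF \<beta>]]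
    have "{1..d + q} = {1..d} \<union> (\<lambda>j. d + j) ` {1..q}" by (auto simp: image_iff)
    then have "(\<Otimes>s\<in>{1..d + q}. ?g s) = (\<Otimes>s\<in>{1..d} \<union> (\<lambda>j. d + j) ` {1..q}. ?g s)" by (rule arg_cong)
    also have "\<dots> = (\<Otimes>s\<in>{1..d}. ?g s) \<otimes> (\<Otimes>s\<in>(\<lambda>j. d + j) ` {1..q}. ?g s)"
      by (rule K.finprod_Un_disjoint) (use gc in auto)
    also have "(\<Otimes>s\<in>{1..d}. ?g s) = (\<Otimes>s\<in>{1..d}. f (\<rho> (\<alpha> s)) (y s))"
      by (rule K.finprod_cong'[OF refl A1]) (simp add: ba)
    also have "(\<Otimes>s\<in>(\<lambda>j. d + j) ` {1..q}. ?g s) = (\<Otimes>j\<in>{1..q}. ?g (d + j))"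
      by (rule K.finprod_reindex) (use gc in auto)
    also have "\<dots> = (\<Otimes>j\<in>{1..q}. f (\<rho> (d + \<beta> j)) (a j))"
      by (rule K.finprod_cong'[OF refl B1]) (simp add: ba add.commute)
    finally have "(\<Otimes>s\<in>{1..d + q}. ?g s) = (\<Otimes>s\<in>{1..d}. f (\<rho> (\<alpha> s)) (y s)) \<otimes> (\<Otimes>j\<in>{1..q}. f (\<rho> (d + \<beta> j)) (a j))" .
    moreover have "\<chi> (d + q) ?\<sigma> = \<chi> (d + q) \<rho> \<otimes> (\<chi> d \<alpha> \<otimes> \<chi> q \<beta>)"
      using chi_comp[OF min_repsE(1)[OF \<rho>] block_W[OF \<alpha> \<beta>]] chi_block[OF \<alpha> \<beta>] by simp
    ultimately show ?thesis
      using \<chi>c[OF \<rho>] chi_closed[OF \<alpha>] chi_closed[OF \<beta>] K.finprod_closed[OF A1] K.finprod_closed[OF B1]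
      by (simp add: K.m_ac)
  qed
  let ?\<phi> = "\<lambda>(\<rho>, \<alpha>, \<beta>). \<rho> \<circ> block d \<alpha> \<beta>"
  let ?P = "?M \<times> W d \<times> W q"
  have bij: "?\<phi> ` ?P = W (d + q)" "inj_on ?\<phi> ?P" using W_decomposition[of d q] by (auto simp: bij_betw_def)
  have Tc: "?T \<sigma> \<in> carrier K" if "\<sigma> \<in> W (d + q)" for \<sigma> by (rule pairing_term_closed[OF E x f that])
  let ?R = "\<lambda>\<rho> \<alpha> \<beta>. \<chi> (d + q) \<rho> \<otimes> ?B \<rho> \<beta> \<otimes> ?A \<rho> \<alpha>"
  have Rc: "?R \<rho> \<alpha> \<beta> \<in> carrier K" if "\<rho> \<in> ?M" "\<alpha> \<in> W d" "\<beta> \<in> W q" for \<rho> \<alpha> \<beta>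
    by (intro K.m_closed[OF K.m_closed[OF \<chi>c[OF that(1)] Bc[OF that(1,3)]] Ac[OF that(1,2)]])
  have "pairing (d + q) ?x f = (\<Oplus>\<sigma>\<in>?\<phi> ` ?P. ?T \<sigma>)" unfolding pairing_def bij ..
  also have "\<dots> = (\<Oplus>p\<in>?P. ?T (?\<phi> p))"
    by (rule K.finsum_reindex[OF _ bij(2)]) (use Tc bij(1) in blast)
  also have "\<dots> = (\<Oplus>p\<in>?P. ?R (fst p) (fst (snd p)) (snd (snd p)))"
  proof (rule K.finsum_cong'[OF refl])
    fix p assume "p \<in> ?P"
    then obtain \<rho> \<alpha> \<beta> where "p = (\<rho>, \<alpha>, \<beta>)" "\<rho> \<in> ?M" "\<alpha> \<in> W d" "\<beta> \<in> W q" by auto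
    then show "?T (?\<phi> p) = ?R (fst p) (fst (snd p)) (snd (snd p))" using T[of \<rho> \<alpha> \<beta>] by simp
  qed (use Rc in auto)
  also have "\<dots> = (\<Oplus>\<rho>\<in>?M. \<Oplus>z\<in>W d \<times> W q. ?R \<rho> (fst z) (snd z))"
    by (rule K.finsum_Sigma[symmetric, OF finite_min_reps finite_cartesian_product[OF finite_W finite_W]]) (use Rc in auto)
  \<comment> \<open>For fixed \<rho> the double sum over \<alpha> and \<beta> separates by
    distributivity into the two smaller pairings.\<close>
  also have "\<dots> = (\<Oplus>\<rho>\<in>?M. (\<chi> (d + q) \<rho> \<otimes> pairing q a (\<lambda>j. f (\<rho> (d + j)))) \<otimes> pairing d y (\<lambda>i. f (\<rho> i)))"
  proof (rule K.finsum_cong'[OF refl])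
    show "(\<lambda>\<rho>. (\<chi> (d + q) \<rho> \<otimes> pairing q a (\<lambda>j. f (\<rho> (d + j)))) \<otimes> pairing d y (\<lambda>i. f (\<rho> i))) \<in> ?M \<rightarrow> carrier K"
      by (intro Pi_I K.m_closed \<chi>c pairing_closed[OF E a f2] pairing_closed[OF E y f1])
    fix \<rho> assume \<rho>: "\<rho> \<in> ?M"
    let ?k = "\<chi> (d + q) \<rho>"
    have "(\<Oplus>z\<in>W d \<times> W q. ?R \<rho> (fst z) (snd z)) = (\<Oplus>\<alpha>\<in>W d. \<Oplus>\<beta>\<in>W q. ?R \<rho> \<alpha> \<beta>)"
      by (rule K.finsum_Sigma[symmetric, OF finite_W finite_W Rc[OF \<rho>]])
    also have "\<dots> = (\<Oplus>\<alpha>\<in>W d. (?k \<otimes> pairing q a (\<lambda>j. f (\<rho> (d + j)))) \<otimes> ?A \<rho> \<alpha>)"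
    proof (rule K.finsum_cong'[OF refl])
      show "(\<lambda>\<alpha>. (?k \<otimes> pairing q a (\<lambda>j. f (\<rho> (d + j)))) \<otimes> ?A \<rho> \<alpha>) \<in> W d \<rightarrow> carrier K"
        by (intro Pi_I K.m_closed[OF K.m_closed[OF \<chi>c[OF \<rho>] pairing_closed[OF E a f2[OF \<rho>]]] Ac[OF \<rho>]])
      fix \<alpha> assume \<alpha>: "\<alpha> \<in> W d"
      have "(\<Oplus>\<beta>\<in>W q. ?R \<rho> \<alpha> \<beta>) = (\<Oplus>\<beta>\<in>W q. ?k \<otimes> ?B \<rho> \<beta>) \<otimes> ?A \<rho> \<alpha>"
        by (rule K.finsum_ldistr[symmetric, OF finite_W Ac[OF \<rho> \<alpha>]]) (intro Pi_I K.m_closed[OF \<chi>c[OF \<rho>] Bc[OF \<rho>]])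
      also have "(\<Oplus>\<beta>\<in>W q. ?k \<otimes> ?B \<rho> \<beta>) = ?k \<otimes> pairing q a (\<lambda>j. f (\<rho> (d + j)))"
        unfolding pairing_def
        by (rule K.finsum_rdistr[symmetric, OF finite_W \<chi>c[OF \<rho>]]) (intro Pi_I Bc[OF \<rho>])
      finally show "(\<Oplus>\<beta>\<in>W q. ?R \<rho> \<alpha> \<beta>) = (?k \<otimes> pairing q a (\<lambda>j. f (\<rho> (d + j)))) \<otimes> ?A \<rho> \<alpha>" .
    qed
    also have "\<dots> = (?k \<otimes> pairing q a (\<lambda>j. f (\<rho> (d + j)))) \<otimes> pairing d y (\<lambda>i. f (\<rho> i))"
      unfolding pairing_def[of d]
      by (rule K.finsum_rdistr[symmetric, OF finite_W K.m_closed[OF \<chi>c[OF \<rho>] pairing_closed[OF E a f2[OF \<rho>]]]])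
        (intro Pi_I Ac[OF \<rho>])
    finally show "(\<Oplus>z\<in>W d \<times> W q. ?R \<rho> (fst z) (snd z)) = (?k \<otimes> pairing q a (\<lambda>j. f (\<rho> (d + j)))) \<otimes> pairing d y (\<lambda>i. f (\<rho> i))" .
  qed
  finally show ?thesis .
qed

text \<open>Both sides of the characteristic equation are linear in the left factor, so it may be
  checked on decomposable vectors. Two solutions differ by a form orthogonal to everything, which is
  zero by nondegeneracy.\<close>

lemma left_innerI:
  assumes E: "module K E" and fb: "finite_basis K E B" and r: "rational_ring K"
    and a: "a \<in> carrier (chi_sum K W \<chi> E)" and f: "f \<in> carrier (chi_sum K W \<chi> (dual_module K E))"
    and g: "g \<in> carrier (chi_sum K W \<chi> (dual_module K E))"
    and eq: "\<And>d y. y \<in> tuples E d \<Longrightarrow> chi_form K W \<chi> E (chi_mult K W \<chi> E (chi_dec K W \<chi> E d y) a) f =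
      chi_form K W \<chi> E (chi_dec K W \<chi> E d y) g"
  shows "left_inner K W \<chi> E a f = g"
proof -
  let ?D = "dual_module K E"
  let ?A = "chi_sum K W \<chi> E" and ?S = "chi_sum K W \<chi> ?D" and ?fo = "chi_form K W \<chi> E"
  have D: "module K ?D" by (rule module_dual[OF E])
  have A: "module K ?A" by (rule module_chi_sum[OF E])
  have SM: "module K (self_module K)" by (rule module_self_module[OF cring_K])
  interpret A: module K ?A by (rule A)
  interpret S: module K ?S by (rule module_chi_sum[OF D])
  note \<mu> = chi_mult_linear[OF E] and \<beta> = chi_form_bilinear[OF E]
  have mc: "chi_mult K W \<chi> E x a \<in> carrier ?A" if "x \<in> carrier ?A" for x
    using linear_closed[OF linear_closed[OF \<mu> that, simplified] a] .
  note \<mu>l = bilinear_left_linear[OF \<mu> a] and \<beta>f = bilinear_left_linear[OF \<beta> f, simplified] and \<beta>g = bilinear_left_linear[OF \<beta> g, simplified]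
  have 1: "(\<lambda>x\<in>carrier ?A. ?fo (chi_mult K W \<chi> E x a) f) \<in> linear_maps K ?A (self_module K)"
  proof (rule linear_maps_restrictI[OF A])
    show "?fo (chi_mult K W \<chi> E x a) f \<in> carrier (self_module K)" if "x \<in> carrier ?A" for x
      using linear_closed[OF linear_closed[OF \<beta> mc[OF that], simplified] f] .
  qed (simp_all add: \<mu>l \<beta>f mc)
  have 2: "(\<lambda>x\<in>carrier ?A. ?fo x g) \<in> linear_maps K ?A (self_module K)"
  proof (rule linear_maps_restrictI[OF A])
    show "?fo x g \<in> carrier (self_module K)" if "x \<in> carrier ?A" for x
      using linear_closed[OF linear_closed[OF \<beta> that, simplified] g] .
  qed (simp_all add: \<beta>g)
  have "(\<lambda>x\<in>carrier ?A. ?fo (chi_mult K W \<chi> E x a) f) = (\<lambda>x\<in>carrier ?A. ?fo x g)"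
    by (rule chi_linear_eqI[OF E SM 1 2]) (simp add: eq chi_dec_tuples_closed[OF E E])
  note fe = fun_cong[OF this]
  have gg: "?fo (chi_mult K W \<chi> E x a) f = ?fo x g" if "x \<in> carrier ?A" for x
    using fe[of x] that by simp
  show ?thesis
    unfolding left_inner_def chi_algebra_simps
  proof (rule the_equality)
    show "g \<in> carrier ?S \<and> (\<forall>x\<in>carrier ?A. ?fo (chi_mult K W \<chi> E x a) f = ?fo x g)" using g gg by blast
    fix h assume h: "h \<in> carrier ?S \<and> (\<forall>x\<in>carrier ?A. ?fo (chi_mult K W \<chi> E x a) f = ?fo x h)"
    have "h \<ominus>\<^bsub>?S\<^esub> g = \<zero>\<^bsub>?S\<^esub>"
    proof (rule chi_form_nondegenerate[OF E fb r])
      show "h \<ominus>\<^bsub>?S\<^esub> g \<in> carrier ?S" using h g by simp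
      fix x assume x: "x \<in> carrier ?A"
      have l: "?fo x \<in> linear_maps K ?S (self_module K)" using linear_closed[OF \<beta> x] by simp
      have "?fo x (h \<ominus>\<^bsub>?S\<^esub> g) = ?fo x h \<ominus>\<^bsub>self_module K\<^esub> ?fo x g"
        using linear_minus[OF module_chi_sum[OF D] SM l] h g by blast
      moreover have "?fo x h = ?fo x g" using gg[OF x] h x by metis
      moreover have "?fo x g \<in> carrier (self_module K)" using linear_closed[OF l g] .
      ultimately show "?fo x (h \<ominus>\<^bsub>?S\<^esub> g) = \<zero>"
        using minus_eq_zero_iff[of "self_module K"] SM by (simp add: module_def)
    qed
    then show "h = g" using minus_eq_zero_iff[OF S.M.abelian_group_axioms] h g by blast
  qed
qed

end

theorem proposition23:
  fixes K :: "('k, 'r) ring_scheme"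
    and W :: "nat \<Rightarrow> (nat \<Rightarrow> nat) set"
    and \<chi> :: "nat \<Rightarrow> (nat \<Rightarrow> nat) \<Rightarrow> 'k"
    and E :: "('k, 'e, 'm) module_scheme"
    and d :: int and q n :: nat
    and a :: "nat \<Rightarrow> 'e" and f :: "nat \<Rightarrow> 'e \<Rightarrow> 'k"
  assumes "domain K" and "rational_ring K"
    and "omega_invariant K W \<chi>"
    and "module K E" and "\<exists>B. finite_basis K E B"
    and "int n = d + int q"
    and "a \<in> {1..q} \<rightarrow> carrier E"
    and "f \<in> {1..n} \<rightarrow> carrier (dual_module K E)"
  shows "(n \<ge> q \<longrightarrow>
      left_inner K W \<chi> E (chi_dec K W \<chi> E q a) (chi_dec K W \<chi> (dual_module K E) n f) =
      (\<Oplus>\<^bsub>chi_algebra K W \<chi> (dual_module K E)\<^esub>\<rho>\<in>min_reps W n (nat d) q.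
        (\<chi> n \<rho> \<otimes>\<^bsub>K\<^esub>
          chi_form K W \<chi> E (chi_dec K W \<chi> E q a)
            (chi_dec K W \<chi> (dual_module K E) q (\<lambda>j. f (\<rho> (nat d + j)))))
        \<odot>\<^bsub>chi_algebra K W \<chi> (dual_module K E)\<^esub>
        chi_dec K W \<chi> (dual_module K E) (nat d) (\<lambda>i. f (\<rho> i)))) \<and>
    (n < q \<longrightarrow>
      left_inner K W \<chi> E (chi_dec K W \<chi> E q a) (chi_dec K W \<chi> (dual_module K E) n f) =
      \<zero>\<^bsub>chi_algebra K W \<chi> (dual_module K E)\<^esub>)"
proof -
  interpret character_sequence K W \<chi>
    using assms(1,3) by (simp add: character_sequence_def domain_def)
  note E = assms(4) and a = assms(7) and f = assms(8)
  obtain B where fb: "finite_basis K E B" using assms(5) by blast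
  let ?D = "dual_module K E"
  let ?S = "chi_sum K W \<chi> ?D" and ?A = "chi_sum K W \<chi> E" and ?fo = "chi_form K W \<chi> E"
  have D: "module K ?D" by (rule module_dual[OF E])
  have SM: "module K (self_module K)" by (rule module_self_module[OF cring_K])
  interpret S: module K ?S by (rule module_chi_sum[OF D])
  note ac = chi_dec_closed[OF E a] and fc = chi_dec_closed[OF D f]
  \<comment> \<open>Multiplication by the q-vector raises the degree by q, so only vectors of a
    degree e with e + q = n can contribute.\<close>
  have prod: "?fo (chi_mult K W \<chi> E (chi_dec K W \<chi> E e y) (chi_dec K W \<chi> E q a)) (chi_dec K W \<chi> ?D n f) =
      (if e + q = n then pairing n (\<lambda>t. if t \<le> e then y t else a (t - e)) f else \<zero>\<^bsub>K\<^esub>)"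
    if y: "y \<in> {1..e} \<rightarrow> carrier E" for e y
  proof -
    have "(\<lambda>t. if t \<le> e then y t else a (t - e)) \<in> {1..e + q} \<rightarrow> carrier E"
    proof
      fix t assume t: "t \<in> {1..e + q}"
      show "(if t \<le> e then y t else a (t - e)) \<in> carrier E"
      proof (cases "t \<le> e")
        case True
        then show ?thesis using t y by auto
      next
        case False
        then have "t - e \<in> {1..q}" using t by auto
        then show ?thesis using False a by auto
      qed
    qed
    from chi_form_dec[OF E this f] show ?thesis unfolding chi_mult_dec[OF E y a] by auto
  qed
  show ?thesis
  proof (intro conjI impI)
    assume "q \<le> n"
    \<comment> \<open>Under q \<le> n the integer d is nonnegative, so the conversion truncates
      nothing and n = m + q.\<close>
    define m where "m = nat d"
    have n: "n = m + q" using assms(6) \<open>q \<le> n\<close> by (simp add: m_def)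
    let ?M = "min_reps W n m q"
    let ?c = "\<lambda>\<rho>. \<chi> n \<rho> \<otimes>\<^bsub>K\<^esub> ?fo (chi_dec K W \<chi> E q a) (chi_dec K W \<chi> ?D q (\<lambda>j. f (\<rho> (m + j))))"
    let ?v = "\<lambda>\<rho>. chi_dec K W \<chi> ?D m (\<lambda>i. f (\<rho> i))"
    have \<rho>n: "\<rho> s \<in> {1..n}" if "\<rho> \<in> ?M" "s \<in> {1..n}" for \<rho> s
      using that permutes_in_image[OF W_permutes[OF min_repsE(1)]] unfolding n by blast
    have f1: "(\<lambda>i. f (\<rho> i)) \<in> {1..m} \<rightarrow> carrier ?D" if \<rho>: "\<rho> \<in> ?M" for \<rho>
      by (rule Pi_I, rule funcset_mem[OF f], rule \<rho>n[OF \<rho>]) (auto simp: n)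
    have f2: "(\<lambda>j. f (\<rho> (m + j))) \<in> {1..q} \<rightarrow> carrier ?D" if \<rho>: "\<rho> \<in> ?M" for \<rho>
      by (rule Pi_I, rule funcset_mem[OF f], rule \<rho>n[OF \<rho>]) (auto simp: n)
    have fo: "?fo (chi_dec K W \<chi> E q a) (chi_dec K W \<chi> ?D q (\<lambda>j. f (\<rho> (m + j)))) = pairing q a (\<lambda>j. f (\<rho> (m + j)))"
      if "\<rho> \<in> ?M" for \<rho> using chi_form_dec[OF E a f2[OF that]] by simp
    have cc: "?c \<rho> \<in> carrier K" if "\<rho> \<in> ?M" for \<rho>
      using fo[OF that] pairing_closed[OF E a f2[OF that]] chi_closed[OF min_repsE(1)] that n by simp
    have vc: "?v \<rho> \<in> carrier ?S" if "\<rho> \<in> ?M" for \<rho> using chi_dec_closed[OF D f1[OF that]] .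
    have sc: "(\<lambda>\<rho>. ?c \<rho> \<odot>\<^bsub>?S\<^esub> ?v \<rho>) \<in> ?M \<rightarrow> carrier ?S" using cc vc by blast
    have "left_inner K W \<chi> E (chi_dec K W \<chi> E q a) (chi_dec K W \<chi> ?D n f) = (\<Oplus>\<^bsub>?S\<^esub>\<rho>\<in>?M. ?c \<rho> \<odot>\<^bsub>?S\<^esub> ?v \<rho>)"
    proof (rule left_innerI[OF E fb assms(2) ac fc S.M.finsum_closed[OF sc]])
      fix e y assume "y \<in> tuples E e"
      then have y: "y \<in> {1..e} \<rightarrow> carrier E" by (rule tuples_Pi[OF E])
      have l: "?fo (chi_dec K W \<chi> E e y) \<in> linear_maps K ?S (self_module K)"
        using linear_closed[OF chi_form_bilinear[OF E] chi_dec_closed[OF E y]] by simp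
      have pc: "pairing m y (\<lambda>i. f (\<rho> i)) \<in> carrier K" if "\<rho> \<in> ?M" "e = m" for \<rho>
        using pairing_closed[OF E y] f1[OF that(1)] that(2) by simp
      have "?fo (chi_dec K W \<chi> E e y) (\<Oplus>\<^bsub>?S\<^esub>\<rho>\<in>?M. ?c \<rho> \<odot>\<^bsub>?S\<^esub> ?v \<rho>) =
          (\<Oplus>\<^bsub>K\<^esub>\<rho>\<in>?M. ?fo (chi_dec K W \<chi> E e y) (?c \<rho> \<odot>\<^bsub>?S\<^esub> ?v \<rho>))"
        using linear_finsum[OF module_chi_sum[OF D] SM l sc] by simp
      \<comment> \<open>The proposed form is homogeneous of degree m, so it pairs to zero with
        vectors of any other degree; for e = m the sum is the Laplace expansion.\<close>
      also have "\<dots> = (\<Oplus>\<^bsub>K\<^esub>\<rho>\<in>?M. if e = m then (\<chi> n \<rho> \<otimes>\<^bsub>K\<^esub> pairing q a (\<lambda>j. f (\<rho> (m + j)))) \<otimes>\<^bsub>K\<^esub> pairing m y (\<lambda>i. f (\<rho> i)) else \<zero>\<^bsub>K\<^esub>)"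
      proof (rule K.finsum_cong'[OF refl])
        show "(\<lambda>\<rho>. if e = m then (\<chi> n \<rho> \<otimes>\<^bsub>K\<^esub> pairing q a (\<lambda>j. f (\<rho> (m + j)))) \<otimes>\<^bsub>K\<^esub> pairing m y (\<lambda>i. f (\<rho> i)) else \<zero>\<^bsub>K\<^esub>) \<in> ?M \<rightarrow> carrier K"
          using cc fo pc by auto
        fix \<rho> assume \<rho>: "\<rho> \<in> ?M"
        show "?fo (chi_dec K W \<chi> E e y) (?c \<rho> \<odot>\<^bsub>?S\<^esub> ?v \<rho>) =
            (if e = m then (\<chi> n \<rho> \<otimes>\<^bsub>K\<^esub> pairing q a (\<lambda>j. f (\<rho> (m + j)))) \<otimes>\<^bsub>K\<^esub> pairing m y (\<lambda>i. f (\<rho> i)) else \<zero>\<^bsub>K\<^esub>)"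
          using linear_smult[OF l cc[OF \<rho>] vc[OF \<rho>]] chi_form_dec[OF E y f1[OF \<rho>]] cc[OF \<rho>] fo[OF \<rho>] by auto
      qed
      also have "\<dots> = (if e + q = n then pairing n (\<lambda>t. if t \<le> e then y t else a (t - e)) f else \<zero>\<^bsub>K\<^esub>)"
      proof (cases "e = m")
        case True
        then show ?thesis using pairing_laplace[OF E y a] f n by simp
      qed (simp add: n)
      finally show "?fo (chi_mult K W \<chi> E (chi_dec K W \<chi> E e y) (chi_dec K W \<chi> E q a)) (chi_dec K W \<chi> ?D n f) =
          ?fo (chi_dec K W \<chi> E e y) (\<Oplus>\<^bsub>?S\<^esub>\<rho>\<in>?M. ?c \<rho> \<odot>\<^bsub>?S\<^esub> ?v \<rho>)"
        using prod[OF y] by simp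
    qed
    then show "left_inner K W \<chi> E (chi_dec K W \<chi> E q a) (chi_dec K W \<chi> (dual_module K E) n f) =
      (\<Oplus>\<^bsub>chi_algebra K W \<chi> (dual_module K E)\<^esub>\<rho>\<in>min_reps W n (nat d) q.
        (\<chi> n \<rho> \<otimes>\<^bsub>K\<^esub>
          chi_form K W \<chi> E (chi_dec K W \<chi> E q a)
            (chi_dec K W \<chi> (dual_module K E) q (\<lambda>j. f (\<rho> (nat d + j)))))
        \<odot>\<^bsub>chi_algebra K W \<chi> (dual_module K E)\<^esub>
        chi_dec K W \<chi> (dual_module K E) (nat d) (\<lambda>i. f (\<rho> i)))"
      unfolding finsum_chi_algebra chi_algebra_simps m_def .
  next
    assume "n < q"
    have "left_inner K W \<chi> E (chi_dec K W \<chi> E q a) (chi_dec K W \<chi> ?D n f) = \<zero>\<^bsub>?S\<^esub>"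
    proof (rule left_innerI[OF E fb assms(2) ac fc S.M.zero_closed])
      fix e y assume "y \<in> tuples E e"
      then have y: "y \<in> {1..e} \<rightarrow> carrier E" by (rule tuples_Pi[OF E])
      have l: "?fo (chi_dec K W \<chi> E e y) \<in> linear_maps K ?S (self_module K)"
        using linear_closed[OF chi_form_bilinear[OF E] chi_dec_closed[OF E y]] by simp
      \<comment> \<open>No e satisfies e + q = n when n < q, so both sides vanish and the zero form
        solves the characteristic equation.\<close>
      show "?fo (chi_mult K W \<chi> E (chi_dec K W \<chi> E e y) (chi_dec K W \<chi> E q a)) (chi_dec K W \<chi> ?D n f) =
          ?fo (chi_dec K W \<chi> E e y) \<zero>\<^bsub>?S\<^esub>"
        using prod[OF y] linear_zero[OF module_chi_sum[OF D] SM l] \<open>n < q\<close> by simp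
    qed
    then show "left_inner K W \<chi> E (chi_dec K W \<chi> E q a) (chi_dec K W \<chi> (dual_module K E) n f) =
      \<zero>\<^bsub>chi_algebra K W \<chi> (dual_module K E)\<^esub>"
      unfolding chi_algebra_simps .
  qed
qed

end
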